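(* Let $\delta\ge0$, $\delta\ne1$, and let $T^\ell$ be an operator on $\mathbb{R}^2$ with Fourier multiplier $m^\ell$ ($\ell=1,2$) that is homogeneous of degree $-1+2\delta$ (not necessarily smooth away from $0$). If there is a constant $C$ such that the nonlinearity $B(\psi,\theta)=\int_{\mathbb{R}^2}\psi\,T^\ell\theta\,\nabla_\ell\theta\,dx$ satisfies $$|B(\psi,\theta)|\le C\,\|\mathring{\nabla}^2\psi\|_{L^\infty}\,\|\theta\|_{\dot H^{-1+\delta}}^2$$ for all $\psi\in C_c^\infty(\mathbb{R}^2)$ and $\theta\in\mathcal{S}_0(\mathbb{R}^2)$, then $T^\ell$ is a constant multiple of the mSQG Biot–Savart law $-\epsilon^{\ell a}\nabla_a(-\Delta)^{-1+\delta}$.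
   Context: Repeated indices are summed; $\epsilon^{j\ell}=-\epsilon^{\ell j}$, $\epsilon^{12}=1$; $\widehat{T^\ell\theta}(\xi)=m^\ell(\xi)\hat\theta(\xi)$. The components $m^\ell$ are homogeneous distributions away from the origin in frequency space (so that $m^\ell\hat\theta$ makes sense for $\theta\in\mathcal{S}_0$) and satisfy the reality condition $m(-\xi)=\overline{m(\xi)}$. $\mathring{\nabla}^2_{j\ell}\psi=\nabla_j\nabla_\ell\psi-\tfrac12\Delta\psi\,\delta_{j\ell}$ is the trace-free part of the Hessian ($\delta_{j\ell}$ the Kronecker delta). $\mathcal{S}_0(\mathbb{R}^2)$ is the set of Schwartz functions $f$ for which $\mathrm{supp}\,\hat f$ is a compact subset of $\mathbb{R}^2\setminus\{0\}$. Littlewood–Paley projections: $P_{\le 0}$ has smooth symbol $\hat\chi_{\le0}$ equal to $1$ for $|\xi|\le1/2$ and supported in $|\xi|\le1$; $P_{\le q}$ has symbol $\hat\chi_{\le0}(2^{-q}\xi)$ and $P_q=P_{\le q+1}-P_{\le q}$, $q\in\mathbb{Z}$. The norm is $\|\theta\|_{\dot H^s}^2=\sum_{q}(2^{sq}\|P_q\theta\|_{L^2})^2$. *)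

theory Defs
  imports "HOL-Probability.Probability"
begin

section \<open>Smooth functions on the plane\<close>

type_synonym plane = "real ^ 2"

definition pd :: "2 \<Rightarrow> (plane \<Rightarrow> 'b::real_normed_vector) \<Rightarrow> plane \<Rightarrow> 'b" where
  "pd j f x = vector_derivative (\<lambda>t. f (x + t *\<^sub>R axis j 1)) (at 0)"

text \<open>A multi-index is a list of directions; the same derivative is listed once for each order
  in which its directions can be taken.\<close>

definition pds :: "2 list \<Rightarrow> (plane \<Rightarrow> 'b::real_normed_vector) \<Rightarrow> plane \<Rightarrow> 'b" where
  "pds js f = foldr pd js f"

definition smooth :: "(plane \<Rightarrow> 'b::real_normed_vector) \<Rightarrow> bool" where
  "smooth f \<longleftrightarrow> (\<forall>js x. pds js f differentiable (at x))"

definition supp :: "(plane \<Rightarrow> 'b::zero) \<Rightarrow> plane set" where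
  "supp f = closure {x. f x \<noteq> 0}"

definition Cc_infty :: "(plane \<Rightarrow> 'b::real_normed_vector) set" where
  "Cc_infty = {f. smooth f \<and> compact (supp f)}"

definition schwartz :: "(plane \<Rightarrow> complex) set" where
  "schwartz = {f. smooth f \<and> (\<forall>k js. \<exists>C. \<forall>x. norm x ^ k * norm (pds js f x) \<le> C)}"


section \<open>Fourier transform and the space \<open>S\<^sub>0\<close>\<close>

definition fourier :: "(plane \<Rightarrow> complex) \<Rightarrow> plane \<Rightarrow> complex" where
  "fourier f \<xi> = (\<integral>x. cis (- (x \<bullet> \<xi>)) * f x \<partial>lborel)"

definition inv_fourier :: "(plane \<Rightarrow> complex) \<Rightarrow> plane \<Rightarrow> complex" where
  "inv_fourier g x = (\<integral>\<xi>. cis (x \<bullet> \<xi>) * g \<xi> \<partial>lborel) / complex_of_real ((2 * pi)\<^sup>2)"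

definition multiplier :: "(plane \<Rightarrow> complex) \<Rightarrow> (plane \<Rightarrow> complex) \<Rightarrow> plane \<Rightarrow> complex" where
  "multiplier \<sigma> f = inv_fourier (\<lambda>\<xi>. \<sigma> \<xi> * fourier f \<xi>)"

definition S0 :: "(plane \<Rightarrow> complex) set" where
  "S0 = {f \<in> schwartz. compact (supp (fourier f)) \<and> supp (fourier f) \<subseteq> - {0}}"


section \<open>Distributions on the punctured frequency plane\<close>

type_synonym distr = "(plane \<Rightarrow> complex) \<Rightarrow> complex"

definition test_fun :: "(plane \<Rightarrow> complex) set" where
  "test_fun = {\<phi> \<in> Cc_infty. supp \<phi> \<subseteq> - {0}}"

text \<open>Only the values on \<^const>\<open>test_fun\<close> are meaningful. The bound is the usual
  characterisation of continuity by seminorms, on each compact subset of the punctured plane.\<close>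

definition distribution :: "distr \<Rightarrow> bool" where
  "distribution u \<longleftrightarrow>
     (\<forall>\<phi>\<in>test_fun. \<forall>\<psi>\<in>test_fun. \<forall>a b. u (\<lambda>\<xi>. a * \<phi> \<xi> + b * \<psi> \<xi>) = a * u \<phi> + b * u \<psi>) \<and>
     (\<forall>K. compact K \<and> K \<subseteq> - {0} \<longrightarrow>
        (\<exists>C N. \<forall>\<phi>\<in>test_fun. supp \<phi> \<subseteq> K \<longrightarrow>
           norm (u \<phi>) \<le> C * (\<Sum>js | length js \<le> N. SUP \<xi>. norm (pds js \<phi> \<xi>))))"

text \<open>For a locally integrable function \<open>m\<close> acting by \<open>\<phi> \<mapsto> \<integral> m \<phi>\<close>, the next two conditions
  are \<open>m (r \<xi>) = r powr d * m \<xi>\<close> for \<open>r > 0\<close> (substitute \<open>\<xi> = r \<eta>\<close>, with Jacobian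
  \<open>r\<^sup>2\<close>) and \<open>m (- \<xi>) = cnj (m \<xi>)\<close>.\<close>

definition homogeneous_distr :: "real \<Rightarrow> distr \<Rightarrow> bool" where
  "homogeneous_distr d u \<longleftrightarrow>
     (\<forall>r>0. \<forall>\<phi>\<in>test_fun. u (\<lambda>\<xi>. \<phi> ((1 / r) *\<^sub>R \<xi>)) = complex_of_real (r powr (d + 2)) * u \<phi>)"

definition reality_cond :: "distr \<Rightarrow> bool" where
  "reality_cond u \<longleftrightarrow> (\<forall>\<phi>\<in>test_fun. u (\<lambda>\<xi>. \<phi> (- \<xi>)) = cnj (u (\<lambda>\<xi>. cnj (\<phi> \<xi>))))"

definition mult_distr :: "distr \<Rightarrow> (plane \<Rightarrow> complex) \<Rightarrow> distr" where
  "mult_distr u g = (\<lambda>\<phi>. u (\<lambda>\<xi>. g \<xi> * \<phi> \<xi>))"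

text \<open>The inverse Fourier transform of a compactly supported distribution is the smooth function
  obtained by pairing it with exponentials. For \<open>\<theta> \<in> S0\<close> the product \<open>fourier \<theta> * cis (x \<bullet> _)\<close>
  is a test function on the punctured plane, so the operator below only uses meaningful values
  of \<open>m\<close>.\<close>

definition inv_fourier_distr :: "distr \<Rightarrow> plane \<Rightarrow> complex" where
  "inv_fourier_distr u x = u (\<lambda>\<xi>. cis (x \<bullet> \<xi>)) / complex_of_real ((2 * pi)\<^sup>2)"

definition distr_multiplier :: "distr \<Rightarrow> (plane \<Rightarrow> complex) \<Rightarrow> plane \<Rightarrow> complex" where
  "distr_multiplier m \<theta> = inv_fourier_distr (mult_distr m (fourier \<theta>))"


section \<open>The modified SQG Biot--Savart law\<close>

definition eps :: "2 \<Rightarrow> 2 \<Rightarrow> real" where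
  "eps j l = (if j = 1 \<and> l = 2 then 1 else if j = 2 \<and> l = 1 then - 1 else 0)"

text \<open>\<open>(- \<Delta>)\<^sup>s\<close>, intended for functions in \<^const>\<open>S0\<close> (any real \<open>s\<close>).\<close>

definition frac_laplacian :: "real \<Rightarrow> (plane \<Rightarrow> complex) \<Rightarrow> plane \<Rightarrow> complex" where
  "frac_laplacian s = multiplier (\<lambda>\<xi>. complex_of_real (norm \<xi> powr (2 * s)))"

definition biot_savart :: "real \<Rightarrow> 2 \<Rightarrow> (plane \<Rightarrow> complex) \<Rightarrow> plane \<Rightarrow> complex" where
  "biot_savart \<delta> l \<theta> x =
     - (\<Sum>a\<in>UNIV. complex_of_real (eps l a) * pd a (frac_laplacian (- 1 + \<delta>) \<theta>) x)"


section \<open>Norms\<close>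

definition L2_norm :: "(plane \<Rightarrow> complex) \<Rightarrow> real" where
  "L2_norm f = sqrt (\<integral>x. (norm (f x))\<^sup>2 \<partial>lborel)"

definition Linfty_norm :: "(plane \<Rightarrow> 'b::real_normed_vector) \<Rightarrow> real" where
  "Linfty_norm f = real_of_ereal (esssup lborel (\<lambda>x. ereal (norm (f x))))"

definition LP_cutoff :: "(plane \<Rightarrow> complex) \<Rightarrow> bool" where
  "LP_cutoff c \<longleftrightarrow> smooth c \<and> (\<forall>\<xi>. norm \<xi> \<le> 1 / 2 \<longrightarrow> c \<xi> = 1) \<and> supp c \<subseteq> cball 0 1"

definition P_le :: "(plane \<Rightarrow> complex) \<Rightarrow> int \<Rightarrow> (plane \<Rightarrow> complex) \<Rightarrow> plane \<Rightarrow> complex" where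
  "P_le c q = multiplier (\<lambda>\<xi>. c ((2 powi (- q)) *\<^sub>R \<xi>))"

definition P_at :: "(plane \<Rightarrow> complex) \<Rightarrow> int \<Rightarrow> (plane \<Rightarrow> complex) \<Rightarrow> plane \<Rightarrow> complex" where
  "P_at c q \<theta> x = P_le c (q + 1) \<theta> x - P_le c q \<theta> x"

definition Hdot_norm :: "(plane \<Rightarrow> complex) \<Rightarrow> real \<Rightarrow> (plane \<Rightarrow> complex) \<Rightarrow> real" where
  "Hdot_norm c s \<theta> =
     sqrt (\<Sum>\<^sub>\<infinity>q\<in>UNIV. (2 powr (s * real_of_int q) * L2_norm (P_at c q \<theta>))\<^sup>2)"

text \<open>The norm of a matrix (type \<open>real ^ 2 ^ 2\<close>) is the Euclidean norm of its entries.\<close>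

definition tf_hessian :: "(plane \<Rightarrow> real) \<Rightarrow> plane \<Rightarrow> real ^ 2 ^ 2" where
  "tf_hessian \<psi> x =
     (\<chi> j l. pd j (pd l \<psi>) x - 1 / 2 * (\<Sum>a\<in>UNIV. pd a (pd a \<psi>) x) * (if j = l then 1 else 0))"


section \<open>The nonlinearity\<close>

definition B_form :: "(2 \<Rightarrow> distr) \<Rightarrow> (plane \<Rightarrow> real) \<Rightarrow> (plane \<Rightarrow> complex) \<Rightarrow> complex" where
  "B_form m \<psi> \<theta> =
     (\<integral>x. (\<Sum>l\<in>UNIV. complex_of_real (\<psi> x) * distr_multiplier (m l) \<theta> x * pd l \<theta> x) \<partial>lborel)"

end

theory Submission
  imports Defs
begin

text \<open>The weights \<open>1\<close>, \<open>x\<^sub>j\<close> and \<open>|x|\<^sup>2\<close> have vanishing trace-free Hessian. Cut off logarithmically, they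
  become admissible in the bound with a trace-free Hessian tending to \<open>0\<close>, so
  \<open>B(\<psi>, \<theta>) = 0\<close> for each of these \<open>\<psi>\<close>. On the Fourier side each of these identities
  is a quadratic form in the Fourier transform of \<open>\<theta>\<close>. It is polarised, and one argument is taken to
  be an even cutoff equal to \<open>1\<close> near the support of the other. With \<open>u = \<xi>\<^sub>1 m\<^sup>1 + \<xi>\<^sub>2 m\<^sup>2\<close>, the
  weight \<open>1\<close> says that \<open>u\<close> is odd, and \<open>x\<^sub>j\<close> says that twice the even part of \<open>m\<^sup>j\<close> is the
  distributional derivative \<open>\<partial>\<^sub>j u\<close>. Contracting with \<open>\<xi>\<^sub>j\<close>, Euler's identity for the homogeneous \<open>u\<close>
  gives \<open>(2 - 2 \<delta>) u = 0\<close>; hence \<open>u = 0\<close> and \<open>m\<close> is odd. The weight \<open>|x|\<^sup>2\<close> then gives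
  \<open>\<partial>\<^sub>1 m\<^sup>1 + \<partial>\<^sub>2 m\<^sup>2 = 0\<close>. Therefore \<open>f = \<xi>\<^sub>2 m\<^sup>1 - \<xi>\<^sub>1 m\<^sup>2\<close> has no angular derivative. Being also
  homogeneous of degree \<open>2 \<delta>\<close>, it is a multiple of \<open>|\<xi>|\<close> to the power \<open>2 \<delta>\<close>, by averaging over the
  multiplicative group of complex numbers. This determines \<open>m\<close> up to a constant, and the reality condition
  makes the constant in \<open>m\<close> purely imaginary.\<close>

text \<open>The components of \<open>m\<close> are only distributions, so nothing can be evaluated
  at a point: every identity is tested, and each exchange of \<open>m l\<close> with an integral
  (Parseval, the flow of the group, the group average) passes through \<open>interchange\<close>.
  The Sobolev factor is merely a number once \<theta> is fixed; what is exploited is that the other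
  factor can be sent to 0. A cutoff at one scale would not do this: for |x|^2 cut off at radius R
  the trace-free Hessian stays of order 1, which is why the transition is spread over a logarithmic
  range. Since the bound speaks of real \<theta> only, the quadratic identities hold first for
  Hermitian symmetric Fourier transforms, and polarisation includes a passage to complex
  combinations. The value \<delta> = 1 is excluded because the contracted identity then says nothing
  about u: Euler's identity contributes -(2 \<delta> + 2) and cancels exactly the 4 collected from
  the other terms.\<close>

section \<open>Partial derivatives and smooth functions on the plane\<close>

lemma pd_eqI:
  assumes "(f has_derivative f') (at x)" shows "pd j f x = f' (axis j 1)"
proof -
  have "((\<lambda>t. f (x + t *\<^sub>R axis j 1)) has_derivative (\<lambda>t. f' (t *\<^sub>R axis j 1))) (at 0)"
    by (rule has_derivative_compose[of "\<lambda>t. x + t *\<^sub>R axis j 1" "\<lambda>t. t *\<^sub>R axis j 1" 0 UNIV f f', simplified])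
      (auto intro!: derivative_eq_intros assms)
  moreover have "f' (t *\<^sub>R axis j 1) = t *\<^sub>R f' (axis j 1)" for t
    using has_derivative_bounded_linear[OF assms] by (simp add: linear_simps)
  ultimately show ?thesis
    by (simp add: pd_def has_vector_derivative_def vector_derivative_at)
qed

lemma pds_Nil [simp]: "pds [] f = f" by (simp add: pds_def)
lemma pds_Cons [simp]: "pds (j # js) f = pd j (pds js f)" by (simp add: pds_def)
lemma pds_append: "pds (js @ ks) f = pds js (pds ks f)" by (simp add: pds_def)

text \<open>A class of differentiable functions that is stable under \<open>pd\<close> contains
  every iterated partial derivative of its members; exhibiting such a class replaces an induction
  over multi-indices in each smoothness proof.\<close>

lemma smooth_coinduct:
  assumes "P f" and "\<And>f x. P f \<Longrightarrow> f differentiable (at x)" and "\<And>f j. P f \<Longrightarrow> P (pd j f)"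
  shows "smooth f"
proof -
  have "P (pds js f)" for js by (induction js) (auto simp: assms)
  then show ?thesis by (auto simp: smooth_def assms)
qed

lemma smooth_differentiable: "smooth f \<Longrightarrow> f differentiable (at x)"
  unfolding smooth_def by (metis pds_Nil)

lemma smooth_pds: "smooth f \<Longrightarrow> smooth (pds js f)"
  unfolding smooth_def by (metis pds_append)

lemma smooth_pd: "smooth f \<Longrightarrow> smooth (pd j f)"
  using smooth_pds[of f "[j]"] by simp

lemma smooth_isCont: "smooth f \<Longrightarrow> isCont f x"
  by (simp add: differentiable_imp_continuous_within smooth_differentiable)

lemma smooth_continuous_on: "smooth f \<Longrightarrow> continuous_on A f"
  by (simp add: continuous_at_imp_continuous_on smooth_isCont)

lemma smooth_continuous_on_compose:
  "smooth f \<Longrightarrow> continuous_on A g \<Longrightarrow> continuous_on A (\<lambda>x. f (g x))"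
  using continuous_on_compose2 smooth_continuous_on by blast

lemma smooth_measurable: "smooth f \<Longrightarrow> f \<in> borel_measurable borel"
  by (simp add: borel_measurable_continuous_onI smooth_continuous_on)

lemma smooth_has_derivative:
  assumes "smooth f"
  shows "(f has_derivative (\<lambda>h. \<Sum>j\<in>UNIV. h $ j *\<^sub>R pd j f x)) (at x)"
proof -
  obtain f' where f': "(f has_derivative f') (at x)"
    using smooth_differentiable[OF assms, of x] by (auto simp: differentiable_def)
  have "f' h = (\<Sum>j\<in>UNIV. h $ j *\<^sub>R pd j f x)" for h
  proof -
    interpret bounded_linear f' using f' by (rule has_derivative_bounded_linear)
    have "h = (\<Sum>j\<in>UNIV. h $ j *\<^sub>R axis j 1)"
      by (simp add: vec_eq_iff axis_def if_distrib if_distribR cong: if_cong)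
    then have "f' h = f' (\<Sum>j\<in>UNIV. h $ j *\<^sub>R axis j 1)" by simp
    also have "\<dots> = (\<Sum>j\<in>UNIV. h $ j *\<^sub>R pd j f x)"
      by (simp add: sum scaleR pd_eqI[OF f'])
    finally show ?thesis .
  qed
  then have "f' = (\<lambda>h. \<Sum>j\<in>UNIV. h $ j *\<^sub>R pd j f x)" by auto
  then show ?thesis using f' by simp
qed

lemma has_derivative_pd:
  "f differentiable (at x) \<Longrightarrow> ((\<lambda>t. f (x + t *\<^sub>R axis j 1)) has_vector_derivative pd j f x) (at 0)"
  unfolding pd_def vector_derivative_works[symmetric]
  by (rule differentiable_chain_at[of "\<lambda>t. x + t *\<^sub>R axis j 1" 0 f, unfolded o_def])
    (auto intro!: differentiable_add bounded_linear_imp_differentiable bounded_linear_scaleR_left)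

lemma pd_const [simp]: "pd j (\<lambda>x. c) = (\<lambda>x. 0)"
  by (auto simp: fun_eq_iff intro!: pd_eqI[THEN trans] derivative_eq_intros)

lemma pd_component: "pd j (\<lambda>x. x $ i) = (\<lambda>x. if i = j then 1 else 0)"
proof
  fix x :: plane
  have "((\<lambda>x. x $ i) has_derivative (\<lambda>x. x $ i)) (at x)"
    by (rule bounded_linear_imp_has_derivative) (rule bounded_linear_vec_nth)
  from pd_eqI[OF this] show "pd j (\<lambda>x. x $ i) x = (if i = j then 1 else 0)" by (auto simp: axis_def)
qed

lemma pd_add:
  assumes "f differentiable (at x)" "g differentiable (at x)"
  shows "pd j (\<lambda>x. f x + g x) x = pd j f x + pd j g x"
proof -
  from assms obtain f' g' where "(f has_derivative f') (at x)" "(g has_derivative g') (at x)"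
    by (auto simp: differentiable_def)
  then show ?thesis by (auto intro!: pd_eqI[THEN trans] derivative_eq_intros simp: pd_eqI)
qed

lemma pd_mult:
  fixes f g :: "plane \<Rightarrow> 'b::real_normed_algebra"
  assumes "f differentiable (at x)" "g differentiable (at x)"
  shows "pd j (\<lambda>x. f x * g x) x = f x * pd j g x + pd j f x * g x"
proof -
  from assms obtain f' g' where "(f has_derivative f') (at x)" "(g has_derivative g') (at x)"
    by (auto simp: differentiable_def)
  then show ?thesis by (auto intro!: pd_eqI[THEN trans] derivative_eq_intros simp: pd_eqI)
qed

lemma pd_linear:
  assumes "bounded_linear h" "f differentiable (at x)"
  shows "pd j (\<lambda>x. h (f x)) x = h (pd j f x)"
proof -
  from assms obtain f' where f': "(f has_derivative f') (at x)" by (auto simp: differentiable_def)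
  have "((\<lambda>x. h (f x)) has_derivative (\<lambda>x. h (f' x))) (at x)"
    using bounded_linear.has_derivative[OF assms(1) f'] .
  from pd_eqI[OF this] pd_eqI[OF f'] show ?thesis by simp
qed

lemma smooth_const [simp]: "smooth (\<lambda>x. c)"
  by (rule smooth_coinduct[where P="\<lambda>f. \<exists>c. f = (\<lambda>x. c)"]) auto

lemma smooth_linear_and_pds:
  assumes "bounded_linear h" "smooth f"
  shows "smooth (\<lambda>x. h (f x))" "pds js (\<lambda>x. h (f x)) = (\<lambda>x. h (pds js f x))"
proof -
  have *: "(\<lambda>x. h (f x)) differentiable (at x)" if sf: "smooth f" for x f
  proof -
    obtain f' where "(f has_derivative f') (at x)"
      using smooth_differentiable[OF sf, of x] by (auto simp: differentiable_def)
    from bounded_linear.has_derivative[OF assms(1) this] show ?thesis by (auto simp: differentiable_def)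
  qed
  show "smooth (\<lambda>x. h (f x))"
  proof (rule smooth_coinduct[where P="\<lambda>k. \<exists>f. smooth f \<and> k = (\<lambda>x. h (f x))"])
    fix k j assume "\<exists>f. smooth f \<and> k = (\<lambda>x. h (f x))"
    then obtain f where f: "smooth f" "k = (\<lambda>x. h (f x))" by auto
    then have "pd j k = (\<lambda>x. h (pd j f x))" by (auto simp: pd_linear smooth_differentiable assms)
    with f show "\<exists>f. smooth f \<and> pd j k = (\<lambda>x. h (f x))" by (blast intro: smooth_pd)
  qed (use assms in \<open>auto simp: *\<close>)
  show "pds js (\<lambda>x. h (f x)) = (\<lambda>x. h (pds js f x))"
    by (induction js) (auto simp: pd_linear assms smooth_pds smooth_differentiable)
qed

lemmas smooth_linear = smooth_linear_and_pds(1)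
lemmas pds_linear = smooth_linear_and_pds(2)

text \<open>Coinduction up to sums and products: the partial derivatives of members of \<open>Q\<close> may be
  polynomials in members of \<open>Q\<close> and smooth functions.\<close>

inductive alg :: "((plane \<Rightarrow> 'b::real_normed_algebra) \<Rightarrow> bool) \<Rightarrow> (plane \<Rightarrow> 'b) \<Rightarrow> bool" for Q where
  base: "Q f \<Longrightarrow> alg Q f"
| smooth: "smooth f \<Longrightarrow> alg Q f"
| add: "alg Q f \<Longrightarrow> alg Q g \<Longrightarrow> alg Q (\<lambda>x. f x + g x)"
| mult: "alg Q f \<Longrightarrow> alg Q g \<Longrightarrow> alg Q (\<lambda>x. f x * g x)"

text \<open>The Leibniz rule makes the generated algebra itself stable under \<open>pd\<close>, so
  it can serve as the class in \<open>smooth_coinduct\<close>. Typically \<open>Q\<close> describes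
  one function or one family, such as a reciprocal, whose derivatives are polynomials in its members
  with smooth coefficients.\<close>

lemma smooth_alg:
  assumes d: "\<And>f x. Q f \<Longrightarrow> f differentiable (at x)" and p: "\<And>f j. Q f \<Longrightarrow> alg Q (pd j f)"
    and "alg Q f"
  shows "smooth f"
proof (rule smooth_coinduct[where P="alg Q"])
  have d': "f differentiable (at x)" if "alg Q f" for f x
    using that by induction (auto intro: d smooth_differentiable differentiable_add differentiable_mult)
  then show "alg Q f \<Longrightarrow> f differentiable (at x)" for f x .
  show "alg Q (pd j f)" if "alg Q f" for f j
    using that
  proof induction
    case (add f g)
    have "pd j (\<lambda>x. f x + g x) = (\<lambda>x. pd j f x + pd j g x)" by (auto simp: pd_add d' add)
    with add show ?case by (simp add: alg.add)
  next
    case (mult f g)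
    have "pd j (\<lambda>x. f x * g x) = (\<lambda>x. f x * pd j g x + pd j f x * g x)" by (auto simp: pd_mult d' mult)
    with mult show ?case by (auto intro!: alg.add intro: alg.mult)
  qed (auto intro: p smooth_pd alg.smooth)
qed fact

text \<open>Values lie in a normed vector space without a product, hence a separate class of
  functions instead of \<open>alg\<close>.\<close>

lemma smooth_add:
  assumes "smooth f" "smooth g" shows "smooth (\<lambda>x. f x + g x)"
proof (rule smooth_coinduct[where P="\<lambda>k. \<exists>f g. smooth f \<and> smooth g \<and> k = (\<lambda>x. f x + g x)"])
  fix k :: "plane \<Rightarrow> 'a" and j
  assume "\<exists>f g. smooth f \<and> smooth g \<and> k = (\<lambda>x. f x + g x)"
  then obtain f g where fg: "smooth f" "smooth g" "k = (\<lambda>x. f x + g x)" by auto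
  then have "pd j k = (\<lambda>x. pd j f x + pd j g x)" by (auto simp: pd_add smooth_differentiable)
  with fg show "\<exists>f g. smooth f \<and> smooth g \<and> pd j k = (\<lambda>x. f x + g x)" by (blast intro: smooth_pd)
qed (use assms in \<open>auto intro: smooth_differentiable differentiable_add\<close>)

lemma smooth_mult:
  fixes f g :: "plane \<Rightarrow> 'b::real_normed_algebra"
  assumes "smooth f" "smooth g" shows "smooth (\<lambda>x. f x * g x)"
  by (rule smooth_alg[where Q=smooth])
    (use assms in \<open>auto intro: smooth_differentiable smooth_pd alg.intros\<close>)

lemma pds_add:
  assumes "smooth f" "smooth g"
  shows "pds js (\<lambda>x. f x + g x) = (\<lambda>x. pds js f x + pds js g x)"
  by (induction js) (auto simp: pd_add assms smooth_pds smooth_differentiable)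

lemma smooth_minus: "smooth f \<Longrightarrow> smooth (\<lambda>x. - f x)"
  using smooth_linear[of uminus f] by (simp add: bounded_linear_minus bounded_linear_ident)

lemma pds_minus: "smooth f \<Longrightarrow> pds js (\<lambda>x. - f x) = (\<lambda>x. - pds js f x)"
  using pds_linear[of uminus f] by (simp add: bounded_linear_minus bounded_linear_ident)

lemma smooth_diff: "smooth f \<Longrightarrow> smooth g \<Longrightarrow> smooth (\<lambda>x. f x - g x)"
  using smooth_add[of f "\<lambda>x. - g x"] smooth_minus[of g] by simp

lemma pds_diff:
  "smooth f \<Longrightarrow> smooth g \<Longrightarrow> pds js (\<lambda>x. f x - g x) = (\<lambda>x. pds js f x - pds js g x)"
  using pds_add[of f "\<lambda>x. - g x" js] by (simp add: smooth_minus pds_minus)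

lemma smooth_sum: "(\<And>i. i \<in> I \<Longrightarrow> smooth (f i)) \<Longrightarrow> smooth (\<lambda>x. \<Sum>i\<in>I. f i x)"
  by (induction I rule: infinite_finite_induct) (auto intro: smooth_add)

lemma pds_const0 [simp]: "pds js (\<lambda>x. 0) = (\<lambda>x. 0)"
  by (induction js) auto

lemma pds_sum: "(\<And>i. i \<in> I \<Longrightarrow> smooth (f i)) \<Longrightarrow> pds js (\<lambda>x. \<Sum>i\<in>I. f i x) = (\<lambda>x. \<Sum>i\<in>I. pds js (f i) x)"
  by (induction I rule: infinite_finite_induct) (auto simp: pds_add smooth_sum)

lemma smooth_cmult: "smooth f \<Longrightarrow> smooth (\<lambda>x. (c::'b::real_normed_algebra) * f x)"
  by (intro smooth_mult) auto

lemma pds_cmult: "smooth f \<Longrightarrow> pds js (\<lambda>x. (c::'b::real_normed_algebra) * f x) = (\<lambda>x. c * pds js f x)"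
  by (rule pds_linear) (rule bounded_linear_mult_right)

lemma smooth_of_real: "smooth f \<Longrightarrow> smooth (\<lambda>x. of_real (f x) :: 'b::{real_normed_algebra_1})"
  by (rule smooth_linear[OF bounded_linear_of_real])

lemma smooth_component: "smooth (\<lambda>x. x $ i)"
  by (rule smooth_alg[where Q="\<lambda>f. f = (\<lambda>x. x $ i)"])
    (auto intro: alg.intros simp: pd_component intro!: bounded_linear_imp_differentiable bounded_linear_vec_nth)

lemmas smooth_intros = smooth_const smooth_component smooth_add smooth_diff smooth_minus smooth_mult
  smooth_of_real smooth_sum

lemma smooth_norm2: "smooth (\<lambda>x. (norm x)\<^sup>2)"
proof -
  have "(\<lambda>x::plane. (norm x)\<^sup>2) = (\<lambda>x. \<Sum>i\<in>UNIV. x $ i * x $ i)"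
    by (auto simp: power2_norm_eq_inner inner_vec_def)
  then show ?thesis by (auto intro!: smooth_intros)
qed

lemma smooth_inverse:
  fixes f :: "plane \<Rightarrow> 'b::real_normed_field"
  assumes "smooth f" and nz: "\<And>x. f x \<noteq> 0" shows "smooth (\<lambda>x. inverse (f x))"
proof (rule smooth_alg[where Q="\<lambda>k. k = (\<lambda>x. inverse (f x))"])
  have "((\<lambda>x. inverse (f x)) has_derivative (\<lambda>h. - (inverse (f x) * (\<Sum>j\<in>UNIV. h $ j *\<^sub>R pd j f x) * inverse (f x)))) (at x)" for x
    using Deriv.has_derivative_inverse[OF nz smooth_has_derivative[OF assms(1)]] .
  note * = this pd_eqI[OF this]
  show "k differentiable (at x)" if "k = (\<lambda>x. inverse (f x))" for k x
    using *(1) that by (auto simp: differentiable_def)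
  fix k j assume k: "k = (\<lambda>x. inverse (f x))"
  have "pd j k = (\<lambda>x. (- pd j f x) * (inverse (f x) * inverse (f x)))"
    unfolding k *(2) by (auto simp: axis_def if_distrib if_distribR cong: if_cong)
  moreover have "alg (\<lambda>k. k = (\<lambda>x. inverse (f x))) (\<lambda>x. (- pd j f x) * (inverse (f x) * inverse (f x)))"
    by (intro alg.mult alg.smooth smooth_minus smooth_pd assms alg.base refl)
  ultimately show "alg (\<lambda>k. k = (\<lambda>x. inverse (f x))) (pd j k)" by (simp only:)
qed (auto intro: alg.base)

lemma smooth_divide:
  fixes f :: "plane \<Rightarrow> 'b::real_normed_field"
  assumes "smooth f" "smooth g" and "\<And>x. g x \<noteq> 0" shows "smooth (\<lambda>x. f x / g x)"
  using smooth_mult[OF assms(1) smooth_inverse[OF assms(2,3)]] by (simp add: divide_inverse)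

lemma smooth_by_derivative:
  fixes f :: "plane \<Rightarrow> 'b::real_normed_algebra"
  assumes d: "\<And>x. (f has_derivative (\<lambda>h. \<Sum>j\<in>UNIV. h $ j *\<^sub>R g j x)) (at x)" and g: "\<And>j. smooth (g j)"
  shows "smooth f" "pd j f = g j"
proof -
  show *: "pd j f = g j" for j
    by (auto simp: fun_eq_iff pd_eqI[OF d] axis_def if_distrib if_distribR cong: if_cong)
  show "smooth f"
    by (rule smooth_alg[where Q="\<lambda>k. k = f"])
      (auto intro: alg.intros g simp: * intro!: differentiableI[OF d])
qed

text \<open>\<open>smooth\<close> concerns functions on the plane, so the outer function of one
  variable is given by the sequence \<open>h\<close> of its successive derivatives. By the chain
  rule the compositions form a family covered by \<open>smooth_alg\<close>.\<close>

lemma smooth_compose_real: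
  fixes h :: "nat \<Rightarrow> real \<Rightarrow> real" and \<rho> :: "plane \<Rightarrow> real"
  assumes h: "\<And>n t. t \<in> range \<rho> \<Longrightarrow> (h n has_real_derivative h (Suc n) t) (at t)" and \<rho>: "smooth \<rho>"
  shows "smooth (\<lambda>x. h n (\<rho> x))" "pd j (\<lambda>x. h n (\<rho> x)) = (\<lambda>x. h (Suc n) (\<rho> x) * pd j \<rho> x)"
proof -
  have d: "((\<lambda>x. h n (\<rho> x)) has_derivative (\<lambda>v. (\<Sum>j\<in>UNIV. v $ j *\<^sub>R pd j \<rho> x) * h (Suc n) (\<rho> x))) (at x)" for n x
    using has_derivative_compose[OF smooth_has_derivative[OF \<rho>] h[unfolded has_field_derivative_def], of x n]
    by (simp add: mult.commute)
  show pd: "pd j (\<lambda>x. h n (\<rho> x)) = (\<lambda>x. h (Suc n) (\<rho> x) * pd j \<rho> x)" for j n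
    by (auto simp: fun_eq_iff pd_eqI[OF d] axis_def if_distrib if_distribR cong: if_cong)
  show "smooth (\<lambda>x. h n (\<rho> x))"
    by (rule smooth_alg[where Q="\<lambda>k. \<exists>n. k = (\<lambda>x. h n (\<rho> x))"])
      (auto intro!: differentiableI[OF d] simp: pd, intro alg.mult alg.smooth[OF smooth_pd, OF \<rho>] alg.base, auto intro: alg.base)
qed

section \<open>Differentiation under the integral sign\<close>

text \<open>Limits along sequences are what dominated convergence provides; steps of size below 1
  suffice and keep all evaluation points in the unit ball where the integrand is controlled.\<close>

lemma has_vector_derivative_seqI:
  fixes v :: "real \<Rightarrow> 'b::real_normed_vector"
  assumes "\<And>X. (\<And>i::nat. X i \<noteq> 0) \<Longrightarrow> (\<And>i. \<bar>X i\<bar> < 1) \<Longrightarrow> X \<longlonglongrightarrow> 0 \<Longrightarrow> (\<lambda>i. (v (X i) - v 0) /\<^sub>R X i) \<longlonglongrightarrow> d"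
  shows "(v has_vector_derivative d) (at 0)"
proof -
  have "((\<lambda>h. (v h - v 0) /\<^sub>R h) \<longlongrightarrow> d) (at 0)"
    unfolding tendsto_at_iff_sequentially o_def
  proof (intro allI impI)
    fix X :: "nat \<Rightarrow> real" assume X: "\<forall>i. X i \<in> UNIV - {0}" "X \<longlonglongrightarrow> 0"
    obtain N where N: "\<And>i. i \<ge> N \<Longrightarrow> \<bar>X i\<bar> < 1"
      using LIMSEQ_D[OF X(2), of 1] by auto
    have "(\<lambda>i. (v (X (i + N)) - v 0) /\<^sub>R X (i + N)) \<longlonglongrightarrow> d"
      using X N by (intro assms) (auto intro: LIMSEQ_ignore_initial_segment)
    then show "(\<lambda>i. (v (X i) - v 0) /\<^sub>R X i) \<longlonglongrightarrow> d"
      by (rule LIMSEQ_offset)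
  qed
  then have "((\<lambda>h. norm ((v h - v 0) /\<^sub>R h - d)) \<longlongrightarrow> 0) (at 0)"
    using Lim_null tendsto_norm_zero by blast
  moreover have "\<forall>\<^sub>F h in at (0::real). norm ((v h - v 0) /\<^sub>R h - d) = norm (v (0 + h) - v 0 - h *\<^sub>R d) / norm h"
  proof (intro eventually_at_topological[THEN iffD2] exI[of _ UNIV] conjI ballI impI)
    fix h :: real assume "h \<noteq> 0"
    then have "v h - v 0 - h *\<^sub>R d = h *\<^sub>R ((v h - v 0) /\<^sub>R h - d)" by (simp add: algebra_simps)
    then have "norm (v h - v 0 - h *\<^sub>R d) = \<bar>h\<bar> * norm ((v h - v 0) /\<^sub>R h - d)" by (metis norm_scaleR)
    with \<open>h \<noteq> 0\<close> show "norm ((v h - v 0) /\<^sub>R h - d) = norm (v (0 + h) - v 0 - h *\<^sub>R d) / norm h" by simp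
  qed auto
  ultimately have "((\<lambda>h. norm (v (0 + h) - v 0 - h *\<^sub>R d) / norm h) \<longlongrightarrow> 0) (at 0)"
    by (rule Lim_transform_eventually)
  then show ?thesis
    unfolding has_vector_derivative_def has_derivative_at by (auto intro: bounded_linear_scaleR_left)
qed

lemma has_vector_derivative_shift_0:
  fixes g :: "real \<Rightarrow> 'b::real_normed_vector"
  assumes "((\<lambda>s. g (s + t)) has_vector_derivative d) (at 0)"
  shows "(g has_vector_derivative d) (at t)"
proof -
  have "((\<lambda>s. s - t) has_vector_derivative 1) (at t)"
    by (auto intro!: derivative_eq_intros simp: has_real_derivative_iff_has_vector_derivative[symmetric])
  from vector_diff_chain_at[OF this, of "\<lambda>s. g (s + t)" d] assms show ?thesis by (simp add: o_def)
qed

text \<open>The mean value inequality bounds the difference quotients by the majorant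
  \<open>w\<close> of the partial derivative; dominated convergence does the rest.\<close>

lemma pd_integral:
  fixes f :: "'a \<Rightarrow> plane \<Rightarrow> complex"
  assumes d: "\<And>x \<eta>. x \<in> space M \<Longrightarrow> \<eta> \<in> ball \<xi> 1 \<Longrightarrow> f x differentiable (at \<eta>)"
    and int: "\<And>\<eta>. \<eta> \<in> ball \<xi> 1 \<Longrightarrow> integrable M (\<lambda>x. f x \<eta>)"
    and meas: "(\<lambda>x. pd j (f x) \<xi>) \<in> borel_measurable M"
    and w: "integrable M w"
    and bnd: "\<And>x \<eta>. x \<in> space M \<Longrightarrow> \<eta> \<in> ball \<xi> 1 \<Longrightarrow> norm (pd j (f x) \<eta>) \<le> w x"
  shows "((\<lambda>t. \<integral>x. f x (\<xi> + t *\<^sub>R axis j 1) \<partial>M) has_vector_derivative (\<integral>x. pd j (f x) \<xi> \<partial>M)) (at 0)"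
proof (rule has_vector_derivative_seqI)
  let ?e = "axis j 1 :: plane"
  fix X :: "nat \<Rightarrow> real" assume X: "\<And>i. X i \<noteq> 0" "\<And>i. \<bar>X i\<bar> < 1" "X \<longlonglongrightarrow> 0"
  have inb: "\<xi> + t *\<^sub>R ?e \<in> ball \<xi> 1" if "\<bar>t\<bar> < 1" for t
    using that by (simp add: dist_norm)
  have der: "((\<lambda>t. f x (\<xi> + t *\<^sub>R ?e)) has_vector_derivative pd j (f x) (\<xi> + t *\<^sub>R ?e)) (at t)"
    if "x \<in> space M" "\<bar>t\<bar> < 1" for x t
  proof -
    have "((\<lambda>s. f x ((\<xi> + t *\<^sub>R ?e) + s *\<^sub>R ?e)) has_vector_derivative pd j (f x) (\<xi> + t *\<^sub>R ?e)) (at 0)"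
      by (intro has_derivative_pd d inb that)
    then have "((\<lambda>s. f x (\<xi> + (s + t) *\<^sub>R ?e)) has_vector_derivative pd j (f x) (\<xi> + t *\<^sub>R ?e)) (at 0)"
      by (simp add: algebra_simps)
    then show ?thesis by (rule has_vector_derivative_shift_0)
  qed
  have q: "norm ((f x (\<xi> + t *\<^sub>R ?e) - f x \<xi>) /\<^sub>R t) \<le> w x" if "x \<in> space M" "\<bar>t\<bar> < 1" "t \<noteq> 0" for x t
  proof -
    have "norm (f x (\<xi> + t *\<^sub>R ?e) - f x (\<xi> + 0 *\<^sub>R ?e)) \<le> w x * norm (t - 0)"
    proof (rule differentiable_bound[where S="ball 0 1" and f'="\<lambda>t h. h *\<^sub>R pd j (f x) (\<xi> + t *\<^sub>R ?e)"])
      fix s :: real assume s: "s \<in> ball 0 1"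
      then show "((\<lambda>t. f x (\<xi> + t *\<^sub>R ?e)) has_derivative (\<lambda>h. h *\<^sub>R pd j (f x) (\<xi> + s *\<^sub>R ?e))) (at s within ball 0 1)"
        using der[OF that(1), of s] by (auto simp: has_vector_derivative_def intro: has_derivative_at_withinI)
      show "onorm (\<lambda>h. h *\<^sub>R pd j (f x) (\<xi> + s *\<^sub>R ?e)) \<le> w x"
        using s bnd[OF that(1) inb, of s] by (intro onorm_le) (auto simp: mult.commute mult_left_mono)
    qed (use that in auto)
    then have "norm (f x (\<xi> + t *\<^sub>R ?e) - f x \<xi>) / \<bar>t\<bar> \<le> w x" using that by (simp add: pos_divide_le_eq)
    then show ?thesis by (simp add: divide_inverse mult.commute)
  qed
  have "(\<lambda>i. \<integral>x. (f x (\<xi> + X i *\<^sub>R ?e) - f x \<xi>) /\<^sub>R X i \<partial>M) \<longlonglongrightarrow> (\<integral>x. pd j (f x) \<xi> \<partial>M)"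
  proof (rule integral_dominated_convergence[where w=w])
    show "AE x in M. (\<lambda>i. (f x (\<xi> + X i *\<^sub>R ?e) - f x \<xi>) /\<^sub>R X i) \<longlonglongrightarrow> pd j (f x) \<xi>"
    proof (intro AE_I2)
      fix x assume x: "x \<in> space M"
      have "((\<lambda>h. norm (f x (\<xi> + h *\<^sub>R ?e) - f x \<xi> - h *\<^sub>R pd j (f x) \<xi>) / norm h) \<longlongrightarrow> 0) (at 0)"
        using der[OF x, of 0] by (simp add: has_vector_derivative_def has_derivative_at)
      then have "(\<lambda>i. norm (f x (\<xi> + X i *\<^sub>R ?e) - f x \<xi> - X i *\<^sub>R pd j (f x) \<xi>) / norm (X i)) \<longlonglongrightarrow> 0"
        unfolding tendsto_at_iff_sequentially o_def using X by auto
      moreover have "norm (f x (\<xi> + X i *\<^sub>R ?e) - f x \<xi> - X i *\<^sub>R pd j (f x) \<xi>) / norm (X i)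
          = norm ((f x (\<xi> + X i *\<^sub>R ?e) - f x \<xi>) /\<^sub>R X i - pd j (f x) \<xi>)" for i
      proof -
        have "f x (\<xi> + X i *\<^sub>R ?e) - f x \<xi> - X i *\<^sub>R pd j (f x) \<xi>
          = X i *\<^sub>R ((f x (\<xi> + X i *\<^sub>R ?e) - f x \<xi>) /\<^sub>R X i - pd j (f x) \<xi>)"
          using X(1)[of i] by (simp add: algebra_simps)
        then show ?thesis using X(1)[of i] by (metis norm_scaleR nonzero_mult_div_cancel_left norm_eq_zero real_norm_def)
      qed
      ultimately have "(\<lambda>i. norm ((f x (\<xi> + X i *\<^sub>R ?e) - f x \<xi>) /\<^sub>R X i - pd j (f x) \<xi>)) \<longlonglongrightarrow> 0" by simp
      then show "(\<lambda>i. (f x (\<xi> + X i *\<^sub>R ?e) - f x \<xi>) /\<^sub>R X i) \<longlonglongrightarrow> pd j (f x) \<xi>"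
        using LIM_zero_cancel tendsto_norm_zero_iff by blast
    qed
    show "(\<lambda>x. (f x (\<xi> + X i *\<^sub>R ?e) - f x \<xi>) /\<^sub>R X i) \<in> borel_measurable M" for i
      using int[OF inb[OF X(2)], of i] int[of \<xi>] by (auto dest!: borel_measurable_integrable)
  qed (use meas w q X in auto)
  moreover have "(\<integral>x. (f x (\<xi> + X i *\<^sub>R ?e) - f x \<xi>) /\<^sub>R X i \<partial>M)
      = ((\<integral>x. f x (\<xi> + X i *\<^sub>R ?e) \<partial>M) - (\<integral>x. f x \<xi> \<partial>M)) /\<^sub>R X i" for i
    using int[OF inb[OF X(2)], of i] int[of \<xi>] by simp
  ultimately show "(\<lambda>i. ((\<integral>x. f x (\<xi> + X i *\<^sub>R ?e) \<partial>M) - (\<integral>x. f x (\<xi> + 0 *\<^sub>R ?e) \<partial>M)) /\<^sub>R X i)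
      \<longlonglongrightarrow> (\<integral>x. pd j (f x) \<xi> \<partial>M)" by (simp only: scaleR_zero_left add_0_right)
qed

text \<open>Differentiation under the integral sign yields derivatives along the axes only, while
  \<open>smooth\<close> asks for total differentiability; continuity of the partial derivatives
  bridges the gap.\<close>

lemma has_derivative_by_partials:
  fixes f :: "plane \<Rightarrow> 'b::real_normed_vector"
  assumes p: "\<And>x j. ((\<lambda>t. f (x + t *\<^sub>R axis j 1)) has_vector_derivative g j x) (at 0)"
    and c: "\<And>j. continuous_on UNIV (g j)"
  shows "(f has_derivative (\<lambda>h. \<Sum>j\<in>UNIV. h $ j *\<^sub>R g j x)) (at x)"
proof -
  define e where "e a b = a *\<^sub>R axis 1 1 + b *\<^sub>R (axis 2 1 :: plane)" for a b
  have e: "e (x $ 1) (x $ 2) = x" for x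
    by (simp add: e_def vec_eq_iff forall_2 axis_def)
  have p1: "((\<lambda>a. f (e a b)) has_vector_derivative g 1 (e a b)) (at a)" for a b
    using p[of "e a b" 1] by - (rule has_vector_derivative_shift_0, simp add: e_def algebra_simps)
  have p2: "((\<lambda>b. f (e a b)) has_vector_derivative g 2 (e a b)) (at b)" for a b
    using p[of "e a b" 2] by - (rule has_vector_derivative_shift_0, simp add: e_def algebra_simps)
  have ce: "continuous_on UNIV (\<lambda>p. e (fst p) (snd p))" unfolding e_def by (intro continuous_intros)
  have "((\<lambda>(a, b). f (e a b)) has_derivative
      (\<lambda>(ta, tb). ta *\<^sub>R g 1 (e (x $ 1) (x $ 2)) + blinfun_apply (blinfun_scaleR_left (g 2 (e (x $ 1) (x $ 2)))) tb))
      (at (x $ 1, x $ 2) within UNIV \<times> UNIV)"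
  proof (rule has_derivative_partialsI[where fy="\<lambda>a b. blinfun_scaleR_left (g 2 (e a b))"])
    have "continuous_on UNIV (\<lambda>p. blinfun_scaleR_left (g 2 (e (fst p) (snd p))))"
      by (intro bounded_linear.continuous_on[OF bounded_linear_blinfun_scaleR_left]
          continuous_on_compose2[OF c ce]) auto
    then show "continuous (at (x $ 1, x $ 2) within UNIV \<times> UNIV) (\<lambda>(a, b). blinfun_scaleR_left (g 2 (e a b)))"
      by (auto simp: continuous_on_eq_continuous_within case_prod_unfold)
  qed (use p1 p2 in \<open>auto simp: has_vector_derivative_def\<close>)
  then have "((\<lambda>(a, b). f (e a b)) has_derivative (\<lambda>(ta, tb). ta *\<^sub>R g 1 x + tb *\<^sub>R g 2 x)) (at (x $ 1, x $ 2))"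
    by (simp add: e)
  moreover have "((\<lambda>x::plane. (x $ 1, x $ 2)) has_derivative (\<lambda>h. (h $ 1, h $ 2))) (at x)"
    by (intro has_derivative_Pair bounded_linear_imp_has_derivative bounded_linear_vec_nth)
  ultimately have "((\<lambda>x. case (x $ 1, x $ 2) of (a, b) \<Rightarrow> f (e a b)) has_derivative
      (\<lambda>h. case (h $ 1, h $ 2) of (ta, tb) \<Rightarrow> ta *\<^sub>R g 1 x + tb *\<^sub>R g 2 x)) (at x)"
    by (rule has_derivative_compose[rotated])
  then show ?thesis by (simp add: e sum_2)
qed

text \<open>A majorant independent of \<xi> for each multi-index makes the integrated derivatives
  continuous by dominated convergence and partial derivatives of one another, so the family
  \<open>V\<close> is closed under \<open>pd\<close>.\<close>

lemma smooth_and_pds_integral: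
  fixes f :: "'a \<Rightarrow> plane \<Rightarrow> complex"
  assumes sm: "\<And>x. smooth (f x)"
    and meas: "\<And>js \<xi>. (\<lambda>x. pds js (f x) \<xi>) \<in> borel_measurable M"
    and bnd: "\<And>js. \<exists>w. integrable M w \<and> (\<forall>x \<xi>. norm (pds js (f x) \<xi>) \<le> w x)"
  shows "smooth (\<lambda>\<xi>. \<integral>x. f x \<xi> \<partial>M)"
    and "pds js (\<lambda>\<xi>. \<integral>x. f x \<xi> \<partial>M) = (\<lambda>\<xi>. \<integral>x. pds js (f x) \<xi> \<partial>M)"
proof -
  define V where "V js \<xi> = (\<integral>x. pds js (f x) \<xi> \<partial>M)" for js \<xi>
  have int: "integrable M (\<lambda>x. pds js (f x) \<xi>)" for js \<xi>
  proof -
    obtain w where w: "integrable M w" "\<And>x \<xi>. norm (pds js (f x) \<xi>) \<le> w x" using bnd[of js] by blast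
    then show ?thesis
      by (intro Bochner_Integration.integrable_bound[OF w(1) meas] AE_I2) (metis abs_ge_self order_trans real_norm_def)
  qed
  have cont: "continuous_on UNIV (V js)" for js
  proof -
    obtain w where w: "integrable M w" "\<And>x \<xi>. norm (pds js (f x) \<xi>) \<le> w x" using bnd[of js] by blast
    show ?thesis
      unfolding V_def continuous_on_sequentially o_def
      by (auto intro!: integral_dominated_convergence[OF _ _ w(1)] meas w(2)
          isCont_tendsto_compose[OF smooth_isCont[OF smooth_pds[OF sm]]])
  qed
  have d: "(V js has_derivative (\<lambda>h. \<Sum>j\<in>UNIV. h $ j *\<^sub>R V (j # js) \<xi>)) (at \<xi>)" for js \<xi>
  proof (rule has_derivative_by_partials)
    fix j \<xi>
    obtain w where w: "integrable M w" "\<And>x \<xi>. norm (pds (j # js) (f x) \<xi>) \<le> w x" using bnd[of "j # js"] by blast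
    show "((\<lambda>t. V js (\<xi> + t *\<^sub>R axis j 1)) has_vector_derivative V (j # js) \<xi>) (at 0)"
      unfolding V_def pds_Cons
      by (intro pd_integral[OF _ int _ w(1)]) (use w(2) meas[of "j # js"] in \<open>auto intro: smooth_differentiable smooth_pds sm\<close>)
  qed (rule cont)
  have pdV: "pd j (V js) = V (j # js)" for j js
    by (auto simp: fun_eq_iff pd_eqI[OF d] axis_def if_distrib if_distribR cong: if_cong)
  have V: "pds js (V []) = V js" for js by (induction js) (auto simp: pdV)
  moreover have "(\<lambda>\<xi>. \<integral>x. f x \<xi> \<partial>M) = V []" by (simp add: V_def[abs_def])
  ultimately show "smooth (\<lambda>\<xi>. \<integral>x. f x \<xi> \<partial>M)"
    unfolding smooth_def using differentiableI[OF d] by simp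
  show "pds js (\<lambda>\<xi>. \<integral>x. f x \<xi> \<partial>M) = (\<lambda>\<xi>. \<integral>x. pds js (f x) \<xi> \<partial>M)"
    using V[of js] by (simp add: V_def[abs_def])
qed

section \<open>Test functions on annuli and continuous functionals\<close>

text \<open>The support condition of a test function with explicit radii, phrased through the points
  where the function is nonzero rather than through a closure. Keeping the radii in the statement
  lets whole families share one seminorm estimate.\<close>

definition on_ann :: "real \<Rightarrow> real \<Rightarrow> (plane \<Rightarrow> complex) \<Rightarrow> bool" where
  "on_ann r R \<phi> \<longleftrightarrow> smooth \<phi> \<and> (\<forall>\<xi>. \<phi> \<xi> \<noteq> 0 \<longrightarrow> r \<le> norm \<xi> \<and> norm \<xi> \<le> R)"

lemma on_ann_smooth: "on_ann r R \<phi> \<Longrightarrow> smooth \<phi>" by (simp add: on_ann_def)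

lemma compact_ann: "compact {\<xi>::plane. r \<le> norm \<xi> \<and> norm \<xi> \<le> R}"
proof -
  have "{\<xi>::plane. r \<le> norm \<xi> \<and> norm \<xi> \<le> R} = cball 0 R - ball 0 r" by auto
  then show ?thesis by (metis compact_cball compact_diff open_ball)
qed

lemma on_ann_supp:
  assumes "on_ann r R \<phi>" shows "supp \<phi> \<subseteq> {\<xi>. r \<le> norm \<xi> \<and> norm \<xi> \<le> R}"
  unfolding supp_def
  by (rule closure_minimal) (use assms in \<open>auto simp: on_ann_def intro: compact_imp_closed compact_ann\<close>)

lemma test_fun_iff: "\<phi> \<in> test_fun \<longleftrightarrow> (\<exists>r>0. \<exists>R. on_ann r R \<phi>)"
proof
  assume "\<phi> \<in> test_fun"
  then have s: "smooth \<phi>" and c: "compact (supp \<phi>)" and n: "supp \<phi> \<subseteq> - {0}"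
    by (auto simp: test_fun_def Cc_infty_def)
  have sub: "\<phi> \<xi> \<noteq> 0 \<Longrightarrow> \<xi> \<in> supp \<phi>" for \<xi>
    unfolding supp_def by (rule subsetD[OF closure_subset]) simp
  obtain R where R: "\<And>\<xi>. \<xi> \<in> supp \<phi> \<Longrightarrow> norm \<xi> \<le> R"
    using compact_imp_bounded[OF c] by (auto simp: bounded_iff)
  have "open (- supp \<phi>)" using c by (simp add: compact_imp_closed open_Compl)
  then obtain r where r: "r > 0" "ball 0 r \<subseteq> - supp \<phi>"
    using n unfolding open_contains_ball by (meson ComplI ComplD insertI1 subsetD)
  have "r \<le> norm \<xi>" if "\<xi> \<in> supp \<phi>" for \<xi>
    using subsetD[OF r(2), of \<xi>] that by (cases "r \<le> norm \<xi>") auto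
  with R s sub have "on_ann r R \<phi>" by (simp add: on_ann_def)
  with r(1) show "\<exists>r>0. \<exists>R. on_ann r R \<phi>" by blast
next
  assume "\<exists>r>0. \<exists>R. on_ann r R \<phi>"
  then obtain r R where r: "r > 0" "on_ann r R \<phi>" by auto
  have "compact ({\<xi>. r \<le> norm \<xi> \<and> norm \<xi> \<le> R} \<inter> supp \<phi>)"
    by (intro compact_Int_closed compact_ann) (simp add: supp_def)
  then have c: "compact (supp \<phi>)" using on_ann_supp[OF r(2)] by (simp add: inf_absorb2)
  have "supp \<phi> \<subseteq> - {0}" using on_ann_supp[OF r(2)] r(1) by auto
  with c show "\<phi> \<in> test_fun" using on_ann_smooth[OF r(2)] by (simp add: test_fun_def Cc_infty_def)
qed

lemma on_ann_mono: "on_ann r R \<phi> \<Longrightarrow> r' \<le> r \<Longrightarrow> R \<le> R' \<Longrightarrow> on_ann r' R' \<phi>"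
  by (force simp: on_ann_def)

lemma on_ann_mult: "on_ann r R \<phi> \<Longrightarrow> smooth a \<Longrightarrow> on_ann r R (\<lambda>\<xi>. a \<xi> * \<phi> \<xi>)"
  by (auto simp: on_ann_def smooth_mult)

lemma on_ann_add: "on_ann r R \<phi> \<Longrightarrow> on_ann r R \<psi> \<Longrightarrow> on_ann r R (\<lambda>\<xi>. \<phi> \<xi> + \<psi> \<xi>)"
  unfolding on_ann_def by (auto intro: smooth_add) (metis add_0)+

lemma on_ann_minus: "on_ann r R \<phi> \<Longrightarrow> on_ann r R (\<lambda>\<xi>. - \<phi> \<xi>)"
  by (auto simp: on_ann_def smooth_minus)

lemma on_ann_diff: "on_ann r R \<phi> \<Longrightarrow> on_ann r R \<psi> \<Longrightarrow> on_ann r R (\<lambda>\<xi>. \<phi> \<xi> - \<psi> \<xi>)"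
  using on_ann_add[of r R \<phi> "\<lambda>\<xi>. - \<psi> \<xi>"] on_ann_minus[of r R \<psi>] by simp

lemma on_ann_pd:
  assumes "on_ann r R \<phi>" shows "on_ann r R (pd j \<phi>)"
proof -
  have "pd j \<phi> \<xi> = 0" if "\<not> (r \<le> norm \<xi> \<and> norm \<xi> \<le> R)" for \<xi>
  proof -
    let ?S = "- {\<xi>::plane. r \<le> norm \<xi> \<and> norm \<xi> \<le> R}"
    have "(\<phi> has_derivative (\<lambda>h. 0)) (at \<xi>)"
      by (rule has_derivative_transform_within_open[of "\<lambda>x. 0" _ _ _ ?S])
        (use assms that compact_ann[of r R] in \<open>auto simp: on_ann_def intro: compact_imp_closed\<close>)
    from pd_eqI[OF this] show ?thesis .
  qed
  then show ?thesis using assms by (auto simp: on_ann_def smooth_pd)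
qed

lemma on_ann_pds: "on_ann r R \<phi> \<Longrightarrow> on_ann r R (pds js \<phi>)"
  by (induction js) (auto intro: on_ann_pd)

lemma smooth_bounded_on_ann:
  assumes "smooth (a :: plane \<Rightarrow> 'b::real_normed_vector)"
  obtains C where "C \<ge> 0" "\<And>\<xi>. r \<le> norm \<xi> \<Longrightarrow> norm \<xi> \<le> R \<Longrightarrow> norm (a \<xi>) \<le> C"
proof -
  have "compact (a ` {\<xi>. r \<le> norm \<xi> \<and> norm \<xi> \<le> R})"
    by (intro compact_continuous_image smooth_continuous_on compact_ann assms)
  then obtain C where "\<forall>y\<in>a ` {\<xi>. r \<le> norm \<xi> \<and> norm \<xi> \<le> R}. norm y \<le> C"
    using compact_imp_bounded bounded_iff by metis
  then show ?thesis by (intro that[of "max 0 C"]) (auto simp: le_max_iff_disj)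
qed

lemma on_ann_bounded:
  assumes "on_ann r R \<phi>" obtains C where "C \<ge> 0" "\<And>\<xi>. norm (\<phi> \<xi>) \<le> C"
proof -
  obtain C where C: "C \<ge> 0" "\<And>\<xi>. r \<le> norm \<xi> \<Longrightarrow> norm \<xi> \<le> R \<Longrightarrow> norm (\<phi> \<xi>) \<le> C"
    by (rule smooth_bounded_on_ann[OF on_ann_smooth[OF assms], of r R]) blast
  show ?thesis
  proof (rule that[OF C(1)])
    fix \<xi> show "norm (\<phi> \<xi>) \<le> C" using C assms by (cases "\<phi> \<xi> = 0") (auto simp: on_ann_def)
  qed
qed

text \<open>Continuity restated with one common bound \<open>b\<close> for all derivatives up to
  order \<open>N\<close> instead of a sum of suprema: applying it takes only pointwise estimates.
  Every compact subset of the punctured plane lies in one of the annuli.\<close>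

definition cont_functional :: "distr \<Rightarrow> bool" where
  "cont_functional u \<longleftrightarrow>
     (\<forall>\<phi>\<in>test_fun. \<forall>\<psi>\<in>test_fun. \<forall>a b. u (\<lambda>\<xi>. a * \<phi> \<xi> + b * \<psi> \<xi>) = a * u \<phi> + b * u \<psi>) \<and>
     (\<forall>r>0. \<forall>R. \<exists>C N. C \<ge> 0 \<and> (\<forall>\<phi> b. on_ann r R \<phi> \<longrightarrow> (\<forall>js \<xi>. length js \<le> N \<longrightarrow> norm (pds js \<phi> \<xi>) \<le> b)
        \<longrightarrow> norm (u \<phi>) \<le> C * b))"

lemma cont_functional_boundE:
  assumes "cont_functional u" "r > 0"
  obtains C N where "C \<ge> 0"
    "\<And>\<phi> b. on_ann r R \<phi> \<Longrightarrow> (\<And>js \<xi>. length js \<le> N \<Longrightarrow> norm (pds js \<phi> \<xi>) \<le> b) \<Longrightarrow> norm (u \<phi>) \<le> C * b"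
  using assms unfolding cont_functional_def by meson

lemma distribution_cont_functional:
  assumes "distribution u" shows "cont_functional u"
  unfolding cont_functional_def
proof (intro conjI allI impI)
  show "\<forall>\<phi>\<in>test_fun. \<forall>\<psi>\<in>test_fun. \<forall>a b. u (\<lambda>\<xi>. a * \<phi> \<xi> + b * \<psi> \<xi>) = a * u \<phi> + b * u \<psi>"
    using assms by (simp add: distribution_def)
  fix r R :: real assume r: "r > 0"
  let ?K = "{\<xi>::plane. r \<le> norm \<xi> \<and> norm \<xi> \<le> R}"
  have "?K \<subseteq> - {0}" using r by auto
  then obtain C N where CN: "\<And>\<phi>. \<phi> \<in> test_fun \<Longrightarrow> supp \<phi> \<subseteq> ?K \<Longrightarrow>
      norm (u \<phi>) \<le> C * (\<Sum>js | length js \<le> N. SUP \<xi>. norm (pds js \<phi> \<xi>))"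
    using assms compact_ann[of r R] unfolding distribution_def by meson
  let ?n = "real (card {js :: 2 list. length js \<le> N})"
  have "norm (u \<phi>) \<le> (\<bar>C\<bar> * ?n) * b"
    if \<phi>: "on_ann r R \<phi>" and b: "\<forall>js \<xi>. length js \<le> N \<longrightarrow> norm (pds js \<phi> \<xi>) \<le> b" for \<phi> b
  proof -
    have le: "(\<Sum>js | length js \<le> N. SUP \<xi>. norm (pds js \<phi> \<xi>)) \<le> (\<Sum>js\<in>{js :: 2 list. length js \<le> N}. b)"
      by (intro sum_mono cSUP_least) (use b in auto)
    \<comment> \<open>For an unbounded set the real supremum would be an unspecified value, so
      boundedness of the derivatives, supported in a compact annulus, has to be supplied
      first.\<close>
    have "0 \<le> (SUP \<xi>. norm (pds js \<phi> \<xi>))" for js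
    proof -
      obtain D where "\<And>\<xi>. norm (pds js \<phi> \<xi>) \<le> D" using on_ann_bounded[OF on_ann_pds[OF \<phi>]] by metis
      then have "norm (pds js \<phi> 0) \<le> (SUP \<xi>. norm (pds js \<phi> \<xi>))"
        by (intro cSUP_upper bdd_aboveI2[where M=D]) auto
      then show ?thesis by (rule order_trans[OF norm_ge_zero])
    qed
    \<comment> \<open>The constant supplied by \<open>distribution\<close> may be negative; it is
      replaced by its absolute value.\<close>
    then have "C * (\<Sum>js | length js \<le> N. SUP \<xi>. norm (pds js \<phi> \<xi>)) \<le> \<bar>C\<bar> * (\<Sum>js | length js \<le> N. SUP \<xi>. norm (pds js \<phi> \<xi>))"
      by (intro mult_right_mono sum_nonneg) auto
    also have "\<dots> \<le> \<bar>C\<bar> * (?n * b)" using le by (intro mult_left_mono) auto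
    finally show ?thesis using CN[of \<phi>] \<phi> r on_ann_supp[OF \<phi>] by (force simp: test_fun_iff)
  qed
  then show "\<exists>C N. C \<ge> 0 \<and> (\<forall>\<phi> b. on_ann r R \<phi> \<longrightarrow> (\<forall>js \<xi>. length js \<le> N \<longrightarrow> norm (pds js \<phi> \<xi>) \<le> b)
        \<longrightarrow> norm (u \<phi>) \<le> C * b)"
    by (intro exI[of _ "\<bar>C\<bar> * ?n"] exI[of _ N]) auto
qed

lemma test_fun_add: "\<phi> \<in> test_fun \<Longrightarrow> \<psi> \<in> test_fun \<Longrightarrow> (\<lambda>\<xi>. \<phi> \<xi> + \<psi> \<xi>) \<in> test_fun"
proof -
  assume "\<phi> \<in> test_fun" "\<psi> \<in> test_fun"
  then obtain r R r' R' where "r > 0" "on_ann r R \<phi>" "r' > 0" "on_ann r' R' \<psi>" by (auto simp: test_fun_iff)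
  then have "min r r' > 0" "on_ann (min r r') (max R R') (\<lambda>\<xi>. \<phi> \<xi> + \<psi> \<xi>)"
    by (auto intro!: on_ann_add elim: on_ann_mono)
  then show ?thesis unfolding test_fun_iff by blast
qed

lemma test_fun_mult: "\<phi> \<in> test_fun \<Longrightarrow> smooth a \<Longrightarrow> (\<lambda>\<xi>. a \<xi> * \<phi> \<xi>) \<in> test_fun"
  by (auto simp: test_fun_iff intro: on_ann_mult)

lemma test_fun_pd: "\<phi> \<in> test_fun \<Longrightarrow> pd j \<phi> \<in> test_fun"
  by (auto simp: test_fun_iff intro: on_ann_pd)

lemma test_fun_minus: "\<phi> \<in> test_fun \<Longrightarrow> (\<lambda>\<xi>. - \<phi> \<xi>) \<in> test_fun"
  by (auto simp: test_fun_iff intro: on_ann_minus)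

lemma test_fun_diff: "\<phi> \<in> test_fun \<Longrightarrow> \<psi> \<in> test_fun \<Longrightarrow> (\<lambda>\<xi>. \<phi> \<xi> - \<psi> \<xi>) \<in> test_fun"
  using test_fun_add[of \<phi> "\<lambda>\<xi>. - \<psi> \<xi>"] test_fun_minus[of \<psi>] by simp

lemma test_fun_smooth: "\<phi> \<in> test_fun \<Longrightarrow> smooth \<phi>"
  by (auto simp: test_fun_iff on_ann_def)

lemma test_fun_zero: "(\<lambda>\<xi>. 0) \<in> test_fun"
  by (auto simp: test_fun_iff on_ann_def intro: exI[of _ 1])

lemma test_fun_sum: "(\<And>i. i \<in> I \<Longrightarrow> f i \<in> test_fun) \<Longrightarrow> (\<lambda>\<xi>. \<Sum>i\<in>I. f i \<xi>) \<in> test_fun"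
  by (induction I rule: infinite_finite_induct) (auto intro: test_fun_add test_fun_zero)

lemma test_fun_cmult: "\<phi> \<in> test_fun \<Longrightarrow> (\<lambda>\<xi>. c * \<phi> \<xi>) \<in> test_fun"
  using test_fun_mult[of \<phi> "\<lambda>_. c"] by simp

context
  fixes u assumes u: "cont_functional u"
begin

lemma functional_lin:
  "\<phi> \<in> test_fun \<Longrightarrow> \<psi> \<in> test_fun \<Longrightarrow> u (\<lambda>\<xi>. a * \<phi> \<xi> + b * \<psi> \<xi>) = a * u \<phi> + b * u \<psi>"
  using u by (simp add: cont_functional_def)

lemma functional_add:
  "\<phi> \<in> test_fun \<Longrightarrow> \<psi> \<in> test_fun \<Longrightarrow> u (\<lambda>\<xi>. \<phi> \<xi> + \<psi> \<xi>) = u \<phi> + u \<psi>"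
  using functional_lin[of \<phi> \<psi> 1 1] by simp

lemma functional_diff:
  "\<phi> \<in> test_fun \<Longrightarrow> \<psi> \<in> test_fun \<Longrightarrow> u (\<lambda>\<xi>. \<phi> \<xi> - \<psi> \<xi>) = u \<phi> - u \<psi>"
  using functional_lin[of \<phi> \<psi> 1 "-1"] by simp

lemma functional_cmult: "\<phi> \<in> test_fun \<Longrightarrow> u (\<lambda>\<xi>. a * \<phi> \<xi>) = a * u \<phi>"
  using functional_lin[of \<phi> \<phi> a 0] by simp

lemma functional_minus: "\<phi> \<in> test_fun \<Longrightarrow> u (\<lambda>\<xi>. - \<phi> \<xi>) = - u \<phi>"
  using functional_cmult[of \<phi> "-1"] by simp

lemma functional_zero: "u (\<lambda>\<xi>. 0) = 0"
  using functional_cmult[OF test_fun_zero, of 0] by simp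

lemma functional_sum: "(\<And>i. i \<in> I \<Longrightarrow> f i \<in> test_fun) \<Longrightarrow> u (\<lambda>\<xi>. \<Sum>i\<in>I. f i \<xi>) = (\<Sum>i\<in>I. u (f i))"
  by (induction I rule: infinite_finite_induct) (auto simp: functional_zero functional_add test_fun_sum)

end

text \<open>Leibniz rule by induction from the right end of the list, that is on the derivative
  applied first. It may fall on \<open>a\<close>, which is therefore generalised. The constant
  depends on the multi-index but not on \<phi>.\<close>

lemma pds_mult_bound:
  assumes "smooth a"
  shows "\<exists>C\<ge>0. \<forall>\<phi> b. on_ann r R \<phi> \<longrightarrow> (\<forall>ks \<xi>. length ks \<le> length js \<longrightarrow> norm (pds ks \<phi> \<xi>) \<le> b)
      \<longrightarrow> (\<forall>\<xi>. norm (pds js (\<lambda>\<xi>. a \<xi> * \<phi> \<xi>) \<xi>) \<le> C * b)"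
  using assms
proof (induction js arbitrary: a rule: rev_induct)
  case Nil
  obtain C where C: "C \<ge> 0" "\<And>\<xi>. r \<le> norm \<xi> \<Longrightarrow> norm \<xi> \<le> R \<Longrightarrow> norm (a \<xi>) \<le> C"
    by (rule smooth_bounded_on_ann[OF Nil, of r R]) blast
  have "norm (a \<xi> * \<phi> \<xi>) \<le> C * b" if "on_ann r R \<phi>" "\<forall>\<xi>. norm (\<phi> \<xi>) \<le> b" for \<phi> b \<xi>
  proof (cases "\<phi> \<xi> = 0")
    case True
    have "0 \<le> b" using that(2) norm_ge_zero order_trans by blast
    with True C show ?thesis by simp
  next
    case False
    with that C show ?thesis unfolding norm_mult by (intro mult_mono) (auto simp: on_ann_def)
  qed
  with C show ?case by auto
next
  case (snoc j js)
  obtain C1 where C1: "C1 \<ge> 0" "\<And>\<phi> b \<xi>. on_ann r R \<phi> \<Longrightarrow> (\<forall>ks \<xi>. length ks \<le> length js \<longrightarrow> norm (pds ks \<phi> \<xi>) \<le> b)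
      \<Longrightarrow> norm (pds js (\<lambda>\<xi>. a \<xi> * \<phi> \<xi>) \<xi>) \<le> C1 * b" using snoc.IH[OF snoc.prems] by blast
  obtain C2 where C2: "C2 \<ge> 0" "\<And>\<phi> b \<xi>. on_ann r R \<phi> \<Longrightarrow> (\<forall>ks \<xi>. length ks \<le> length js \<longrightarrow> norm (pds ks \<phi> \<xi>) \<le> b)
      \<Longrightarrow> norm (pds js (\<lambda>\<xi>. pd j a \<xi> * \<phi> \<xi>) \<xi>) \<le> C2 * b" using snoc.IH[OF smooth_pd[OF snoc.prems], of j] by blast
  have "norm (pds (js @ [j]) (\<lambda>\<xi>. a \<xi> * \<phi> \<xi>) \<xi>) \<le> (C1 + C2) * b"
    if \<phi>: "on_ann r R \<phi>" and b: "\<forall>ks \<xi>. length ks \<le> length (js @ [j]) \<longrightarrow> norm (pds ks \<phi> \<xi>) \<le> b" for \<phi> b \<xi>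
  proof -
    have s: "smooth \<phi>" using \<phi> by (rule on_ann_smooth)
    have "pd j (\<lambda>\<xi>. a \<xi> * \<phi> \<xi>) = (\<lambda>\<xi>. a \<xi> * pd j \<phi> \<xi> + pd j a \<xi> * \<phi> \<xi>)"
      by (auto simp: pd_mult smooth_differentiable s snoc.prems)
    then have "pds (js @ [j]) (\<lambda>\<xi>. a \<xi> * \<phi> \<xi>) \<xi> = pds js (\<lambda>\<xi>. a \<xi> * pd j \<phi> \<xi>) \<xi> + pds js (\<lambda>\<xi>. pd j a \<xi> * \<phi> \<xi>) \<xi>"
      by (simp add: pds_append pds_add smooth_mult smooth_pd s snoc.prems)
    moreover have "norm (pds js (\<lambda>\<xi>. a \<xi> * pd j \<phi> \<xi>) \<xi>) \<le> C1 * b"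
    proof (intro C1(2) on_ann_pd \<phi> allI impI)
      fix ks :: "2 list" and \<xi> assume "length ks \<le> length js"
      then show "norm (pds ks (pd j \<phi>) \<xi>) \<le> b" using b[rule_format, of "ks @ [j]" \<xi>] by (simp add: pds_append)
    qed
    moreover have "norm (pds js (\<lambda>\<xi>. pd j a \<xi> * \<phi> \<xi>) \<xi>) \<le> C2 * b"
      using b by (intro C2(2) \<phi>) auto
    ultimately show ?thesis by (simp add: distrib_right norm_triangle_le)
  qed
  with C1 C2 show ?case by (intro exI[of _ "C1 + C2"]) auto
qed

lemma cont_functional_mult:
  assumes u: "cont_functional u" and a: "smooth a"
  shows "cont_functional (\<lambda>\<phi>. u (\<lambda>\<xi>. a \<xi> * \<phi> \<xi>))"
  unfolding cont_functional_def
proof (intro conjI ballI allI impI)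
  fix \<phi> \<psi> c d assume t: "\<phi> \<in> test_fun" "\<psi> \<in> test_fun"
  have "(\<lambda>\<xi>. a \<xi> * (c * \<phi> \<xi> + d * \<psi> \<xi>)) = (\<lambda>\<xi>. c * (a \<xi> * \<phi> \<xi>) + d * (a \<xi> * \<psi> \<xi>))"
    by (auto simp: algebra_simps)
  then show "u (\<lambda>\<xi>. a \<xi> * (c * \<phi> \<xi> + d * \<psi> \<xi>)) = c * u (\<lambda>\<xi>. a \<xi> * \<phi> \<xi>) + d * u (\<lambda>\<xi>. a \<xi> * \<psi> \<xi>)"
    by (simp add: functional_lin[OF u] test_fun_mult t a)
next
  fix r R :: real assume r: "r > 0"
  obtain C N where C: "C \<ge> 0" "\<And>\<phi> b. on_ann r R \<phi> \<Longrightarrow> (\<And>js \<xi>. length js \<le> N \<Longrightarrow> norm (pds js \<phi> \<xi>) \<le> b) \<Longrightarrow> norm (u \<phi>) \<le> C * b"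
    by (rule cont_functional_boundE[OF u r, of R]) blast
  obtain E where E: "\<And>js. E js \<ge> 0" "\<And>js \<phi> b \<xi>. on_ann r R \<phi> \<Longrightarrow> (\<forall>ks \<xi>. length ks \<le> length js \<longrightarrow> norm (pds ks \<phi> \<xi>) \<le> b)
      \<Longrightarrow> norm (pds js (\<lambda>\<xi>. a \<xi> * \<phi> \<xi>) \<xi>) \<le> E js * b"
    using pds_mult_bound[OF a, of r R] by metis
  let ?F = "\<Sum>js | length js \<le> N. E js"
  have fin: "finite {js :: 2 list. length js \<le> N}" using finite_lists_length_le[of "UNIV :: 2 set" N] by simp
  have "norm (u (\<lambda>\<xi>. a \<xi> * \<phi> \<xi>)) \<le> (C * ?F) * b"
    if \<phi>: "on_ann r R \<phi>" and b: "\<forall>js \<xi>. length js \<le> N \<longrightarrow> norm (pds js \<phi> \<xi>) \<le> b" for \<phi> b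
  proof -
    have "norm (\<phi> 0) \<le> b" using b[rule_format, of "[]" 0] by simp
    then have b0: "0 \<le> b" using norm_ge_zero order_trans by blast
    have "norm (pds js (\<lambda>\<xi>. a \<xi> * \<phi> \<xi>) \<xi>) \<le> ?F * b" if "length js \<le> N" for js \<xi>
    proof -
      have "norm (pds js (\<lambda>\<xi>. a \<xi> * \<phi> \<xi>) \<xi>) \<le> E js * b" using E(2)[OF \<phi>, of js b \<xi>] b that by auto
      also have "\<dots> \<le> ?F * b" using that b0 E(1) fin by (intro mult_right_mono member_le_sum) auto
      finally show ?thesis .
    qed
    then have "norm (u (\<lambda>\<xi>. a \<xi> * \<phi> \<xi>)) \<le> C * (?F * b)" by (intro C(2) on_ann_mult \<phi> a)
    then show ?thesis by (simp add: mult.assoc)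
  qed
  moreover have "0 \<le> C * ?F" using C(1) E(1) by (auto intro!: mult_nonneg_nonneg sum_nonneg)
  ultimately show "\<exists>C N. C \<ge> 0 \<and> (\<forall>\<phi> b. on_ann r R \<phi> \<longrightarrow> (\<forall>js \<xi>. length js \<le> N \<longrightarrow> norm (pds js \<phi> \<xi>) \<le> b)
        \<longrightarrow> norm (u (\<lambda>\<xi>. a \<xi> * \<phi> \<xi>)) \<le> C * b)"
    by blast
qed

lemma cont_functional_lincomb:
  assumes u: "cont_functional u" and v: "cont_functional v"
  shows "cont_functional (\<lambda>\<phi>. c * u \<phi> + d * v \<phi>)"
  unfolding cont_functional_def
proof (intro conjI ballI allI impI)
  fix \<phi> \<psi> a b assume t: "\<phi> \<in> test_fun" "\<psi> \<in> test_fun"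
  show "c * u (\<lambda>\<xi>. a * \<phi> \<xi> + b * \<psi> \<xi>) + d * v (\<lambda>\<xi>. a * \<phi> \<xi> + b * \<psi> \<xi>) = a * (c * u \<phi> + d * v \<phi>) + b * (c * u \<psi> + d * v \<psi>)"
    by (simp add: functional_lin[OF u t] functional_lin[OF v t] algebra_simps)
next
  fix r R :: real assume r: "r > 0"
  obtain C N where C: "C \<ge> 0" "\<And>\<phi> b. on_ann r R \<phi> \<Longrightarrow> (\<And>js \<xi>. length js \<le> N \<Longrightarrow> norm (pds js \<phi> \<xi>) \<le> b) \<Longrightarrow> norm (u \<phi>) \<le> C * b"
    by (rule cont_functional_boundE[OF u r, of R]) blast
  obtain C' N' where C': "C' \<ge> 0" "\<And>\<phi> b. on_ann r R \<phi> \<Longrightarrow> (\<And>js \<xi>. length js \<le> N' \<Longrightarrow> norm (pds js \<phi> \<xi>) \<le> b) \<Longrightarrow> norm (v \<phi>) \<le> C' * b"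
    by (rule cont_functional_boundE[OF v r, of R]) blast
  have "norm (c * u \<phi> + d * v \<phi>) \<le> (norm c * C + norm d * C') * b"
    if \<phi>: "on_ann r R \<phi>" and b: "\<forall>js \<xi>. length js \<le> max N N' \<longrightarrow> norm (pds js \<phi> \<xi>) \<le> b" for \<phi> b
  proof -
    have "norm (u \<phi>) \<le> C * b" "norm (v \<phi>) \<le> C' * b" using b by (auto intro!: C(2) C'(2) \<phi>)
    then have "norm c * norm (u \<phi>) \<le> norm c * (C * b)" "norm d * norm (v \<phi>) \<le> norm d * (C' * b)"
      by (auto intro: mult_left_mono)
    then show ?thesis
      using norm_triangle_ineq[of "c * u \<phi>" "d * v \<phi>"] by (simp add: norm_mult algebra_simps)
  qed
  moreover have "0 \<le> norm c * C + norm d * C'" using C(1) C'(1) by auto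
  ultimately show "\<exists>C N. C \<ge> 0 \<and> (\<forall>\<phi> b. on_ann r R \<phi> \<longrightarrow> (\<forall>js \<xi>. length js \<le> N \<longrightarrow> norm (pds js \<phi> \<xi>) \<le> b)
        \<longrightarrow> norm (c * u \<phi> + d * v \<phi>) \<le> C * b)"
    by blast
qed

lemma functional_tendsto:
  assumes u: "cont_functional u" and r: "r > 0"
    and \<phi>: "\<And>i::nat. on_ann r R (\<phi> i)" and \<psi>: "on_ann r R \<psi>"
    and lim: "\<And>js \<epsilon>. \<epsilon> > 0 \<Longrightarrow> \<forall>\<^sub>F i in sequentially. \<forall>\<xi>. norm (pds js (\<phi> i) \<xi> - pds js \<psi> \<xi>) \<le> \<epsilon>"
  shows "(\<lambda>i. u (\<phi> i)) \<longlonglongrightarrow> u \<psi>"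
proof (rule tendstoI)
  fix \<epsilon> :: real assume "\<epsilon> > 0"
  obtain C N where C: "C \<ge> 0" "\<And>\<phi> b. on_ann r R \<phi> \<Longrightarrow> (\<And>js \<xi>. length js \<le> N \<Longrightarrow> norm (pds js \<phi> \<xi>) \<le> b) \<Longrightarrow> norm (u \<phi>) \<le> C * b"
    by (rule cont_functional_boundE[OF u r, of R]) blast
  \<comment> \<open>The extra 1 covers \<open>C = 0\<close> and leaves \<open>C * \<eta>\<close>
    strictly below \<epsilon>.\<close>
  define \<eta> where "\<eta> = \<epsilon> / (C + 1)"
  have \<eta>: "\<eta> > 0" using \<open>\<epsilon> > 0\<close> C(1) by (simp add: \<eta>_def)
  have "C * \<eta> = \<epsilon> * (C / (C + 1))" by (simp add: \<eta>_def)
  also have "\<dots> < \<epsilon> * 1" using \<open>\<epsilon> > 0\<close> C(1) by (intro mult_strict_left_mono) auto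
  finally have small: "C * \<eta> < \<epsilon>" by simp
  have "finite {js :: 2 list. length js \<le> N}" using finite_lists_length_le[of "UNIV :: 2 set" N] by simp
  then have "\<forall>\<^sub>F i in sequentially. \<forall>js\<in>{js. length js \<le> N}. \<forall>\<xi>. norm (pds js (\<phi> i) \<xi> - pds js \<psi> \<xi>) \<le> \<eta>"
    by (intro eventually_ball_finite ballI lim \<eta>)
  then show "\<forall>\<^sub>F i in sequentially. dist (u (\<phi> i)) (u \<psi>) < \<epsilon>"
  proof eventually_elim
    case (elim i)
    have "norm (u (\<lambda>\<xi>. \<phi> i \<xi> - \<psi> \<xi>)) \<le> C * \<eta>"
      using elim by (intro C(2) on_ann_diff \<phi> \<psi>) (simp add: pds_diff on_ann_smooth[OF \<phi>] on_ann_smooth[OF \<psi>])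
    moreover have "\<phi> i \<in> test_fun" "\<psi> \<in> test_fun" using \<phi> \<psi> r by (auto simp: test_fun_iff)
    ultimately show ?case using small by (simp add: functional_diff[OF u] dist_norm)
  qed
qed

text \<open>Replacing the parameter \<open>x\<close> by simple functions turns the integral into a finite sum, to
  which the linearity of \<open>u\<close> applies; its continuity gives the limit.\<close>

lemma interchange:
  fixes F :: "'a::euclidean_space \<Rightarrow> plane \<Rightarrow> complex" and k :: "'a \<Rightarrow> complex"
  assumes u: "cont_functional u" and r: "r > 0" and F: "\<And>x. on_ann r R (F x)"
    and cont: "\<And>js. continuous_on UNIV (\<lambda>p. pds js (F (fst p)) (snd p))"
    and growth: "\<And>js. \<exists>C n. \<forall>x \<xi>. norm (pds js (F x) \<xi>) \<le> C * (1 + norm x) ^ n"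
    and k[measurable]: "k \<in> borel_measurable borel"
    and kint: "\<And>n. integrable lborel (\<lambda>x. (1 + norm x) ^ n * norm (k x))"
  shows "on_ann r R (\<lambda>\<xi>. \<integral>x. k x * F x \<xi> \<partial>lborel)" (is "on_ann r R ?v")
    and "\<exists>C n. \<forall>x. norm (u (F x)) \<le> C * (1 + norm x) ^ n"
    and "(\<lambda>x. u (F x)) \<in> borel_measurable borel"
    and "u (\<lambda>\<xi>. \<integral>x. k x * F x \<xi> \<partial>lborel) = (\<integral>x. k x * u (F x) \<partial>lborel)"
proof -
  have smF: "smooth (F x)" for x using F on_ann_smooth by blast
  \<comment> \<open>Simple functions converging pointwise to the identity map; their norm is at most
    \<open>2 * norm x\<close>, so polynomial growth in x survives with an additional factor
    \<open>2 ^ n\<close>.\<close>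
  obtain s :: "nat \<Rightarrow> 'a \<Rightarrow> 'a" where s: "\<And>i. simple_function lborel (s i)" "\<And>x. (\<lambda>i. s i x) \<longlonglongrightarrow> x"
    "\<And>i x. norm (s i x) \<le> 2 * norm x"
    using borel_measurable_implies_sequence_metric[of "\<lambda>x::'a. x" lborel 0] by auto
  \<comment> \<open>After composition with a simple function any \<open>H\<close> is measurable.
    This is essential for \<open>H = (\<lambda>y. u (F y))\<close>, whose measurability is one of
    the claims.\<close>
  have ms: "(\<lambda>x. H (s i x)) \<in> borel_measurable borel" for H :: "'a \<Rightarrow> complex" and i
    using borel_measurable_simple_function[OF simple_function_compose[OF s(1), of H i]] by (simp add: o_def)
  have mF: "(\<lambda>x. pds js (F x) \<xi>) \<in> borel_measurable borel" for js \<xi>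
    by (intro borel_measurable_continuous_onI)
      (rule continuous_on_compose2[OF cont, of UNIV "\<lambda>x. (x, \<xi>)", simplified], intro continuous_intros)
  obtain C n where Cn: "\<And>js x \<xi>. norm (pds js (F x) \<xi>) \<le> C js * (1 + norm x) ^ n js"
    using growth by metis
  have C0: "0 \<le> C js" for js
    using order_trans[OF norm_ge_zero Cn[of js 0 0]] by simp
  have Cs: "norm (pds js (F (s i x)) \<xi>) \<le> (C js * 2 ^ n js) * (1 + norm x) ^ n js" for js i x \<xi>
  proof -
    have "norm (pds js (F (s i x)) \<xi>) \<le> C js * (1 + norm (s i x)) ^ n js" by (rule Cn)
    also have "\<dots> \<le> C js * (2 * (1 + norm x)) ^ n js"
      using s(3)[of i x] by (intro mult_left_mono power_mono C0) auto
    finally show ?thesis unfolding power_mult_distrib by (simp only: mult.assoc)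
  qed
  have bk: "integrable lborel (\<lambda>x. (D * (1 + norm x) ^ m) * norm (k x))" for D m
    using integrable_mult_right[OF kint[of m], of D] by (simp add: mult.assoc)
  have kI: "integrable lborel k"
    using kint[of 0] by (simp add: integrable_norm_iff)
  have V: "smooth (\<lambda>\<xi>. \<integral>x. k x * F (g x) \<xi> \<partial>lborel)"
      "pds js (\<lambda>\<xi>. \<integral>x. k x * F (g x) \<xi> \<partial>lborel) = (\<lambda>\<xi>. \<integral>x. k x * pds js (F (g x)) \<xi> \<partial>lborel)"
    if m: "\<And>js \<xi>. (\<lambda>x. pds js (F (g x)) \<xi>) \<in> borel_measurable borel"
      and b: "\<And>js. \<exists>D m. \<forall>x \<xi>. norm (pds js (F (g x)) \<xi>) \<le> D * (1 + norm x) ^ m" for g js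
  proof -
    have *: "pds js (\<lambda>\<xi>. k x * F (g x) \<xi>) \<xi> = k x * pds js (F (g x)) \<xi>" for js x \<xi>
      by (simp add: pds_cmult smF)
    have bnd: "\<exists>w. integrable lborel w \<and> (\<forall>x \<xi>. norm (pds js (\<lambda>\<xi>. k x * F (g x) \<xi>) \<xi>) \<le> w x)" for js
    proof -
      obtain D m where "\<And>x \<xi>. norm (pds js (F (g x)) \<xi>) \<le> D * (1 + norm x) ^ m" using b[of js] by blast
      then have "norm (pds js (\<lambda>\<xi>. k x * F (g x) \<xi>) \<xi>) \<le> (D * (1 + norm x) ^ m) * norm (k x)" for x \<xi>
        unfolding * norm_mult mult.commute[of "norm (k x)"] by (rule mult_right_mono) auto
      with bk show ?thesis by blast
    qed
    have meas: "(\<lambda>x. pds js (\<lambda>\<xi>. k x * F (g x) \<xi>) \<xi>) \<in> borel_measurable lborel" for js \<xi>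
      unfolding * using m by simp
    have sm: "smooth (\<lambda>\<xi>. k x * F (g x) \<xi>)" for x by (intro smooth_cmult smF)
    note smooth_and_pds_integral[OF sm meas bnd]
    then show "smooth (\<lambda>\<xi>. \<integral>x. k x * F (g x) \<xi> \<partial>lborel)"
      "pds js (\<lambda>\<xi>. \<integral>x. k x * F (g x) \<xi> \<partial>lborel) = (\<lambda>\<xi>. \<integral>x. k x * pds js (F (g x)) \<xi> \<partial>lborel)"
      unfolding * by auto
  qed
  have growth_s: "\<exists>D m. \<forall>x \<xi>. norm (pds js (F (s i x)) \<xi>) \<le> D * (1 + norm x) ^ m" for js i
    using Cs by blast
  have V1: "smooth ?v" "pds js ?v = (\<lambda>\<xi>. \<integral>x. k x * pds js (F x) \<xi> \<partial>lborel)" for js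
    using V[where g="\<lambda>x. x", OF mF growth] by simp_all
  define v where "v i \<xi> = (\<integral>x. k x * F (s i x) \<xi> \<partial>lborel)" for i \<xi>
  have V2: "smooth (v i)" "pds js (v i) = (\<lambda>\<xi>. \<integral>x. k x * pds js (F (s i x)) \<xi> \<partial>lborel)" for i js
    unfolding v_def using V[where g="s i", OF ms[of "\<lambda>y. pds _ (F y) _"] growth_s] by simp_all
  have F0: "F x \<xi> = 0" if "\<not> (r \<le> norm \<xi> \<and> norm \<xi> \<le> R)" for x \<xi>
    using F[of x] that by (auto simp: on_ann_def)
  show ann: "on_ann r R ?v"
  proof -
    have "?v \<xi> = 0" if "\<not> (r \<le> norm \<xi> \<and> norm \<xi> \<le> R)" for \<xi> by (simp add: F0[OF that])
    with V1(1) show ?thesis unfolding on_ann_def by blast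
  qed
  have annv: "on_ann r R (v i)" for i
  proof -
    have "v i \<xi> = 0" if "\<not> (r \<le> norm \<xi> \<and> norm \<xi> \<le> R)" for \<xi> by (simp add: v_def F0[OF that])
    with V2(1) show ?thesis unfolding on_ann_def by blast
  qed

  \<comment> \<open>Uniform continuity on a compact ball times the annulus gives convergence uniform
    in \<xi>; off the annulus all functions vanish.\<close>
  have unif: "\<forall>\<^sub>F i in sequentially. \<forall>\<xi>. norm (pds js (F (y i)) \<xi> - pds js (F z) \<xi>) \<le> \<epsilon>"
    if y: "y \<longlonglongrightarrow> z" and "\<epsilon> > 0" for js and y :: "nat \<Rightarrow> 'a" and z and \<epsilon> :: real
  proof -
    let ?K = "cball z 1 \<times> {\<xi>::plane. r \<le> norm \<xi> \<and> norm \<xi> \<le> R}"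
    have "uniformly_continuous_on ?K (\<lambda>p. pds js (F (fst p)) (snd p))"
      by (intro compact_uniformly_continuous compact_Times compact_cball compact_ann continuous_on_subset[OF cont]) auto
    then obtain d where d: "d > 0" "\<And>p q. p \<in> ?K \<Longrightarrow> q \<in> ?K \<Longrightarrow> dist q p < d \<Longrightarrow>
        dist (pds js (F (fst q)) (snd q)) (pds js (F (fst p)) (snd p)) < \<epsilon>"
      using \<open>\<epsilon> > 0\<close> unfolding uniformly_continuous_on_def by meson
    have "\<forall>\<^sub>F i in sequentially. dist (y i) z < min d 1"
      using y d(1) by (intro tendstoD) auto
    then show ?thesis
    proof (eventually_elim, intro allI)
      fix i \<xi> assume i: "dist (y i) z < min d 1"
      show "norm (pds js (F (y i)) \<xi> - pds js (F z) \<xi>) \<le> \<epsilon>"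
      proof (cases "r \<le> norm \<xi> \<and> norm \<xi> \<le> R")
        case True
        then show ?thesis using d(2)[of "(z, \<xi>)" "(y i, \<xi>)"] i by (auto simp: dist_Pair_Pair dist_norm norm_minus_commute)
      next
        case False
        then have "pds js (F x) \<xi> = 0" for x using on_ann_pds[OF F, of js x] by (auto simp: on_ann_def)
        with \<open>\<epsilon> > 0\<close> show ?thesis by simp
      qed
    qed
  qed
  have uF: "(\<lambda>i. u (F (s i x))) \<longlonglongrightarrow> u (F x)" for x
    by (intro functional_tendsto[OF u r F F] unif s(2))
  show muF: "(\<lambda>x. u (F x)) \<in> borel_measurable borel"
    by (rule borel_measurable_LIMSEQ_metric[OF ms[of "\<lambda>y. u (F y)"] uF])
  show "\<exists>D m. \<forall>x. norm (u (F x)) \<le> D * (1 + norm x) ^ m"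
  proof -
    obtain D N where D: "D \<ge> 0" "\<And>\<phi> b. on_ann r R \<phi> \<Longrightarrow> (\<And>js \<xi>. length js \<le> N \<Longrightarrow> norm (pds js \<phi> \<xi>) \<le> b) \<Longrightarrow> norm (u \<phi>) \<le> D * b"
      by (rule cont_functional_boundE[OF u r, of R]) blast
    let ?S = "{js :: 2 list. length js \<le> N}"
    have fin: "finite ?S" using finite_lists_length_le[of "UNIV :: 2 set" N] by simp
    have "norm (u (F x)) \<le> D * (sum C ?S * (1 + norm x) ^ sum n ?S)" for x
    proof (intro D(2) F)
      fix js :: "2 list" and \<xi> assume js: "length js \<le> N"
      have "norm (pds js (F x) \<xi>) \<le> C js * (1 + norm x) ^ n js" by (rule Cn)
      also have "\<dots> \<le> sum C ?S * (1 + norm x) ^ sum n ?S"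
        using js fin C0 by (intro mult_mono power_increasing member_le_sum sum_nonneg) auto
      finally show "norm (pds js (F x) \<xi>) \<le> sum C ?S * (1 + norm x) ^ sum n ?S" .
    qed
    then show ?thesis by (intro exI[of _ "D * sum C ?S"] exI[of _ "sum n ?S"]) (simp add: mult.assoc)
  qed
  then obtain D m where Dm: "\<And>x. norm (u (F x)) \<le> D * (1 + norm x) ^ m" by blast
  have D0: "0 \<le> D" using order_trans[OF norm_ge_zero Dm[of 0]] by simp

  \<comment> \<open>On simple functions the integral is a finite sum over the values y, with
    coefficient the integral of \<open>k\<close> over the level set of y, so linearity of
    \<open>u\<close> suffices.\<close>
  have uv: "u (v i) = (\<integral>x. k x * u (F (s i x)) \<partial>lborel)" for i
  proof -
    let ?S = "range (s i)" and ?A = "\<lambda>y. {x. s i x = y}"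
    define c where "c y = (\<integral>x. indicator (?A y) x *\<^sub>R k x \<partial>lborel)" for y
    have fin: "finite ?S" using simple_functionD(1)[OF s(1)[of i]] by simp
    have A: "?A y \<in> sets lborel" for y
      using simple_functionD(2)[OF s(1)[of i], of "{y}"] by (simp add: vimage_def)
    have *: "(\<integral>x. k x * H (s i x) \<partial>lborel) = (\<Sum>y\<in>?S. c y * H y)" for H
    proof -
      have "k x * H (s i x) = (\<Sum>y\<in>?S. (indicator (?A y) x *\<^sub>R k x) * H y)" for x
      proof -
        have "(\<Sum>y\<in>?S. (indicator (?A y) x *\<^sub>R k x) * H y) = (\<Sum>y\<in>?S. if y = s i x then k x * H y else 0)"
          by (intro sum.cong) (auto simp: indicator_def)
        then show ?thesis using fin by simp
      qed
      moreover have "integrable lborel (\<lambda>x. (indicator (?A y) x *\<^sub>R k x) * H y)" for y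
        by (intro integrable_mult_left integrable_mult_indicator A kI)
      ultimately show ?thesis
        unfolding c_def by (simp only: Bochner_Integration.integral_sum integral_mult_left_zero)
    qed
    have "v i = (\<lambda>\<xi>. \<Sum>y\<in>?S. c y * F y \<xi>)" unfolding v_def using *[of "\<lambda>y. F y _"] by auto
    moreover have "F y \<in> test_fun" for y using F r by (auto simp: test_fun_iff)
    ultimately have "u (v i) = (\<Sum>y\<in>?S. c y * u (F y))"
      by (simp add: functional_sum[OF u] functional_cmult[OF u] test_fun_cmult)
    then show ?thesis using *[of "\<lambda>y. u (F y)"] by simp
  qed
  have "(\<lambda>i. u (v i)) \<longlonglongrightarrow> u ?v"
  proof (rule functional_tendsto[OF u r annv ann])
    fix js and \<epsilon> :: real assume "\<epsilon> > 0"
    \<comment> \<open>A point where the estimate fails, if there is one. Dominated convergence along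
      these moving points gives uniformity in \<xi> without integrating a supremum over
      \<xi>.\<close>
    define \<Xi> where "\<Xi> i = (SOME \<xi>. \<not> norm (pds js (v i) \<xi> - pds js ?v \<xi>) \<le> \<epsilon>)" for i
    let ?d = "\<lambda>i x. pds js (F (s i x)) (\<Xi> i) - pds js (F x) (\<Xi> i)"
    have [measurable]: "?d i \<in> borel_measurable borel" for i
      using ms[of "\<lambda>y. pds js (F y) (\<Xi> i)" i] mF[of js "\<Xi> i"] by simp
    have db: "norm (?d i x) \<le> (C js * 2 ^ n js + C js) * (1 + norm x) ^ n js" for i x
      using norm_triangle_ineq4[of "pds js (F (s i x)) (\<Xi> i)" "pds js (F x) (\<Xi> i)"] Cs[of js i x "\<Xi> i"] Cn[of js x "\<Xi> i"]
      by (simp add: distrib_right)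
    have "(\<lambda>i. \<integral>x. norm (k x * ?d i x) \<partial>lborel) \<longlonglongrightarrow> (\<integral>x. 0 \<partial>(lborel :: 'a measure))"
    proof (rule integral_dominated_convergence[OF _ _ bk[of "C js * 2 ^ n js + C js" "n js"]])
      show "AE x in lborel. (\<lambda>i. norm (k x * ?d i x)) \<longlonglongrightarrow> 0"
      proof (intro AE_I2)
        fix x
        have "(\<lambda>i. norm (?d i x)) \<longlonglongrightarrow> 0"
        proof (rule tendstoI)
          fix e :: real assume "e > 0"
          with unif[OF s(2)[of x], of "e / 2" js] show "\<forall>\<^sub>F i in sequentially. dist (norm (?d i x)) 0 < e"
            by (auto elim!: eventually_mono) (smt (verit) field_sum_of_halves)
        qed
        then show "(\<lambda>i. norm (k x * ?d i x)) \<longlonglongrightarrow> 0"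
          unfolding norm_mult by (rule tendsto_mult_right_zero)
      qed
      show "AE x in lborel. norm (norm (k x * ?d i x)) \<le> (C js * 2 ^ n js + C js) * (1 + norm x) ^ n js * norm (k x)" for i
        using db[of i] by (auto simp: norm_mult mult.commute[of "norm (k _)"] intro!: mult_right_mono)
    qed simp_all
    then have "\<forall>\<^sub>F i in sequentially. (\<integral>x. norm (k x * ?d i x) \<partial>lborel) < \<epsilon>"
      using \<open>\<epsilon> > 0\<close> by (auto dest!: order_tendstoD(2)[of _ _ _ \<epsilon>])
    then show "\<forall>\<^sub>F i in sequentially. \<forall>\<xi>. norm (pds js (v i) \<xi> - pds js ?v \<xi>) \<le> \<epsilon>"
    proof eventually_elim
      case (elim i)
      have I: "integrable lborel (\<lambda>x. k x * H x)"
        if "H \<in> borel_measurable borel" "\<And>x. norm (H x) \<le> D * (1 + norm x) ^ m" for H and D m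
      proof (rule Bochner_Integration.integrable_bound[OF bk[of D m]])
        show "AE x in lborel. norm (k x * H x) \<le> norm (D * (1 + norm x) ^ m * norm (k x))"
        proof (intro AE_I2)
          fix x
          have "norm (k x * H x) \<le> (D * (1 + norm x) ^ m) * norm (k x)"
            unfolding norm_mult mult.commute[of "norm (k _)"] by (intro mult_right_mono that) simp
          then show "norm (k x * H x) \<le> norm (D * (1 + norm x) ^ m * norm (k x))" by simp
        qed
      qed (use that(1) in simp)
      note I = I[OF mF[of js "\<Xi> i"] Cn] I[OF ms[of "\<lambda>y. pds js (F y) (\<Xi> i)" i] Cs]
      have "norm (pds js (v i) (\<Xi> i) - pds js ?v (\<Xi> i)) = norm (\<integral>x. k x * ?d i x \<partial>lborel)"
        using I by (simp add: V1(2) V2(2) right_diff_distrib)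
      also have "\<dots> \<le> (\<integral>x. norm (k x * ?d i x) \<partial>lborel)" by (rule integral_norm_bound)
      finally have "norm (pds js (v i) (\<Xi> i) - pds js ?v (\<Xi> i)) \<le> \<epsilon>" using elim by simp
      then show ?case
        unfolding \<Xi>_def using someI[of "\<lambda>\<xi>. \<not> norm (pds js (v i) \<xi> - pds js ?v \<xi>) \<le> \<epsilon>"] by blast
    qed
  qed
  moreover have "(\<lambda>i. u (v i)) \<longlonglongrightarrow> (\<integral>x. k x * u (F x) \<partial>lborel)"
    unfolding uv
  proof (rule integral_dominated_convergence[OF _ _ bk[of "D * 2 ^ m" m]])
    show "AE x in lborel. (\<lambda>i. k x * u (F (s i x))) \<longlonglongrightarrow> k x * u (F x)"
      by (intro AE_I2 tendsto_intros uF)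
    show "AE x in lborel. norm (k x * u (F (s i x))) \<le> D * 2 ^ m * (1 + norm x) ^ m * norm (k x)" for i
    proof (intro AE_I2)
      fix x
      have "norm (u (F (s i x))) \<le> D * (1 + norm (s i x)) ^ m" by (rule Dm)
      also have "\<dots> \<le> D * (2 * (1 + norm x)) ^ m"
        using s(3)[of i x] by (intro mult_left_mono power_mono D0) auto
      finally show "norm (k x * u (F (s i x))) \<le> D * 2 ^ m * (1 + norm x) ^ m * norm (k x)"
        unfolding norm_mult power_mult_distrib mult.assoc[symmetric] mult.commute[of "norm (k _)"]
        by (rule mult_right_mono) simp
    qed
  qed (use muF ms[of "\<lambda>y. u (F y)"] in simp_all)
  ultimately show "u ?v = (\<integral>x. k x * u (F x) \<partial>lborel)" by (rule LIMSEQ_unique)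
qed

section \<open>Fourier transforms of rapidly decreasing functions\<close>

lemma lborel_plane_prod:
  fixes f g :: "real \<Rightarrow> complex"
  assumes "integrable lborel f" "integrable lborel g"
  shows "integrable lborel (\<lambda>x::plane. f (x $ 1) * g (x $ 2))"
    and "(\<integral>x. f ((x::plane) $ 1) * g (x $ 2) \<partial>lborel) = (\<integral>t. f t \<partial>lborel) * (\<integral>t. g t \<partial>lborel)"
proof -
  interpret product_sigma_finite "\<lambda>b::plane. lborel :: real measure" by standard
  define F where "F b = (if b = (axis 1 1 :: plane) then f else g)" for b
  let ?P = "\<Pi>\<^sub>M b\<in>Basis. (lborel :: real measure)" and ?T = "\<lambda>h::plane \<Rightarrow> real. \<Sum>b\<in>Basis. h b *\<^sub>R b"
  have ne: "axis (1::2) (1::real) \<noteq> axis 2 1" by (simp add: axis_eq_axis)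
  have B: "(Basis :: plane set) = {axis 1 1, axis 2 1}"
    by (auto simp: Basis_vec_def UNIV_2)
  have F: "integrable lborel (F b)" for b using assms by (simp add: F_def)
  have "F b \<in> borel_measurable borel" for b using F[of b] by (auto dest: borel_measurable_integrable)
  have c: "?T h $ 1 = h (axis 1 1)" "?T h $ 2 = h (axis 2 1)" for h
    using ne by (auto simp: B axis_def)
  have *: "f (?T h $ 1) * g (?T h $ 2) = (\<Prod>b\<in>Basis. F b (h b))" for h
    unfolding c using ne by (simp add: B F_def)
  have m: "(\<lambda>x::plane. f (x $ 1) * g (x $ 2)) \<in> borel_measurable borel"
    using assms by (auto dest!: borel_measurable_integrable)
  have T: "?T \<in> measurable ?P borel" by measurable
  show "integrable lborel (\<lambda>x::plane. f (x $ 1) * g (x $ 2))"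
    using product_integrable_prod[of Basis F, OF finite_Basis F] m
    by (subst lborel_eq, subst integrable_distr_eq[OF T]) (simp_all only: * measurable_lborel1)
  have "(\<integral>x. f ((x::plane) $ 1) * g (x $ 2) \<partial>lborel) = (\<integral>h. (\<Prod>b\<in>Basis. F b (h b)) \<partial>?P)"
    using m by (subst lborel_eq, subst integral_distr[OF T]) (simp_all only: * measurable_lborel1)
  also have "\<dots> = (\<Prod>b\<in>Basis. \<integral>t. F b t \<partial>lborel)"
    by (rule product_integral_prod[OF finite_Basis F])
  also have "\<dots> = (\<integral>t. f t \<partial>lborel) * (\<integral>t. g t \<partial>lborel)" using ne by (simp add: B F_def)
  finally show "(\<integral>x. f ((x::plane) $ 1) * g (x $ 2) \<partial>lborel) = (\<integral>t. f t \<partial>lborel) * (\<integral>t. g t \<partial>lborel)" .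
qed

text \<open>\<open>(1 + norm x)\<^sup>2\<close> dominates both \<open>1 + (x $ 1)\<^sup>2\<close>
  and \<open>1 + (x $ 2)\<^sup>2\<close>, so the inverse fourth power is controlled by a product of
  integrable functions of one variable.\<close>

lemma integrable_plane_weight: "integrable lborel (\<lambda>x::plane. inverse ((1 + norm x) ^ 4))"
proof -
  have "integrable lborel (\<lambda>t::real. inverse (1 + t\<^sup>2))"
    using integrable_inverse_1_plus_square by (simp add: set_integrable_def einterval_def)
  then have "integrable lborel (\<lambda>t::real. complex_of_real (inverse (1 + t\<^sup>2)))" by (rule integrable_of_real)
  from lborel_plane_prod(1)[OF this this]
  have I: "integrable lborel (\<lambda>x::plane. complex_of_real (inverse (1 + (x $ 1)\<^sup>2)) * complex_of_real (inverse (1 + (x $ 2)\<^sup>2)))" .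
  show ?thesis
  proof (rule Bochner_Integration.integrable_bound[OF I])
    show "AE x in lborel. norm (inverse ((1 + norm x) ^ 4)) \<le> norm (complex_of_real (inverse (1 + (x $ 1)\<^sup>2)) * complex_of_real (inverse (1 + ((x::plane) $ 2)\<^sup>2)))"
    proof (intro AE_I2)
      fix x :: plane
      have *: "1 + (x $ i)\<^sup>2 \<le> (1 + norm x)\<^sup>2" for i
      proof -
        have "(x $ i)\<^sup>2 \<le> (norm x)\<^sup>2" using component_le_norm_cart[of x i] by (simp add: abs_le_square_iff[symmetric])
        then have "1 + (x $ i)\<^sup>2 \<le> 1 + (norm x)\<^sup>2 + 2 * norm x" using norm_ge_zero[of x] by linarith
        then show ?thesis by (simp add: power2_sum)
      qed
      have "(1 + (x $ 1)\<^sup>2) * (1 + (x $ 2)\<^sup>2) \<le> (1 + norm x)\<^sup>2 * (1 + norm x)\<^sup>2"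
        by (intro mult_mono *) auto
      also have "\<dots> = (1 + norm x) ^ 4" by (simp flip: power_add)
      finally have "inverse ((1 + norm x) ^ 4) \<le> inverse ((1 + (x $ 1)\<^sup>2) * (1 + (x $ 2)\<^sup>2))"
        by (intro le_imp_inverse_le) (auto intro!: mult_pos_pos add_pos_nonneg)
      moreover have "norm (complex_of_real (inverse (1 + (x $ 1)\<^sup>2)) * complex_of_real (inverse (1 + (x $ 2)\<^sup>2)))
          = inverse ((1 + (x $ 1)\<^sup>2) * (1 + (x $ 2)\<^sup>2))"
        unfolding norm_mult norm_of_real by (simp add: abs_of_pos add_pos_nonneg)
      ultimately show "norm (inverse ((1 + norm x) ^ 4)) \<le> norm (complex_of_real (inverse (1 + (x $ 1)\<^sup>2)) * complex_of_real (inverse (1 + (x $ 2)\<^sup>2)))"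
        by simp
    qed
  qed simp
qed

text \<open>Decay without any condition on derivatives. It makes all moments integrable, which is
  what smoothness of the Fourier transform needs, and it tolerates factors of polynomial growth such
  as a functional tested on exponentials.\<close>

definition rapid :: "(plane \<Rightarrow> complex) \<Rightarrow> bool" where
  "rapid f \<longleftrightarrow> f \<in> borel_measurable borel \<and> (\<forall>k. \<exists>C. \<forall>x. (1 + norm x) ^ k * norm (f x) \<le> C)"

lemma rapid_measurable: "rapid f \<Longrightarrow> f \<in> borel_measurable borel" by (simp add: rapid_def)

lemma rapid_integrable:
  assumes "rapid f" shows "integrable lborel (\<lambda>x. (1 + norm x) ^ k * norm (f x))"
proof -
  have m: "f \<in> borel_measurable borel" using assms by (simp add: rapid_def)
  \<comment> \<open>Four spare powers pay for the integrable weight.\<close>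
  obtain C where C: "\<And>x. (1 + norm x) ^ (k + 4) * norm (f x) \<le> C"
    using assms unfolding rapid_def by meson
  show ?thesis
  proof (rule Bochner_Integration.integrable_bound[OF integrable_mult_right[OF integrable_plane_weight, of C]])
    show "AE x in lborel. norm ((1 + norm x) ^ k * norm (f x)) \<le> norm (C * inverse ((1 + norm x) ^ 4))"
    proof (intro AE_I2)
      fix x :: plane
      have "(1 + norm x) ^ k * norm (f x) * (1 + norm x) ^ 4 \<le> C"
        using C[of x] by (simp add: power_add algebra_simps)
      moreover have "0 < (1 + norm x) ^ 4" by (intro zero_less_power add_pos_nonneg) auto
      ultimately have "(1 + norm x) ^ k * norm (f x) \<le> C * inverse ((1 + norm x) ^ 4)"
        unfolding divide_inverse[symmetric] by (simp only: pos_le_divide_eq)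
      then show "norm ((1 + norm x) ^ k * norm (f x)) \<le> norm (C * inverse ((1 + norm x) ^ 4))"
        using mult_nonneg_nonneg[OF zero_le_power[of "1 + norm x" k] norm_ge_zero[of "f x"]] by auto
    qed
  qed (use m in simp)
qed

lemma rapid_integrable_0: "rapid f \<Longrightarrow> integrable lborel f"
  using rapid_integrable[of f 0] rapid_measurable[of f] by (simp add: integrable_norm_iff)

lemma rapid_mult:
  assumes "rapid f" "p \<in> borel_measurable borel" and p: "\<And>x. norm (p x) \<le> C * (1 + norm x) ^ n"
  shows "rapid (\<lambda>x. p x * f x)"
  unfolding rapid_def
proof (intro conjI allI)
  fix k
  obtain D where D: "\<And>x. (1 + norm x) ^ (k + n) * norm (f x) \<le> D"
    using assms(1) unfolding rapid_def by meson
  have C0: "C \<ge> 0" using order_trans[OF norm_ge_zero p[of 0]] by simp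
  have "(1 + norm x) ^ k * norm (p x * f x) \<le> C * D" for x
  proof -
    have "(1 + norm x) ^ k * norm (p x * f x) = ((1 + norm x) ^ k * norm (f x)) * norm (p x)" by (simp add: norm_mult)
    also have "\<dots> \<le> ((1 + norm x) ^ k * norm (f x)) * (C * (1 + norm x) ^ n)"
      by (intro mult_left_mono p) auto
    also have "\<dots> = C * ((1 + norm x) ^ (k + n) * norm (f x))" by (simp add: power_add)
    also have "\<dots> \<le> C * D" by (intro mult_left_mono D C0)
    finally show ?thesis .
  qed
  then show "\<exists>C. \<forall>x. (1 + norm x) ^ k * norm (p x * f x) \<le> C" by blast
qed (use assms in \<open>auto simp: rapid_def\<close>)

lemma rapid_add:
  assumes "rapid f" "rapid g" shows "rapid (\<lambda>x. f x + g x)"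
  unfolding rapid_def
proof (intro conjI allI)
  fix k
  obtain C D where CD: "\<And>x. (1 + norm x) ^ k * norm (f x) \<le> C" "\<And>x. (1 + norm x) ^ k * norm (g x) \<le> D"
    using assms unfolding rapid_def by meson
  have "(1 + norm x) ^ k * norm (f x + g x) \<le> C + D" for x
  proof -
    have "(1 + norm x) ^ k * norm (f x + g x) \<le> (1 + norm x) ^ k * (norm (f x) + norm (g x))"
      by (intro mult_left_mono norm_triangle_ineq) auto
    with CD[of x] show ?thesis by (simp add: distrib_left)
  qed
  then show "\<exists>C. \<forall>x. (1 + norm x) ^ k * norm (f x + g x) \<le> C" by blast
qed (use assms in \<open>auto simp: rapid_def\<close>)

lemma rapid_cmult: "rapid f \<Longrightarrow> rapid (\<lambda>x. c * f x)"
  by (rule rapid_mult[of f "\<lambda>_. c" "norm c" 0]) auto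

lemma rapid_bounded_support:
  assumes m: "f \<in> borel_measurable borel" and b: "\<And>x. norm (f x) \<le> C" and z: "\<And>x. norm x > R \<Longrightarrow> f x = 0"
  shows "rapid f"
  unfolding rapid_def
proof (intro conjI allI m exI)
  fix k x
  have "C \<ge> 0" using b[of 0] norm_ge_zero order_trans by blast
  show "(1 + norm x) ^ k * norm (f x) \<le> (1 + \<bar>R\<bar>) ^ k * C"
  proof (cases "norm x > R")
    case False
    then show ?thesis by (intro mult_mono power_mono b) auto
  qed (simp add: z \<open>C \<ge> 0\<close>)
qed

lemma on_ann_rapid:
  assumes "on_ann r R g" shows "rapid g"
proof -
  obtain C where C: "\<And>x. norm (g x) \<le> C" by (rule on_ann_bounded[OF assms]) blast
  show ?thesis
    by (rule rapid_bounded_support[OF smooth_measurable[OF on_ann_smooth[OF assms]] C, of R])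
      (use assms in \<open>auto simp: on_ann_def\<close>)
qed

text \<open>One transform for both signs: \<open>s = - 1\<close> is \<open>fourier\<close>,
  \<open>s = 1\<close> is \<open>inv_fourier\<close> up to the factor
  \<open>(2 * pi)\<^sup>2\<close>.\<close>

definition ft :: "real \<Rightarrow> (plane \<Rightarrow> complex) \<Rightarrow> plane \<Rightarrow> complex" where
  "ft s f \<xi> = (\<integral>x. cis (s * (x \<bullet> \<xi>)) * f x \<partial>lborel)"

lemma fourier_ft: "fourier f = ft (-1) f"
  by (simp add: fun_eq_iff fourier_def ft_def)

lemma inv_fourier_ft: "inv_fourier g = (\<lambda>x. ft 1 g x / complex_of_real ((2 * pi)\<^sup>2))"
  by (simp add: fun_eq_iff inv_fourier_def ft_def inner_commute)

lemma smooth_cis: "smooth (\<lambda>\<xi>. cis (s * (x \<bullet> \<xi>)))"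
  and pd_cis: "pd j (\<lambda>\<xi>. cis (s * (x \<bullet> \<xi>))) = (\<lambda>\<xi>. (\<i> * s * (x $ j)) * cis (s * (x \<bullet> \<xi>)))"
proof -
  let ?e = "\<lambda>\<xi>. cis (s * (x \<bullet> \<xi>))"
  have d: "(?e has_derivative (\<lambda>h. (s * (x \<bullet> h)) *\<^sub>R (\<i> * ?e \<xi>))) (at \<xi>)" for \<xi>
  proof -
    have "((\<lambda>t. exp (\<i> * complex_of_real t)) has_vector_derivative (\<i> * exp (\<i> * complex_of_real t))) (at t)" for t
      by (auto intro!: derivative_eq_intros has_vector_derivative_real_field)
    then have "(cis has_derivative (\<lambda>h. h *\<^sub>R (\<i> * cis t))) (at t)" for t
      by (simp add: has_vector_derivative_def cis_conv_exp[abs_def])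
    moreover have "((\<lambda>\<xi>. s * (x \<bullet> \<xi>)) has_derivative (\<lambda>h. s * (x \<bullet> h))) (at \<xi>)"
      by (auto intro!: derivative_eq_intros)
    ultimately show ?thesis by (rule has_derivative_compose[rotated])
  qed
  show pd: "pd j ?e = (\<lambda>\<xi>. (\<i> * s * (x $ j)) * ?e \<xi>)" for j
    by (auto simp: fun_eq_iff pd_eqI[OF d] inner_axis' scaleR_conv_of_real inner_axis)
  show "smooth ?e"
  proof (rule smooth_alg[where Q="\<lambda>f. f = ?e"])
    fix f j assume "f = ?e"
    then show "alg (\<lambda>f. f = ?e) (pd j f)"
      unfolding pd by (simp only: pd) (intro alg.mult alg.smooth[OF smooth_const] alg.base refl)
  qed (auto intro!: differentiableI[OF d] alg.base)
qed

lemma pd_cis_mult: "pd j (\<lambda>\<xi>. c * cis (s * (x \<bullet> \<xi>))) = (\<lambda>\<xi>. (c * (\<i> * s * (x $ j))) * cis (s * (x \<bullet> \<xi>)))"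
  by (rule ext) (simp add: pd_linear[OF bounded_linear_mult_right smooth_differentiable[OF smooth_cis]] pd_cis)

lemma pds_cis_mult: "pds js (\<lambda>\<xi>. c * cis (s * (x \<bullet> \<xi>))) = (\<lambda>\<xi>. (c * (\<Prod>j\<leftarrow>js. \<i> * s * (x $ j))) * cis (s * (x \<bullet> \<xi>)))"
proof (induction js)
  case (Cons j js)
  show ?case unfolding pds_Cons Cons pd_cis_mult by (simp add: mult_ac)
qed simp

lemma ft_smooth_and_pd:
  assumes f: "rapid f"
  shows "smooth (ft s f)" and "pd j (ft s f) = ft s (\<lambda>x. (\<i> * s * (x $ j)) * f x)"
proof -
  have n: "norm (\<Prod>j\<leftarrow>js. \<i> * s * (x $ j)) \<le> (\<bar>s\<bar> ^ length js) * (1 + norm x) ^ length js" for js and x :: plane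
  proof (induction js)
    case (Cons j js)
    have "norm (\<i> * s * (x $ j)) \<le> \<bar>s\<bar> * (1 + norm x)"
      using component_le_norm_cart[of x j] by (simp add: norm_mult mult_left_mono)
    with Cons have "norm (\<i> * s * (x $ j)) * norm (\<Prod>j\<leftarrow>js. \<i> * s * (x $ j)) \<le> (\<bar>s\<bar> * (1 + norm x)) * ((\<bar>s\<bar> ^ length js) * (1 + norm x) ^ length js)"
      by (intro mult_mono) auto
    then show ?case by (simp add: norm_mult algebra_simps)
  qed simp
  have [measurable]: "f \<in> borel_measurable borel" using f by (rule rapid_measurable)
  have [measurable]: "(\<lambda>x::plane. \<Prod>j\<leftarrow>js. \<i> * s * (x $ j)) \<in> borel_measurable borel" for js
    by (induction js) auto
  have p: "pds js (\<lambda>\<xi>. cis (s * (x \<bullet> \<xi>)) * f x) = (\<lambda>\<xi>. (f x * (\<Prod>j\<leftarrow>js. \<i> * s * (x $ j))) * cis (s * (x \<bullet> \<xi>)))" for js x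
    using pds_cis_mult[where js=js and c="f x" and s=s and x=x] by (simp add: mult.commute)
  have sm: "smooth (\<lambda>\<xi>. cis (s * (x \<bullet> \<xi>)) * f x)" for x by (intro smooth_mult smooth_cis smooth_const)
  have bnd: "\<exists>w. integrable lborel w \<and> (\<forall>x \<xi>. norm (pds js (\<lambda>\<xi>. cis (s * (x \<bullet> \<xi>)) * f x) \<xi>) \<le> w x)" for js
  proof (intro exI conjI allI)
    show "integrable lborel (\<lambda>x. (\<bar>s\<bar> ^ length js) * ((1 + norm x) ^ length js * norm (f x)))"
      by (intro integrable_mult_right rapid_integrable f)
    fix x \<xi>
    show "norm (pds js (\<lambda>\<xi>. cis (s * (x \<bullet> \<xi>)) * f x) \<xi>) \<le> (\<bar>s\<bar> ^ length js) * ((1 + norm x) ^ length js * norm (f x))"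
      using mult_right_mono[OF n[where js=js and x=x] norm_ge_zero[of "f x"]] unfolding p by (simp add: norm_mult algebra_simps)
  qed
  have meas: "(\<lambda>x. pds js (\<lambda>\<xi>. cis (s * (x \<bullet> \<xi>)) * f x) \<xi>) \<in> borel_measurable lborel" for js \<xi>
    unfolding p unfolding cis_conv_exp by measurable
  show "smooth (ft s f)" using smooth_and_pds_integral(1)[OF sm meas bnd] by (simp add: ft_def[abs_def])
  have "pds [j] (\<lambda>\<xi>. \<integral>x. cis (s * (x \<bullet> \<xi>)) * f x \<partial>lborel)
      = (\<lambda>\<xi>. \<integral>x. pds [j] (\<lambda>\<xi>. cis (s * (x \<bullet> \<xi>)) * f x) \<xi> \<partial>lborel)"
    by (rule smooth_and_pds_integral(2)[OF sm meas bnd])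
  then show "pd j (ft s f) = ft s (\<lambda>x. (\<i> * s * (x $ j)) * f x)"
    unfolding p unfolding ft_def[abs_def] by (simp add: mult_ac)
qed

text \<open>Integration by parts in its simplest form: the integral of a translate of
  \<open>g\<close> does not depend on the translation, and differentiating in the translation
  parameter under the integral gives the claim.\<close>

lemma on_ann_integral_pd:
  assumes g: "on_ann r R g" shows "(\<integral>x. pd j g x \<partial>lborel) = 0"
proof -
  obtain C where C: "C \<ge> 0" "\<And>x. norm (pd j g x) \<le> C" by (rule on_ann_bounded[OF on_ann_pd[OF g]]) blast
  have sh: "((\<lambda>y. g (x + y)) has_derivative (\<lambda>h. \<Sum>j\<in>UNIV. h $ j *\<^sub>R pd j g (x + y))) (at y)" for x y
    by (rule has_derivative_compose[OF _ smooth_has_derivative[OF on_ann_smooth[OF g]], where f'="\<lambda>h. h", simplified])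
      (auto intro!: derivative_eq_intros)
  have psh: "pd j (\<lambda>y. g (x + y)) y = pd j g (x + y)" for x y
    by (simp add: pd_eqI[OF sh] axis_def if_distrib if_distribR cong: if_cong)
  have T: "(\<integral>x. g (x + y) \<partial>lborel) = (\<integral>x. g x \<partial>lborel)" "integrable lborel (\<lambda>x. g (x + y))" for y
  proof -
    have gi: "integrable (distr lborel borel ((+) y)) g"
      unfolding lborel_distr_plus by (rule rapid_integrable_0[OF on_ann_rapid[OF g]])
    have gm: "g \<in> borel_measurable borel" by (rule smooth_measurable[OF on_ann_smooth[OF g]])
    show "integrable lborel (\<lambda>x. g (x + y))"
      using gi gm by (subst (asm) integrable_distr_eq) (auto simp: add.commute)
    have "(\<integral>x. g x \<partial>lborel) = (\<integral>x. g x \<partial>distr lborel borel ((+) y))" unfolding lborel_distr_plus ..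
    also have "\<dots> = (\<integral>x. g (y + x) \<partial>lborel)" using gm by (subst integral_distr) auto
    finally show "(\<integral>x. g (x + y) \<partial>lborel) = (\<integral>x. g x \<partial>lborel)" by (simp add: add.commute)
  qed
  \<comment> \<open>Translations shorter than 1 keep the support within radius \<open>R + 1\<close>,
    hence the majorant used here.\<close>
  have "((\<lambda>t. \<integral>x. g (x + (0 + t *\<^sub>R axis j 1)) \<partial>lborel) has_vector_derivative (\<integral>x. pd j (\<lambda>y. g (x + y)) 0 \<partial>lborel)) (at 0)"
  proof (rule pd_integral[where w="\<lambda>x. C * indicator (cball 0 (R + 1)) x"])
    show "(\<lambda>y. g (x + y)) differentiable (at \<eta>)" for x \<eta> using sh by (auto simp: differentiable_def)
    show "integrable lborel (\<lambda>x::plane. C * indicator (cball 0 (R + 1)) x)"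
      by (intro integrable_mult_right integrable_real_indicator) (use emeasure_bounded_finite[OF bounded_cball[of "0 :: plane" "R + 1"]] in auto)
    show "(\<lambda>x. pd j (\<lambda>y. g (x + y)) 0) \<in> borel_measurable lborel"
      unfolding psh using smooth_measurable[OF smooth_pd[OF on_ann_smooth[OF g]]] by simp
    fix x \<eta> :: plane assume \<eta>: "\<eta> \<in> ball 0 1"
    show "norm (pd j (\<lambda>y. g (x + y)) \<eta>) \<le> C * indicator (cball 0 (R + 1)) x"
    proof (cases "norm x \<le> R + 1")
      case False
      then have "norm (x + \<eta>) > R" using norm_triangle_ineq2[of x "- \<eta>"] \<eta> by simp
      then have "pd j g (x + \<eta>) = 0" using on_ann_pd[OF g, of j] unfolding on_ann_def by (meson not_less)
      with C(1) show ?thesis by (simp add: psh)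
    qed (use C in \<open>simp add: psh\<close>)
  qed (rule T(2))
  then have "((\<lambda>t::real. \<integral>x. g x \<partial>lborel) has_vector_derivative (\<integral>x. pd j g x \<partial>lborel)) (at 0)"
    by (simp add: T(1) psh)
  from vector_derivative_unique_at[OF this has_vector_derivative_const] show ?thesis .
qed

lemma ft_of_pd:
  assumes g: "on_ann r R g" shows "ft s (pd j g) \<xi> = - (\<i> * s * (\<xi> $ j)) * ft s g \<xi>"
proof -
  let ?e = "\<lambda>x. cis (s * (\<xi> \<bullet> x))"
  have sg: "smooth g" using g by (rule on_ann_smooth)
  have G: "on_ann r R (\<lambda>x. ?e x * g x)" by (intro on_ann_mult g smooth_cis)
  have "pd j (\<lambda>x. ?e x * g x) = (\<lambda>x. ?e x * pd j g x + (\<i> * s * (\<xi> $ j)) * (?e x * g x))"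
    by (auto simp: pd_mult smooth_differentiable smooth_cis sg pd_cis algebra_simps)
  with on_ann_integral_pd[OF G, of j]
  have "(\<integral>x. ?e x * pd j g x + (\<i> * s * (\<xi> $ j)) * (?e x * g x) \<partial>lborel) = 0" by simp
  moreover have "integrable lborel (\<lambda>x. ?e x * pd j g x)" "integrable lborel (\<lambda>x. (\<i> * s * (\<xi> $ j)) * (?e x * g x))"
    using on_ann_rapid[OF on_ann_mult[OF on_ann_pd[OF g, of j] smooth_cis[of s \<xi>]]] on_ann_rapid[OF G]
    by (auto intro: rapid_integrable_0)
  ultimately have "(\<integral>x. ?e x * pd j g x \<partial>lborel) + (\<i> * s * (\<xi> $ j)) * (\<integral>x. ?e x * g x \<partial>lborel) = 0" by simp
  then show ?thesis by (simp add: ft_def inner_commute eq_neg_iff_add_eq_0)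
qed

lemma ft_bounded: assumes "rapid f" shows "norm (ft s f \<xi>) \<le> (\<integral>x. norm (f x) \<partial>lborel)"
  unfolding ft_def by (rule order_trans[OF integral_norm_bound]) (simp add: norm_mult)

text \<open>Each power of |\<xi>| is traded for a derivative of \<open>g\<close> by
  \<open>ft_of_pd\<close>; the induction on the power generalises \<open>g\<close>, since its
  partial derivatives live on the same annulus.\<close>

lemma ft_rapid:
  assumes g: "on_ann r R g" and s: "\<bar>s\<bar> = 1" shows "rapid (ft s g)"
proof -
  have "\<exists>C. \<forall>\<xi>. (1 + norm \<xi>) ^ k * norm (ft s g \<xi>) \<le> C" for k
    using g
  proof (induction k arbitrary: g)
    case 0
    show ?case using ft_bounded[OF on_ann_rapid[OF 0]] by auto
  next
    case (Suc k)
    obtain C0 where C0: "\<And>\<xi>. (1 + norm \<xi>) ^ k * norm (ft s g \<xi>) \<le> C0" using Suc.IH[OF Suc.prems] by blast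
    obtain C where C: "\<And>\<xi> j. (1 + norm \<xi>) ^ k * norm (ft s (pd j g) \<xi>) \<le> C j" using Suc.IH[OF on_ann_pd[OF Suc.prems]] by metis
    have "(1 + norm \<xi>) ^ Suc k * norm (ft s g \<xi>) \<le> C0 + C 1 + C 2" for \<xi>
    proof -
      have "norm \<xi> \<le> \<bar>\<xi> $ 1\<bar> + \<bar>\<xi> $ 2\<bar>" using norm_le_l1_cart[of \<xi>] by (simp add: sum_2)
      then have "(1 + norm \<xi>) ^ k * norm (ft s g \<xi>) * (1 + norm \<xi>) \<le> (1 + norm \<xi>) ^ k * norm (ft s g \<xi>) * (1 + \<bar>\<xi> $ 1\<bar> + \<bar>\<xi> $ 2\<bar>)"
        by (intro mult_left_mono) auto
      moreover have "norm (ft s (pd j g) \<xi>) = \<bar>\<xi> $ j\<bar> * norm (ft s g \<xi>)" for j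
        by (simp add: ft_of_pd[OF Suc.prems] norm_mult s)
      ultimately show ?thesis using C0[of \<xi>] C[of \<xi> 1] C[of \<xi> 2] by (simp add: algebra_simps)
    qed
    then show ?case by blast
  qed
  moreover have "ft s g \<in> borel_measurable borel"
    by (intro smooth_measurable ft_smooth_and_pd on_ann_rapid[OF g])
  ultimately show ?thesis by (simp add: rapid_def)
qed

lemma smooth_complex_component: "smooth (\<lambda>x. complex_of_real (x $ j))"
  by (intro smooth_of_real smooth_component)

lemma on_ann_component: "on_ann r R g \<Longrightarrow> on_ann r R (\<lambda>x. (c * complex_of_real (x $ j)) * g x)"
  by (intro on_ann_mult smooth_mult smooth_const smooth_complex_component)

lemma pds_ft:
  assumes "on_ann r R g" shows "\<exists>h. on_ann r R h \<and> pds js (ft s g) = ft s h"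
proof (induction js)
  case Nil
  show ?case using assms by auto
next
  case (Cons j js)
  then obtain h where "on_ann r R h" "pds js (ft s g) = ft s h" by blast
  then have "on_ann r R (\<lambda>x. (\<i> * s * (x $ j)) * h x)" "pds (j # js) (ft s g) = ft s (\<lambda>x. (\<i> * s * (x $ j)) * h x)"
    using on_ann_component[of r R h "\<i> * s"] by (auto simp: ft_smooth_and_pd(2)[OF on_ann_rapid])
  then show ?case by blast
qed

lemma inv_fourier_schwartz:
  assumes g: "on_ann r R g" shows "inv_fourier g \<in> schwartz"
proof -
  let ?c = "1 / complex_of_real ((2 * pi)\<^sup>2)"
  have i: "inv_fourier g = (\<lambda>x. ?c * ft 1 g x)" by (simp add: inv_fourier_ft)
  have sm: "smooth (ft 1 g)" by (intro ft_smooth_and_pd on_ann_rapid[OF g])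
  have "\<exists>C. \<forall>x. norm x ^ k * norm (pds js (inv_fourier g) x) \<le> C" for k js
  proof -
    obtain h where h: "on_ann r R h" "pds js (ft 1 g) = ft 1 h" using pds_ft[OF g] by blast
    have "rapid (\<lambda>x. ?c * ft 1 h x)" by (intro rapid_cmult ft_rapid[OF h(1)]) simp
    then obtain C where C: "\<And>x. (1 + norm x) ^ k * norm (?c * ft 1 h x) \<le> C" unfolding rapid_def by meson
    have "pds js (inv_fourier g) = (\<lambda>x. ?c * ft 1 h x)" unfolding i pds_cmult[OF sm] h(2) ..
    moreover have "norm x ^ k * norm (?c * ft 1 h x) \<le> C" for x
      by (rule order_trans[OF mult_right_mono[OF power_mono] C]) auto
    ultimately show ?thesis by (intro exI[of _ C]) simp
  qed
  moreover have "smooth (inv_fourier g)" unfolding i by (intro smooth_cmult sm)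
  ultimately show ?thesis by (simp add: schwartz_def)
qed

lemma schwartz_rapid:
  assumes "f \<in> schwartz" shows "rapid f"
  unfolding rapid_def
proof (intro conjI allI)
  show "f \<in> borel_measurable borel" using assms by (auto simp: schwartz_def intro: smooth_measurable)
  fix k
  obtain C0 where C0: "\<And>x. norm x ^ 0 * norm (pds [] f x) \<le> C0" using assms unfolding schwartz_def by blast
  obtain C where C: "\<And>x. norm x ^ k * norm (pds [] f x) \<le> C" using assms unfolding schwartz_def by blast
  have "(1 + norm x) ^ k * norm (f x) \<le> 2 ^ k * (C0 + C)" for x
  proof -
    have "(1 + norm x) ^ k \<le> 2 ^ k * (1 + norm x ^ k)"
    proof (cases "norm x \<le> 1")
      case True
      then have "(1 + norm x) ^ k \<le> 2 ^ k" by (intro power_mono) auto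
      also have "\<dots> \<le> 2 ^ k * (1 + norm x ^ k)" by simp
      finally show ?thesis .
    next
      case False
      then have "(1 + norm x) ^ k \<le> (2 * norm x) ^ k" by (intro power_mono) auto
      also have "\<dots> \<le> 2 ^ k * (1 + norm x ^ k)" by (simp add: power_mult_distrib)
      finally show ?thesis .
    qed
    then have "(1 + norm x) ^ k * norm (f x) \<le> (2 ^ k * (1 + norm x ^ k)) * norm (f x)" by (intro mult_right_mono) auto
    also have "\<dots> = 2 ^ k * (norm (f x) + norm x ^ k * norm (f x))" by (simp add: algebra_simps)
    also have "\<dots> \<le> 2 ^ k * (C0 + C)" using C0[of x] C[of x] by (intro mult_left_mono add_mono) auto
    finally show ?thesis .
  qed
  then show "\<exists>C. \<forall>x. (1 + norm x) ^ k * norm (f x) \<le> C" by blast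
qed

section \<open>Gaussian regularisation and Fourier inversion\<close>

lemma lborel_integral_affine:
  fixes f :: "plane \<Rightarrow> complex"
  assumes "c \<noteq> 0" and f: "f \<in> borel_measurable borel"
  shows "(\<integral>x. f x \<partial>lborel) = complex_of_real (c\<^sup>2) * (\<integral>x. f (t + c *\<^sub>R x) \<partial>lborel)"
proof -
  have "(\<integral>x. f x \<partial>lborel) = (\<integral>x. f x \<partial>density (distr lborel borel (\<lambda>x::plane. t + c *\<^sub>R x)) (\<lambda>_. \<bar>c\<bar> ^ DIM(plane)))"
    using lborel_affine[OF assms(1), of t] by simp
  also have "\<dots> = (\<integral>x. c\<^sup>2 *\<^sub>R f x \<partial>distr lborel borel (\<lambda>x::plane. t + c *\<^sub>R x))"
    using f by (subst integral_density) (auto simp: power2_eq_square)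
  also have "\<dots> = (\<integral>x. c\<^sup>2 *\<^sub>R f (t + c *\<^sub>R x) \<partial>lborel)"
    using f by (subst integral_distr) auto
  finally show ?thesis by (simp add: scaleR_conv_of_real)
qed

lemma lborel_integral_reflect:
  fixes f :: "plane \<Rightarrow> complex"
  assumes "f \<in> borel_measurable borel"
  shows "(\<integral>x. f (- x) \<partial>lborel) = (\<integral>x. f x \<partial>lborel)"
  using lborel_integral_affine[of "-1" f 0] assms by simp

text \<open>The standard Gaussian density of the plane, as a product so that its Fourier transform
  factors into two characteristic functions of the normal law.\<close>

definition gs :: "plane \<Rightarrow> real" where
  "gs x = std_normal_density (x $ 1) * std_normal_density (x $ 2)"

lemma gs_eq: "gs x = exp (- (norm x)\<^sup>2 / 2) / (2 * pi)"
proof -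
  have "(norm x)\<^sup>2 = (x $ 1)\<^sup>2 + (x $ 2)\<^sup>2"
    unfolding power2_norm_eq_inner inner_vec_def sum_2 by (simp add: power2_eq_square)
  then have "exp (- (norm x)\<^sup>2 / 2) = exp (- (x $ 1)\<^sup>2 / 2) * exp (- (x $ 2)\<^sup>2 / 2)"
    by (simp add: exp_add[symmetric] add_divide_distrib diff_divide_distrib)
  then show ?thesis by (simp add: gs_def std_normal_density_def)
qed

lemma gs_nonneg: "0 \<le> gs x" and gs_measurable [measurable]: "gs \<in> borel_measurable borel"
  unfolding gs_def[abs_def] by auto

lemma std_normal_ft:
  "integrable lborel (\<lambda>x. cis (t * x) * complex_of_real (std_normal_density x))"
  "(\<integral>x. cis (t * x) * complex_of_real (std_normal_density x) \<partial>lborel) = complex_of_real (exp (- t\<^sup>2 / 2))"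
proof -
  have "integrable lborel (\<lambda>x. complex_of_real (std_normal_density x))" by (intro integrable_of_real) simp
  then show "integrable lborel (\<lambda>x. cis (t * x) * complex_of_real (std_normal_density x))"
    by (rule Bochner_Integration.integrable_bound) (auto simp: norm_mult cis_conv_exp)
  have "complex_of_real (exp (- t\<^sup>2 / 2)) = (\<integral>x. iexp (t * x) \<partial>density lborel std_normal_density)"
    using char_std_normal_distribution unfolding char_def by (metis (no_types, lifting))
  also have "\<dots> = (\<integral>x. std_normal_density x *\<^sub>R iexp (t * x) \<partial>lborel)"
    by (subst integral_density) auto
  finally show "(\<integral>x. cis (t * x) * complex_of_real (std_normal_density x) \<partial>lborel) = complex_of_real (exp (- t\<^sup>2 / 2))"
    by (simp add: scaleR_conv_of_real cis_conv_exp mult.commute)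
qed

lemma gs_ft:
  "integrable lborel (\<lambda>x. cis (x \<bullet> y) * complex_of_real (gs x))"
  "(\<integral>x. cis (x \<bullet> y) * complex_of_real (gs x) \<partial>lborel) = complex_of_real (2 * pi * gs y)"
proof -
  let ?f = "\<lambda>i t. cis (y $ i * t) * complex_of_real (std_normal_density t)"
  have *: "cis (x \<bullet> y) * complex_of_real (gs x) = ?f 1 (x $ 1) * ?f 2 (x $ 2)" for x
    by (simp add: gs_def inner_vec_def sum_2 cis_mult[symmetric] mult_ac)
  show "integrable lborel (\<lambda>x. cis (x \<bullet> y) * complex_of_real (gs x))"
    unfolding * by (intro lborel_plane_prod(1) std_normal_ft(1))
  have "(\<integral>x. cis (x \<bullet> y) * complex_of_real (gs x) \<partial>lborel) = complex_of_real (exp (- (y $ 1)\<^sup>2 / 2)) * complex_of_real (exp (- (y $ 2)\<^sup>2 / 2))"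
    unfolding * by (subst lborel_plane_prod(2)) (simp_all only: std_normal_ft)
  also have "\<dots> = complex_of_real (2 * pi * gs y)"
    by (simp add: gs_def std_normal_density_def)
  finally show "(\<integral>x. cis (x \<bullet> y) * complex_of_real (gs x) \<partial>lborel) = complex_of_real (2 * pi * gs y)" .
qed

lemma gs_integral: "integrable lborel gs" "(\<integral>x. complex_of_real (gs x) \<partial>lborel) = 1"
proof -
  have "integrable lborel (\<lambda>x. complex_of_real (gs x))" using gs_ft(1)[of 0] by simp
  then show "integrable lborel gs" by (simp add: complex_of_real_integrable_eq)
  show "(\<integral>x. complex_of_real (gs x) \<partial>lborel) = 1" using gs_ft(2)[of 0] by (simp add: gs_eq)
qed

text \<open>Damping by a Gaussian makes the double integral absolutely convergent, so Fubini
  applies. The inner integral is the transform of the Gaussian at \<eta> - \<xi> scaled by 1 /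
  \<epsilon>; substituting \<eta> = \<xi> + \<epsilon> y removes the scale.\<close>

lemma ft_inversion_smoothed:
  assumes g: "on_ann r R g" and \<epsilon>: "\<epsilon> > 0"
  shows "(\<integral>x. cis (- (x \<bullet> \<xi>)) * ft 1 g x * complex_of_real (gs (\<epsilon> *\<^sub>R x)) \<partial>lborel)
    = (\<integral>y. 2 * pi * complex_of_real (gs y) * g (\<xi> + \<epsilon> *\<^sub>R y) \<partial>lborel)"
proof -
  have [measurable]: "g \<in> borel_measurable borel" by (rule smooth_measurable[OF on_ann_smooth[OF g]])
  let ?h = "\<lambda>x \<eta>. cis (x \<bullet> (\<eta> - \<xi>)) * complex_of_real (gs (\<epsilon> *\<^sub>R x)) * g \<eta>"
  have hm: "(\<lambda>(x, \<eta>). ?h x \<eta>) \<in> borel_measurable (lborel \<Otimes>\<^sub>M lborel)"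
    unfolding cis_conv_exp by measurable
  have gi: "integrable lborel g" by (intro rapid_integrable_0 on_ann_rapid[OF g])
  have gse: "integrable lborel (\<lambda>x. gs (\<epsilon> *\<^sub>R x))"
  proof -
    have "integrable (density (distr lborel borel (\<lambda>x::plane. 0 + \<epsilon> *\<^sub>R x)) (\<lambda>_. \<bar>\<epsilon>\<bar> ^ DIM(plane))) gs"
      using lborel_affine[of \<epsilon> "0::plane"] \<epsilon> gs_integral(1) by simp
    then have "integrable lborel (\<lambda>x. \<epsilon>\<^sup>2 *\<^sub>R gs (\<epsilon> *\<^sub>R x))"
      using \<epsilon> by (subst (asm) integrable_density) (auto simp: power2_eq_square integrable_distr_eq)
    then show ?thesis using \<epsilon> by simp
  qed
  have nh: "norm (?h x \<eta>) = gs (\<epsilon> *\<^sub>R x) * norm (g \<eta>)" for x \<eta>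
    by (simp add: norm_mult gs_nonneg)
  have hI: "integrable (lborel \<Otimes>\<^sub>M lborel) (\<lambda>(x, \<eta>). ?h x \<eta>)"
  proof (rule lborel_pair.Fubini_integrable[OF hm])
    show "integrable lborel (\<lambda>x. \<integral>\<eta>. norm (case (x, \<eta>) of (x, \<eta>) \<Rightarrow> ?h x \<eta>) \<partial>lborel)"
      using gse by (simp only: prod.case nh integral_mult_right_zero integrable_mult_left)
    show "AE x in lborel. integrable lborel (\<lambda>\<eta>. case (x, \<eta>) of (x, \<eta>) \<Rightarrow> ?h x \<eta>)"
    proof (intro AE_I2)
      fix x
      have "integrable lborel (\<lambda>\<eta>. gs (\<epsilon> *\<^sub>R x) * norm (g \<eta>))" using gi by simp
      then show "integrable lborel (\<lambda>\<eta>. case (x, \<eta>) of (x, \<eta>) \<Rightarrow> ?h x \<eta>)"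
        by (rule Bochner_Integration.integrable_bound) (auto simp: norm_mult gs_nonneg cis_conv_exp)
    qed
  qed
  have "(\<integral>x. cis (- (x \<bullet> \<xi>)) * ft 1 g x * complex_of_real (gs (\<epsilon> *\<^sub>R x)) \<partial>lborel) = (\<integral>x. \<integral>\<eta>. ?h x \<eta> \<partial>lborel \<partial>lborel)"
  proof (rule Bochner_Integration.integral_cong[OF refl])
    fix x :: plane
    have "(\<integral>\<eta>. ?h x \<eta> \<partial>lborel) = (\<integral>\<eta>. (cis (- (x \<bullet> \<xi>)) * complex_of_real (gs (\<epsilon> *\<^sub>R x))) * (cis (1 * (\<eta> \<bullet> x)) * g \<eta>) \<partial>lborel)"
    proof (rule Bochner_Integration.integral_cong[OF refl])
      fix \<eta>
      have "cis (x \<bullet> (\<eta> - \<xi>)) = cis (- (x \<bullet> \<xi>)) * cis (1 * (\<eta> \<bullet> x))"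
        by (simp add: cis_mult inner_diff_right inner_commute)
      then show "?h x \<eta> = (cis (- (x \<bullet> \<xi>)) * complex_of_real (gs (\<epsilon> *\<^sub>R x))) * (cis (1 * (\<eta> \<bullet> x)) * g \<eta>)"
        by (simp only: mult_ac)
    qed
    also have "\<dots> = cis (- (x \<bullet> \<xi>)) * ft 1 g x * complex_of_real (gs (\<epsilon> *\<^sub>R x))"
      unfolding integral_mult_right_zero ft_def by (simp add: mult_ac)
    finally show "cis (- (x \<bullet> \<xi>)) * ft 1 g x * complex_of_real (gs (\<epsilon> *\<^sub>R x)) = (\<integral>\<eta>. ?h x \<eta> \<partial>lborel)" by simp
  qed
  also have "\<dots> = (\<integral>\<eta>. \<integral>x. ?h x \<eta> \<partial>lborel \<partial>lborel)"
    by (rule lborel_pair.Fubini_integral[symmetric, OF hI])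
  also have "\<dots> = (\<integral>\<eta>. complex_of_real (2 * pi * gs ((1 / \<epsilon>) *\<^sub>R (\<eta> - \<xi>)) / \<epsilon>\<^sup>2) * g \<eta> \<partial>lborel)"
  proof (rule Bochner_Integration.integral_cong[OF refl])
    fix \<eta>
    let ?k = "\<lambda>x. cis (x \<bullet> ((1 / \<epsilon>) *\<^sub>R (\<eta> - \<xi>))) * complex_of_real (gs x)"
    have "?k \<in> borel_measurable borel" unfolding cis_conv_exp by measurable
    from lborel_integral_affine[OF _ this, of \<epsilon> 0] \<epsilon>
    have "complex_of_real (2 * pi * gs ((1 / \<epsilon>) *\<^sub>R (\<eta> - \<xi>))) = complex_of_real (\<epsilon>\<^sup>2) * (\<integral>x. cis (x \<bullet> (\<eta> - \<xi>)) * complex_of_real (gs (\<epsilon> *\<^sub>R x)) \<partial>lborel)"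
      unfolding gs_ft(2) by simp
    then have "(\<integral>x. cis (x \<bullet> (\<eta> - \<xi>)) * complex_of_real (gs (\<epsilon> *\<^sub>R x)) \<partial>lborel) = complex_of_real (2 * pi * gs ((1 / \<epsilon>) *\<^sub>R (\<eta> - \<xi>)) / \<epsilon>\<^sup>2)"
      using \<epsilon> by (simp add: field_simps)
    then show "(\<integral>x. ?h x \<eta> \<partial>lborel) = complex_of_real (2 * pi * gs ((1 / \<epsilon>) *\<^sub>R (\<eta> - \<xi>)) / \<epsilon>\<^sup>2) * g \<eta>"
      unfolding integral_mult_left_zero by simp
  qed
  also have "\<dots> = (\<integral>y. 2 * pi * complex_of_real (gs y) * g (\<xi> + \<epsilon> *\<^sub>R y) \<partial>lborel)"
  proof -
    let ?k = "\<lambda>\<eta>. complex_of_real (2 * pi * gs ((1 / \<epsilon>) *\<^sub>R (\<eta> - \<xi>)) / \<epsilon>\<^sup>2) * g \<eta>"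
    have "(\<integral>x. ?k x \<partial>lborel) = complex_of_real (\<epsilon>\<^sup>2) * (\<integral>x. ?k (\<xi> + \<epsilon> *\<^sub>R x) \<partial>lborel)"
      by (rule lborel_integral_affine) (use \<epsilon> in auto)
    also have "\<dots> = (\<integral>x. complex_of_real (\<epsilon>\<^sup>2) * ?k (\<xi> + \<epsilon> *\<^sub>R x) \<partial>lborel)"
      by (simp only: integral_mult_right_zero)
    also have "\<dots> = (\<integral>y. 2 * pi * complex_of_real (gs y) * g (\<xi> + \<epsilon> *\<^sub>R y) \<partial>lborel)"
      by (rule Bochner_Integration.integral_cong) (use \<epsilon> in \<open>auto simp: field_simps\<close>)
    finally show ?thesis .
  qed
  finally show ?thesis .
qed

text \<open>Let \<epsilon> tend to 0 in \<open>ft_inversion_smoothed\<close>. The left side keeps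
  the factor \<open>gs 0 = 1 / (2 * pi)\<close>, the right side tends to
  \<open>2 * pi * g \<xi>\<close>, which together give the normalisation
  \<open>(2 * pi)\<^sup>2\<close> of \<open>inv_fourier\<close>.\<close>

lemma fourier_inv_fourier:
  assumes g: "on_ann r R g" shows "fourier (inv_fourier g) = g"
proof
  fix \<xi>
  define e where "e n = 1 / real (Suc n)" for n
  have e: "e n > 0" for n by (simp add: e_def)
  have e0: "e \<longlonglongrightarrow> 0" unfolding e_def by (rule LIMSEQ_Suc[OF lim_1_over_n])
  have sg: "smooth g" by (rule on_ann_smooth[OF g])
  have gm: "g \<in> borel_measurable borel" by (rule smooth_measurable[OF sg])
  have rt: "rapid (ft 1 g)" by (rule ft_rapid[OF g]) simp
  have tm: "ft 1 g \<in> borel_measurable borel" by (rule rapid_measurable[OF rt])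
  have ti: "integrable lborel (\<lambda>x. norm (ft 1 g x))" using rapid_integrable_0[OF rt] by simp
  obtain C where C: "\<And>x. norm (g x) \<le> C" by (rule on_ann_bounded[OF g]) blast
  have gs0: "isCont gs 0" unfolding gs_eq[abs_def] by (intro continuous_intros) auto
  have gsle: "gs x \<le> 1 / (2 * pi)" for x by (simp add: gs_eq divide_right_mono)
  let ?L = "\<lambda>n. \<integral>x. cis (- (x \<bullet> \<xi>)) * ft 1 g x * complex_of_real (gs (e n *\<^sub>R x)) \<partial>lborel"
  have "?L \<longlonglongrightarrow> (\<integral>x. cis (- (x \<bullet> \<xi>)) * ft 1 g x * complex_of_real (gs 0) \<partial>lborel)"
  proof (rule integral_dominated_convergence[where w="\<lambda>x. norm (ft 1 g x) * (1 / (2 * pi))"])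
    show "AE x in lborel. (\<lambda>n. cis (- (x \<bullet> \<xi>)) * ft 1 g x * complex_of_real (gs (e n *\<^sub>R x))) \<longlonglongrightarrow> cis (- (x \<bullet> \<xi>)) * ft 1 g x * complex_of_real (gs 0)"
    proof (intro AE_I2 tendsto_intros)
      fix x :: plane
      have "(\<lambda>n. e n *\<^sub>R x) \<longlonglongrightarrow> 0" using tendsto_scaleR[OF e0 tendsto_const[of x]] by simp
      then show "(\<lambda>n. gs (e n *\<^sub>R x)) \<longlonglongrightarrow> gs 0" by (rule isCont_tendsto_compose[OF gs0])
    qed
    show "AE x in lborel. norm (cis (- (x \<bullet> \<xi>)) * ft 1 g x * complex_of_real (gs (e n *\<^sub>R x))) \<le> norm (ft 1 g x) * (1 / (2 * pi))" for n
      using gsle by (intro AE_I2) (auto simp: norm_mult gs_nonneg simp del: times_divide_eq_right intro!: mult_left_mono)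
    show "integrable lborel (\<lambda>x. norm (ft 1 g x) * (1 / (2 * pi)))" by (intro integrable_mult_left ti)
  qed (use tm in \<open>auto simp: cis_conv_exp\<close>)
  moreover have "?L \<longlonglongrightarrow> (\<integral>y. 2 * pi * complex_of_real (gs y) * g \<xi> \<partial>lborel)"
    unfolding ft_inversion_smoothed[OF g e]
  proof (rule integral_dominated_convergence[where w="\<lambda>y. 2 * pi * (gs y * C)"])
    show "AE y in lborel. (\<lambda>n. 2 * pi * complex_of_real (gs y) * g (\<xi> + e n *\<^sub>R y)) \<longlonglongrightarrow> 2 * pi * complex_of_real (gs y) * g \<xi>"
    proof (intro AE_I2 tendsto_intros)
      fix y :: plane
      have "(\<lambda>n. \<xi> + e n *\<^sub>R y) \<longlonglongrightarrow> \<xi>" using tendsto_add[OF tendsto_const[of \<xi>] tendsto_scaleR[OF e0 tendsto_const[of y]]] by simp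
      then show "(\<lambda>n. g (\<xi> + e n *\<^sub>R y)) \<longlonglongrightarrow> g \<xi>" by (rule isCont_tendsto_compose[OF smooth_isCont[OF sg]])
    qed
    show "integrable lborel (\<lambda>y. 2 * pi * (gs y * C))" by (intro integrable_mult_left integrable_mult_right gs_integral)
    show "AE y in lborel. norm (2 * pi * complex_of_real (gs y) * g (\<xi> + e n *\<^sub>R y)) \<le> 2 * pi * (gs y * C)" for n
      by (intro AE_I2) (auto simp: norm_mult gs_nonneg intro!: mult_left_mono C)
  qed (use gm in auto)
  ultimately have "(\<integral>x. cis (- (x \<bullet> \<xi>)) * ft 1 g x * complex_of_real (gs 0) \<partial>lborel) = (\<integral>y. 2 * pi * complex_of_real (gs y) * g \<xi> \<partial>lborel)"
    by (rule LIMSEQ_unique)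
  then have "(\<integral>x. cis (- (x \<bullet> \<xi>)) * ft 1 g x \<partial>lborel) * complex_of_real (gs 0) = 2 * pi * g \<xi>"
    unfolding integral_mult_left_zero integral_mult_right_zero gs_integral(2) by simp
  moreover have "complex_of_real (gs 0) = 1 / (2 * pi)" by (simp add: gs_eq)
  ultimately have "(\<integral>x. cis (- (x \<bullet> \<xi>)) * ft 1 g x \<partial>lborel) = complex_of_real ((2 * pi)\<^sup>2) * g \<xi>"
    by (simp add: field_simps power2_eq_square)
  moreover have "fourier (inv_fourier g) \<xi> = (\<integral>x. (cis (- (x \<bullet> \<xi>)) * ft 1 g x) / complex_of_real ((2 * pi)\<^sup>2) \<partial>lborel)"
    unfolding fourier_def inv_fourier_ft by simp
  ultimately show "fourier (inv_fourier g) \<xi> = g \<xi>" by simp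
qed

lemma inv_fourier_S0: "g \<in> test_fun \<Longrightarrow> inv_fourier g \<in> S0"
proof -
  assume g: "g \<in> test_fun"
  then obtain r R where "on_ann r R g" by (auto simp: test_fun_iff)
  with g show ?thesis
    by (auto simp: S0_def test_fun_def Cc_infty_def fourier_inv_fourier inv_fourier_schwartz)
qed

lemma fourier_S0:
  assumes "\<theta> \<in> S0" shows "fourier \<theta> \<in> test_fun"
  using assms ft_smooth_and_pd(1)[OF schwartz_rapid, of \<theta> "-1"]
  by (auto simp: S0_def test_fun_def Cc_infty_def fourier_ft)

text \<open>The bound is available for real-valued \<theta> only; this is the condition on the
  Fourier side that guarantees it.\<close>

lemma inv_fourier_real:
  assumes g: "on_ann r R g" and h: "\<And>\<xi>. g (- \<xi>) = cnj (g \<xi>)"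
  shows "inv_fourier g x \<in> \<real>"
proof -
  have gm: "g \<in> borel_measurable borel" by (rule smooth_measurable[OF on_ann_smooth[OF g]])
  have "cnj (ft 1 g x) = (\<integral>\<xi>. cnj (cis (1 * (\<xi> \<bullet> x)) * g \<xi>) \<partial>lborel)" unfolding ft_def by (simp only: Bochner_Integration.integral_cnj)
  also have "\<dots> = (\<integral>\<xi>. cis (1 * ((- \<xi>) \<bullet> x)) * g (- \<xi>) \<partial>lborel)"
    by (simp add: h cis_cnj)
  also have "\<dots> = ft 1 g x" unfolding ft_def using gm
    by (subst lborel_integral_reflect[where f="\<lambda>\<xi>. cis (1 * (\<xi> \<bullet> x)) * g \<xi>"]) (auto simp: cis_conv_exp)
  finally have "ft 1 g x \<in> \<real>" by (simp add: Reals_cnj_iff)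
  then show ?thesis unfolding inv_fourier_ft by (auto intro!: Reals_divide Reals_of_real)
qed

lemma inv_fourier_smooth_pd:
  assumes g: "on_ann r R g"
  shows "smooth (inv_fourier g)" and "pd j (inv_fourier g) = inv_fourier (\<lambda>\<xi>. (\<i> * (\<xi> $ j)) * g \<xi>)"
    and "rapid (inv_fourier g)" and "complex_of_real (x $ j) * inv_fourier g x = inv_fourier (\<lambda>\<xi>. \<i> * pd j g \<xi>) x"
proof -
  let ?c = "1 / complex_of_real ((2 * pi)\<^sup>2)"
  have i: "inv_fourier g = (\<lambda>x. ?c * ft 1 g x)" for g by (simp add: inv_fourier_ft)
  note F = ft_smooth_and_pd[OF on_ann_rapid[OF g]]
  show "smooth (inv_fourier g)" unfolding i by (intro smooth_cmult F)
  show "pd j (inv_fourier g) = inv_fourier (\<lambda>\<xi>. (\<i> * (\<xi> $ j)) * g \<xi>)"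
    unfolding i by (rule ext) (simp only: pd_linear[OF bounded_linear_mult_right smooth_differentiable[OF F(1)]] F(2) of_real_1 mult_1_right)
  show "rapid (inv_fourier g)" unfolding i by (intro rapid_cmult ft_rapid[OF g]) simp
  have "ft 1 (\<lambda>\<xi>. \<i> * pd j g \<xi>) x = \<i> * ft 1 (pd j g) x"
    by (simp add: ft_def mult.left_commute[of _ \<i>])
  then show "complex_of_real (x $ j) * inv_fourier g x = inv_fourier (\<lambda>\<xi>. \<i> * pd j g \<xi>) x"
    unfolding i by (simp add: ft_of_pd[OF g] mult.assoc[symmetric])
qed

lemma smooth_and_pd_compose_linear:
  fixes \<phi> :: "plane \<Rightarrow> complex"
  assumes L: "bounded_linear (L :: plane \<Rightarrow> plane)" and "smooth \<phi>"
  shows "smooth (\<lambda>\<xi>. \<phi> (L \<xi>))"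
    and "pd j (\<lambda>\<xi>. \<phi> (L \<xi>)) = (\<lambda>\<xi>. \<Sum>k\<in>UNIV. complex_of_real (L (axis j 1) $ k) * pd k \<phi> (L \<xi>))"
proof -
  have d: "((\<lambda>\<xi>. \<phi> (L \<xi>)) has_derivative (\<lambda>h. \<Sum>k\<in>UNIV. L h $ k *\<^sub>R pd k \<phi> (L \<xi>))) (at \<xi>)" if "smooth \<phi>" for \<phi> :: "plane \<Rightarrow> complex" and \<xi>
    by (rule has_derivative_compose[OF bounded_linear_imp_has_derivative[OF L] smooth_has_derivative[OF that]])
  have p: "pd j (\<lambda>\<xi>. \<phi> (L \<xi>)) = (\<lambda>\<xi>. \<Sum>k\<in>UNIV. complex_of_real (L (axis j 1) $ k) * pd k \<phi> (L \<xi>))" if "smooth \<phi>" for \<phi> :: "plane \<Rightarrow> complex" and j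
    by (auto simp: pd_eqI[OF d[OF that]] scaleR_conv_of_real)
  then show "pd j (\<lambda>\<xi>. \<phi> (L \<xi>)) = (\<lambda>\<xi>. \<Sum>k\<in>UNIV. complex_of_real (L (axis j 1) $ k) * pd k \<phi> (L \<xi>))" using assms(2) by blast
  show "smooth (\<lambda>\<xi>. \<phi> (L \<xi>))"
  proof (rule smooth_alg[where Q="\<lambda>f. \<exists>\<phi>. smooth \<phi> \<and> f = (\<lambda>\<xi>. \<phi> (L \<xi>))"])
    fix f :: "plane \<Rightarrow> complex" and j
    assume "\<exists>\<phi>. smooth \<phi> \<and> f = (\<lambda>\<xi>. \<phi> (L \<xi>))"
    then obtain \<phi> where \<phi>: "smooth \<phi>" "f = (\<lambda>\<xi>. \<phi> (L \<xi>))" by blast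
    show "alg (\<lambda>f. \<exists>\<phi>. smooth \<phi> \<and> f = (\<lambda>\<xi>. \<phi> (L \<xi>))) (pd j f)"
      unfolding \<phi>(2) p[OF \<phi>(1)] sum_2
      by (intro alg.add alg.mult alg.smooth[OF smooth_const] alg.base) (use \<phi>(1) smooth_pd in blast)+
  next
    fix f :: "plane \<Rightarrow> complex" and x
    assume "\<exists>\<phi>. smooth \<phi> \<and> f = (\<lambda>\<xi>. \<phi> (L \<xi>))"
    then show "f differentiable (at x)" using differentiableI[OF d] by blast
  qed (use assms(2) in \<open>auto intro!: alg.base\<close>)
qed

section \<open>Smooth cutoffs\<close>

text \<open>The functions exp (-1/t) t^(-n), extended by 0: a family closed under differentiation up
  to linear combinations, so that smoothness of the flat function exp (-1/t) at 0 needs only the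
  right-hand limit of each member.\<close>

definition eb :: "nat \<Rightarrow> real \<Rightarrow> real" where
  "eb n t = (if t > 0 then exp (- inverse t) * inverse t ^ n else 0)"

lemma eb_tendsto: "(eb n \<longlongrightarrow> 0) (at_right 0)"
proof -
  have "((\<lambda>s::real. s ^ n / exp s) \<longlongrightarrow> 0) at_top" by (rule tendsto_power_div_exp_0)
  then have "((\<lambda>t::real. inverse t ^ n / exp (inverse t)) \<longlongrightarrow> 0) (at_right 0)"
    by (rule filterlim_compose[OF _ filterlim_inverse_at_top_right])
  moreover have "\<forall>\<^sub>F t in at_right 0. inverse t ^ n / exp (inverse t) = eb n t"
    unfolding eventually_at_right_field by (auto simp: eb_def exp_minus divide_inverse mult.commute intro!: exI[of _ 1])
  ultimately show ?thesis by (rule Lim_transform_eventually)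
qed

lemma eb_deriv: "(eb n has_real_derivative (eb (n + 2) t - real n * eb (n + 1) t)) (at t)"
proof -
  consider "t > 0" | "t < 0" | "t = 0" by linarith
  then show ?thesis
  proof cases
    case 1
    have "((\<lambda>t. exp (- inverse t) * inverse t ^ n) has_real_derivative (eb (n + 2) t - real n * eb (n + 1) t)) (at t)"
    proof -
      have "((\<lambda>t. inverse t) has_real_derivative - (inverse t ^ 2)) (at t)"
        using 1 by (auto intro!: derivative_eq_intros simp: power2_eq_square)
      note dI = this
      have dE: "((\<lambda>t. exp (- inverse t)) has_real_derivative exp (- inverse t) * inverse t ^ 2) (at t)"
        by (rule DERIV_cong[OF DERIV_fun_exp[OF DERIV_minus[OF dI]]]) simp
      show ?thesis
        by (rule DERIV_cong[OF DERIV_mult[OF dE DERIV_power[OF dI, of n]]])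
          (use 1 in \<open>cases n; simp add: eb_def power2_eq_square algebra_simps\<close>)
    qed
    then show ?thesis
      by (rule has_field_derivative_transform_within_open[of _ _ _ "{0<..}"]) (use 1 in \<open>auto simp: eb_def\<close>)
  next
    case 2
    have "((\<lambda>t. 0) has_real_derivative (eb (n + 2) t - real n * eb (n + 1) t)) (at t)"
      using 2 by (auto simp: eb_def)
    then show ?thesis
      by (rule has_field_derivative_transform_within_open[of _ _ _ "{..<0}"]) (use 2 in \<open>auto simp: eb_def\<close>)
  next
    case 3
    have "((\<lambda>h. eb n h / h) \<longlongrightarrow> 0) (at_left 0)"
      by (rule Lim_transform_eventually[of "\<lambda>_. 0"])
        (auto simp: eventually_at_left_field eb_def intro!: exI[of _ "-1"])
    \<comment> \<open>For h > 0 the difference quotient \<open>eb n h / h\<close> is the next member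
      \<open>eb (Suc n) h\<close>.\<close>
    moreover have "((\<lambda>h. eb n h / h) \<longlongrightarrow> 0) (at_right 0)"
      by (rule Lim_transform_eventually[OF eb_tendsto[of "Suc n"]])
        (auto simp: eventually_at_right_field eb_def divide_inverse intro!: exI[of _ 1])
    ultimately have "((\<lambda>h. eb n h / h) \<longlongrightarrow> 0) (at 0)" by (simp add: filterlim_at_split)
    with 3 show ?thesis by (simp add: has_field_derivative_iff eb_def)
  qed
qed

lemma eb_pos: "t > 0 \<Longrightarrow> 0 < eb 0 t" and eb_zero: "t \<le> 0 \<Longrightarrow> eb 0 t = 0" and eb_nonneg: "0 \<le> eb 0 t"
  by (auto simp: eb_def)

lemma smooth_eb:
  assumes \<rho>: "smooth (\<rho> :: plane \<Rightarrow> real)" shows "smooth (\<lambda>x. eb n (\<rho> x))"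
proof -
  let ?Q = "\<lambda>f. \<exists>n. f = (\<lambda>x. eb n (\<rho> x))"
  have d: "((\<lambda>x. eb n (\<rho> x)) has_derivative
      (\<lambda>v. (\<Sum>j\<in>UNIV. v $ j *\<^sub>R pd j \<rho> x) * (eb (n + 2) (\<rho> x) - real n * eb (n + 1) (\<rho> x)))) (at x)" for n x
    using has_derivative_compose[OF smooth_has_derivative[OF \<rho>, of x] eb_deriv[where n=n and t="\<rho> x", unfolded has_field_derivative_def]]
    by (simp add: mult.commute)
  have pd: "pd j (\<lambda>x. eb n (\<rho> x)) = (\<lambda>x. (eb (n + 2) (\<rho> x) + (- real n) * eb (n + 1) (\<rho> x)) * pd j \<rho> x)" for j n
    by (auto simp: fun_eq_iff pd_eqI[OF d] axis_def if_distrib if_distribR cong: if_cong)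
  have b: "alg ?Q (\<lambda>x. eb n (\<rho> x))" for n by (rule alg.base) blast
  show ?thesis
  proof (rule smooth_alg[where Q="?Q"])
    fix f j assume "?Q f"
    then obtain n where f: "f = (\<lambda>x. eb n (\<rho> x))" by blast
    show "alg ?Q (pd j f)"
      unfolding f pd by (intro alg.mult alg.add b alg.smooth[OF smooth_const] alg.smooth[OF smooth_pd[OF \<rho>]])
  qed (use d b in \<open>auto simp: differentiable_def\<close>)
qed

text \<open>A smooth separation of two sets {A \<le> 0} and {B \<le> 0} without common points:
  composed with A and B it is 0 on the first and 1 on the second, and the denominator never
  vanishes.\<close>

definition step :: "real \<Rightarrow> real \<Rightarrow> real" where "step a b = eb 0 a / (eb 0 a + eb 0 b)"

lemma step_props:
  assumes "a > 0 \<or> b > 0"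
  shows "b \<le> 0 \<Longrightarrow> step a b = 1" "a \<le> 0 \<Longrightarrow> step a b = 0" "0 \<le> step a b" "step a b \<le> 1"
  using assms eb_nonneg[of a] eb_nonneg[of b] eb_pos[of a] eb_pos[of b] eb_zero[of a] eb_zero[of b]
  by (auto simp: step_def divide_simps)

lemma smooth_step:
  assumes "smooth A" "smooth B" and AB: "\<And>x. A x > 0 \<or> B x > 0"
  shows "smooth (\<lambda>x. step (A x) (B x))"
proof -
  have "eb 0 (A x) + eb 0 (B x) \<noteq> 0" for x
    using AB[of x] eb_nonneg[of "A x"] eb_nonneg[of "B x"] eb_pos[of "A x"] eb_pos[of "B x"] by auto
  then show ?thesis unfolding step_def by (intro smooth_divide smooth_add smooth_eb assms)
qed

lemma ann_bump:
  assumes r: "0 < r" "r \<le> R"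
  obtains b :: "plane \<Rightarrow> complex" where "on_ann (r / 2) (2 * R) b"
    "\<And>\<xi>. r \<le> norm \<xi> \<Longrightarrow> norm \<xi> \<le> R \<Longrightarrow> b \<xi> = 1" "\<And>\<xi>. b (- \<xi>) = b \<xi>" "\<And>\<xi>. \<exists>t\<ge>0. b \<xi> = complex_of_real t"
proof -
  define a b where "a = (r / 2)\<^sup>2" and "b = (2 * R)\<^sup>2"
  define c d where "c = r\<^sup>2" and "d = R\<^sup>2"
  let ?s = "\<lambda>\<xi>::plane. (norm \<xi>)\<^sup>2"
  \<comment> \<open>\<open>?A\<close> is positive exactly on the open annulus from r/2 to 2R,
    \<open>?B\<close> is nonpositive exactly on the closed one from r to R. Both depend on the
    squared norm, hence are smooth at the origin and even.\<close>
  let ?A = "\<lambda>\<xi>. (?s \<xi> - a) * (b - ?s \<xi>)" and ?B = "\<lambda>\<xi>. (?s \<xi> - c) * (?s \<xi> - d)"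
  have sq: "x < y \<Longrightarrow> 0 \<le> x \<Longrightarrow> x\<^sup>2 < y\<^sup>2" for x y :: real by (rule power_strict_mono) auto
  have AB: "?A \<xi> > 0 \<or> ?B \<xi> > 0" for \<xi>
  proof (cases "r / 2 < norm \<xi> \<and> norm \<xi> < 2 * R")
    case True
    then have "a < ?s \<xi>" unfolding a_def using r by (intro sq) auto
    moreover have "?s \<xi> < b" unfolding b_def by (rule sq) (use True in auto)
    ultimately show ?thesis by simp
  next
    case False
    then have "norm \<xi> < r \<or> R < norm \<xi>" using r by linarith
    then show ?thesis
    proof
      assume "norm \<xi> < r"
      then have "?s \<xi> < c" "?s \<xi> < d" unfolding c_def d_def using r by (auto intro!: sq)
      then show ?thesis by (simp add: mult_neg_neg)
    next
      assume "R < norm \<xi>"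
      then have "c < ?s \<xi>" "d < ?s \<xi>" unfolding c_def d_def using r by (auto intro!: sq)
      then show ?thesis by simp
    qed
  qed
  have sm: "smooth (\<lambda>\<xi>. complex_of_real (step (?A \<xi>) (?B \<xi>)))"
    by (intro smooth_of_real smooth_step smooth_mult smooth_diff smooth_norm2 smooth_const AB)
  show ?thesis
  proof (rule that[of "\<lambda>\<xi>. complex_of_real (step (?A \<xi>) (?B \<xi>))"])
    have ab: "a \<le> b" unfolding a_def b_def using r by (intro power_mono) auto
    have "?A \<xi> \<le> 0" if "\<not> (r / 2 \<le> norm \<xi> \<and> norm \<xi> \<le> 2 * R)" for \<xi>
    proof (cases "norm \<xi> < r / 2")
      case True
      from sq[OF this norm_ge_zero] have "?s \<xi> \<le> a" unfolding a_def by (rule less_imp_le)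
      then show ?thesis using ab by (intro mult_nonpos_nonneg) auto
    next
      case False
      with that have "2 * R < norm \<xi>" by auto
      then have "(2 * R)\<^sup>2 < ?s \<xi>" by (rule sq) (use r in auto)
      then have "b \<le> ?s \<xi>" unfolding b_def by (rule less_imp_le)
      then show ?thesis using ab by (intro mult_nonneg_nonpos) auto
    qed
    then have "complex_of_real (step (?A \<xi>) (?B \<xi>)) = 0" if "\<not> (r / 2 \<le> norm \<xi> \<and> norm \<xi> \<le> 2 * R)" for \<xi>
      using that step_props(2)[OF AB] by simp
    with sm show "on_ann (r / 2) (2 * R) (\<lambda>\<xi>. complex_of_real (step (?A \<xi>) (?B \<xi>)))"
      unfolding on_ann_def by blast
    fix \<xi> :: plane assume \<xi>: "r \<le> norm \<xi>" "norm \<xi> \<le> R"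
    then have "c \<le> ?s \<xi>" "?s \<xi> \<le> d" unfolding c_def d_def using r by (auto intro!: power_mono)
    then have "?B \<xi> \<le> 0" by (intro mult_nonneg_nonpos) auto
    then show "complex_of_real (step (?A \<xi>) (?B \<xi>)) = 1" using step_props(1)[OF AB] by simp
  qed (use step_props(3)[OF AB] in auto)
qed

text \<open>The n-th derivative of a one-variable profile that is 1 for t \<le> 1 and 0 for t \<ge>
  2, read off as an iterated partial derivative along the first axis of a function on the plane,
  where \<open>smooth\<close> is available.\<close>

definition sh :: "nat \<Rightarrow> real \<Rightarrow> real" where
  "sh n t = pds (replicate n 1) (\<lambda>x. step (2 - x $ 1) (x $ 1 - 1)) (axis 1 t)"

lemma smooth_sh_aux: "smooth (\<lambda>x. step (2 - x $ 1) (x $ 1 - 1))"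
  by (rule smooth_step) (auto intro!: smooth_intros)

lemma sh_deriv: "(sh n has_real_derivative sh (Suc n) t) (at t)"
proof -
  let ?f = "pds (replicate n 1) (\<lambda>x. step (2 - x $ 1) (x $ 1 - 1))"
  have "((\<lambda>s. ?f (axis 1 t + s *\<^sub>R axis 1 1)) has_vector_derivative pd 1 ?f (axis 1 t)) (at 0)"
    by (rule has_derivative_pd[OF smooth_differentiable[OF smooth_pds[OF smooth_sh_aux]]])
  moreover have "axis 1 t + s *\<^sub>R axis 1 1 = (axis 1 (s + t) :: plane)" for s
    by (simp add: vec_eq_iff axis_def)
  ultimately have "((\<lambda>s. sh n (s + t)) has_vector_derivative sh (Suc n) t) (at 0)"
    by (simp add: sh_def)
  then show ?thesis
    unfolding has_real_derivative_iff_has_vector_derivative by (rule has_vector_derivative_shift_0)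
qed

lemma sh0: "sh 0 t = step (2 - t) (t - 1)" by (simp add: sh_def)

lemma sh_props: "t \<le> 1 \<Longrightarrow> sh 0 t = 1" "t \<ge> 2 \<Longrightarrow> sh 0 t = 0" "\<bar>sh 0 t\<bar> \<le> 1"
proof -
  have "2 - t > 0 \<or> t - 1 > 0" by linarith
  note S = step_props[OF this]
  show "t \<le> 1 \<Longrightarrow> sh 0 t = 1" "t \<ge> 2 \<Longrightarrow> sh 0 t = 0" using S(1,2) by (auto simp: sh0)
  show "\<bar>sh 0 t\<bar> \<le> 1" unfolding sh0 using S(3,4) by linarith
qed

lemma sh_const:
  assumes "open U" "t \<in> U" "\<And>s. s \<in> U \<Longrightarrow> sh 0 s = c" shows "sh (Suc n) t = 0"
  using assms(2)
proof (induction n arbitrary: t)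
  case 0
  have "((\<lambda>t. c) has_real_derivative sh 1 t) (at t)"
    using has_field_derivative_transform_within_open[OF sh_deriv[of 0 t] assms(1) 0] assms(3) by simp
  then show ?case using DERIV_unique[OF _ DERIV_const] by fastforce
next
  case (Suc n)
  have "((\<lambda>t. 0) has_real_derivative sh (Suc (Suc n)) t) (at t)"
    using has_field_derivative_transform_within_open[OF sh_deriv[of "Suc n" t] assms(1) Suc.prems] Suc.IH by simp
  then show ?case using DERIV_unique[OF _ DERIV_const] by fastforce
qed

text \<open>Derivatives of the profile vanish outside the transition interval, which is
  compact.\<close>

lemma sh_bounded: obtains M where "M \<ge> 0" "\<And>t. \<bar>sh (Suc n) t\<bar> \<le> M"
proof -
  have "continuous_on {1..2} (sh (Suc n))"
    using sh_deriv by (intro continuous_at_imp_continuous_on ballI) (blast intro: DERIV_isCont)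
  then have "compact (sh (Suc n) ` {1..2})" by (intro compact_continuous_image) auto
  then obtain M where M: "\<forall>y\<in>sh (Suc n) ` {1..2}. \<bar>y\<bar> \<le> M"
    using compact_imp_bounded bounded_iff real_norm_def by metis
  show ?thesis
  proof (rule that[of "max 0 M"])
    fix t :: real
    consider "t < 1" | "t > 2" | "t \<in> {1..2}" by force
    then show "\<bar>sh (Suc n) t\<bar> \<le> max 0 M"
    proof cases
      case 1
      then show ?thesis using sh_const[of "{..<1}" t 1] sh_props(1) by auto
    next
      case 2
      then show ?thesis using sh_const[of "{2<..}" t 0] sh_props(2) by auto
    qed (use M in \<open>force simp: le_max_iff_disj\<close>)
  qed simp
qed

text \<open>Cutting off in \<open>ln (1 + |x|\<^sup>2)\<close> makes the trace-free Hessian of a cut-off quadratic small: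
  second derivatives of the cutoff gain a factor \<open>1 / L\<close> over the scaling \<open>|x|\<^sup>-\<^sup>2\<close>.\<close>

lemma log_cutoff:
  obtains cf :: "nat \<Rightarrow> plane \<Rightarrow> real" and C where
    "\<And>n. smooth (cf n)" "\<And>n. \<exists>R. \<forall>x. norm x > R \<longrightarrow> cf n x = 0" "\<And>n x. \<bar>cf n x\<bar> \<le> 1"
    "\<And>x. \<forall>\<^sub>F n in sequentially. cf n x = 1" "C \<ge> 0"
    "\<And>n j x. \<bar>pd j (cf n) x\<bar> * sqrt (1 + (norm x)\<^sup>2) \<le> C / real (Suc n)"
    "\<And>n i j x. \<bar>pd i (pd j (cf n)) x\<bar> * (1 + (norm x)\<^sup>2) \<le> C / real (Suc n)"
proof -
  define Q where "Q x = 1 + (norm x)\<^sup>2" for x :: plane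
  define N where "N n = real (Suc n)" for n
  have N: "N n > 0" "N n \<ge> 1" for n by (simp_all add: N_def)
  \<comment> \<open>The transition 1 \<le> \<rho> \<le> 2 occupies the range from exp N to exp (2 N)
    of 1 + |x|^2, and every derivative of \<rho> carries the factor 1 / N.\<close>
  define \<rho> where "\<rho> n x = ln (Q x) / N n" for n and x :: plane
  define p where "p n j x = 2 * x $ j / (N n * Q x)" for n j and x :: plane
  have q: "Q x > 0" for x by (simp add: Q_def add_pos_nonneg)
  have nq: "N n * Q x \<noteq> 0" for n x using q[of x] N[of n] by simp
  have sQ: "smooth Q" unfolding Q_def by (intro smooth_intros smooth_norm2)
  have sp: "smooth (p n j)" for n j
    unfolding p_def by (intro smooth_divide smooth_intros sQ nq)
  have dq: "(Q has_derivative (\<lambda>h. 2 * (x \<bullet> h))) (at x)" for x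
    unfolding Q_def power2_norm_eq_inner by (auto intro!: derivative_eq_intros simp: inner_commute)
  have d\<rho>: "(\<rho> n has_derivative (\<lambda>h. \<Sum>j\<in>UNIV. h $ j *\<^sub>R p n j x)) (at x)" for n x
  proof -
    have "((\<lambda>x. ln (Q x)) has_derivative (\<lambda>h. (2 * (x \<bullet> h)) * inverse (Q x))) (at x)"
      using has_derivative_ln[OF q dq, of x] by (simp add: divide_inverse)
    from bounded_linear.has_derivative[OF bounded_linear_divide this, of "N n"]
    have "(\<rho> n has_derivative (\<lambda>h. (2 * (x \<bullet> h)) * inverse (Q x) / N n)) (at x)"
      unfolding \<rho>_def .
    moreover have "(2 * (x \<bullet> h)) * inverse (Q x) / N n = (\<Sum>j\<in>UNIV. h $ j *\<^sub>R p n j x)" for h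
      using q[of x] N(1)[of n] by (simp add: p_def inner_vec_def sum_2 field_simps)
    ultimately show ?thesis by simp
  qed
  have s\<rho>: "smooth (\<rho> n)" and pd\<rho>: "pd j (\<rho> n) = p n j" for n j
    using smooth_by_derivative[OF d\<rho> sp] by auto
  define cf where "cf n x = sh 0 (\<rho> n x)" for n x
  have sc: "smooth (\<lambda>x. sh k (\<rho> n x))" "pd j (\<lambda>x. sh k (\<rho> n x)) = (\<lambda>x. sh (Suc k) (\<rho> n x) * p n j x)" for k n j
    by (rule smooth_compose_real[of "\<rho> n" sh, OF sh_deriv s\<rho>])
      (simp only: smooth_compose_real(2)[of "\<rho> n" sh, OF sh_deriv s\<rho>] pd\<rho>)
  have scf: "smooth (cf n)" and pdcf: "pd j (cf n) = (\<lambda>x. sh 1 (\<rho> n x) * p n j x)" for n j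
    unfolding cf_def using sc(1)[where k=0 and n=n] sc(2)[where k=0 and n=n and j=j] by auto
  have ax: "axis i (1::real) $ j = (if i = j then 1 else 0)" for i j :: 2 by (simp add: axis_def)
  have pdp: "pd i (p n j) x = (2 * (if i = j then 1 else 0) * Q x - 4 * (x $ i * x $ j)) / (N n * (Q x)\<^sup>2)" for n i j x
  proof -
    have "((\<lambda>x. 2 * x $ j) has_derivative (\<lambda>h. 2 * h $ j)) (at x)"
      by (intro bounded_linear_imp_has_derivative bounded_linear_const_mult bounded_linear_vec_nth)
    moreover have "((\<lambda>x. N n * Q x) has_derivative (\<lambda>h. N n * (2 * (x \<bullet> h)))) (at x)"
      by (rule has_derivative_mult_right[OF dq])
    ultimately
    have "(p n j has_derivative (\<lambda>h. (2 * h $ j * (N n * Q x) - 2 * x $ j * (N n * (2 * (x \<bullet> h)))) / ((N n * Q x) * (N n * Q x)))) (at x)"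
      unfolding p_def by (intro has_derivative_divide' nq)
    from pd_eqI[OF this, of i]
    have "pd i (p n j) x = (2 * (if i = j then 1 else 0) * (N n * Q x) - 2 * x $ j * (N n * (2 * x $ i))) / ((N n * Q x) * (N n * Q x))"
      by (simp only: inner_axis ax inner_real_def mult_1_right)
    also have "\<dots> = (2 * (if i = j then 1 else 0) * Q x - 4 * (x $ i * x $ j)) / (N n * (Q x)\<^sup>2)"
      using q[of x] N(1)[of n] by (simp add: field_simps power2_eq_square)
    finally show ?thesis .
  qed
  have pd2: "pd i (pd j (cf n)) x = sh 1 (\<rho> n x) * pd i (p n j) x + sh 2 (\<rho> n x) * p n i x * p n j x" for n i j x
    unfolding pdcf
    using pd_mult[OF smooth_differentiable[OF sc(1)[where k=1 and n=n]] smooth_differentiable[OF sp[of n j]], of i x]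
    by (simp add: sc(2)[where k="Suc 0"] numeral_2_eq_2)
  obtain M1 where M1: "M1 \<ge> 0" "\<And>t. \<bar>sh 1 t\<bar> \<le> M1" using sh_bounded[of 0] by auto
  obtain M2 where M2: "M2 \<ge> 0" "\<And>t. \<bar>sh 2 t\<bar> \<le> M2" using sh_bounded[of 1] by (auto simp: numeral_2_eq_2)
  have xq: "\<bar>x $ j\<bar> \<le> sqrt (Q x)" for x :: plane and j
  proof -
    have "\<bar>x $ j\<bar> \<le> norm x" by (rule component_le_norm_cart)
    also have "\<dots> = sqrt ((norm x)\<^sup>2)" by simp
    also have "\<dots> \<le> sqrt (Q x)" unfolding Q_def by (rule real_sqrt_le_mono) simp
    finally show ?thesis .
  qed
  have ss: "sqrt (Q x) * sqrt (Q x) = Q x" for x using q[of x] by simp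
  have pb: "\<bar>p n j x\<bar> * sqrt (Q x) \<le> 2 / N n" for n j x
  proof -
    have "\<bar>p n j x\<bar> * sqrt (Q x) = 2 * (\<bar>x $ j\<bar> * sqrt (Q x)) / (N n * Q x)"
      using q[of x] N(1)[of n] by (simp add: p_def abs_mult)
    also have "\<dots> \<le> 2 * (sqrt (Q x) * sqrt (Q x)) / (N n * Q x)"
      using q[of x] N(1)[of n] by (intro divide_right_mono mult_left_mono mult_right_mono xq) auto
    also have "\<dots> = 2 / N n" unfolding ss using q[of x] by simp
    finally show ?thesis .
  qed
  have ppb: "\<bar>pd i (p n j) x\<bar> * Q x \<le> 6 / N n" for n i j x
  proof -
    have "\<bar>x $ i * x $ j\<bar> \<le> sqrt (Q x) * sqrt (Q x)"
      unfolding abs_mult using q[of x] by (intro mult_mono xq) auto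
    moreover have "\<bar>2 * (if i = j then 1 else 0) * y - 4 * z\<bar> \<le> 6 * y" if "\<bar>z\<bar> \<le> y" for y z :: real
    proof (cases "i = j")
      case True
      then have "(if i = j then 1 else 0 :: real) = 1" by simp
      then show ?thesis using that by simp
    next
      case False
      then have "(if i = j then 1 else 0 :: real) = 0" by simp
      then show ?thesis using that by simp
    qed
    ultimately have "\<bar>2 * (if i = j then 1 else 0) * Q x - 4 * (x $ i * x $ j)\<bar> \<le> 6 * Q x"
      unfolding ss by blast
    then have "\<bar>pd i (p n j) x\<bar> \<le> 6 * Q x / (N n * (Q x)\<^sup>2)"
      unfolding pdp abs_divide using q[of x] N(1)[of n] by (simp add: abs_mult divide_right_mono)
    then have "\<bar>pd i (p n j) x\<bar> * Q x \<le> 6 * Q x / (N n * (Q x)\<^sup>2) * Q x"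
      using q[of x] by (intro mult_right_mono) auto
    also have "\<dots> = 6 / N n" using q[of x] by (simp add: power2_eq_square)
    finally show ?thesis .
  qed
  \<comment> \<open>In the second derivative of the cutoff, \<open>6 * M1\<close> stems from the
    second derivatives of \<rho> and \<open>4 * M2\<close> from products of two first derivatives,
    where one of the two factors 1 / N is given away. The sum also covers the first
    derivative.\<close>
  let ?C = "6 * M1 + 4 * M2"
  show ?thesis
  proof (rule that[of cf ?C])
    show "smooth (cf n)" for n by (rule scf)
    show "\<exists>R. \<forall>x. norm x > R \<longrightarrow> cf n x = 0" for n
    proof (intro exI[of _ "exp (N n)"] allI impI)
      fix x :: plane assume "norm x > exp (N n)"
      then have "(exp (N n))\<^sup>2 \<le> (norm x)\<^sup>2" by (intro power_mono) auto
      then have "exp (2 * N n) \<le> Q x" unfolding exp_double Q_def by linarith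
      then have "2 * N n \<le> ln (Q x)" using q[of x] by (simp only: ln_ge_iff)
      then have "\<rho> n x \<ge> 2" using N(1)[of n] by (simp add: \<rho>_def pos_le_divide_eq)
      then show "cf n x = 0" unfolding cf_def by (rule sh_props)
    qed
    show "\<bar>cf n x\<bar> \<le> 1" for n x unfolding cf_def by (rule sh_props)
    show "\<forall>\<^sub>F n in sequentially. cf n x = 1" for x
    proof -
      have "\<forall>\<^sub>F n in sequentially. ln (Q x) \<le> real n"
        using filterlim_real_sequentially by (auto simp: filterlim_at_top)
      then show ?thesis
      proof eventually_elim
        case (elim n)
        then have "ln (Q x) \<le> N n" by (simp add: N_def)
        then have "\<rho> n x \<le> 1" using N(1)[of n] by (simp add: \<rho>_def pos_divide_le_eq)
        then show ?case unfolding cf_def by (rule sh_props)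
      qed
    qed
    show "?C \<ge> 0" using M1 M2 by simp
    show "\<bar>pd j (cf n) x\<bar> * sqrt (1 + (norm x)\<^sup>2) \<le> ?C / real (Suc n)" for n j x
    proof -
      have "\<bar>pd j (cf n) x\<bar> * sqrt (Q x) = \<bar>sh 1 (\<rho> n x)\<bar> * (\<bar>p n j x\<bar> * sqrt (Q x))"
        by (simp add: pdcf abs_mult)
      also have "\<dots> \<le> M1 * (2 / N n)" using q[of x] by (intro mult_mono M1 pb) auto
      also have "\<dots> \<le> ?C / N n" using M1(1) M2(1) N(1)[of n] by (simp add: divide_right_mono)
      finally show ?thesis unfolding Q_def N_def .
    qed
    show "\<bar>pd i (pd j (cf n)) x\<bar> * (1 + (norm x)\<^sup>2) \<le> ?C / real (Suc n)" for n i j x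
    proof -
      have "\<bar>pd i (pd j (cf n)) x\<bar> * Q x \<le> (\<bar>sh 1 (\<rho> n x) * pd i (p n j) x\<bar> + \<bar>sh 2 (\<rho> n x) * p n i x * p n j x\<bar>) * Q x"
        unfolding pd2 using q[of x] by (intro mult_right_mono abs_triangle_ineq) auto
      also have "\<dots> = \<bar>sh 1 (\<rho> n x)\<bar> * (\<bar>pd i (p n j) x\<bar> * Q x) + \<bar>sh 2 (\<rho> n x)\<bar> * ((\<bar>p n i x\<bar> * sqrt (Q x)) * (\<bar>p n j x\<bar> * sqrt (Q x)))"
      proof -
        define s where "s = sqrt (Q x)"
        have s: "Q x = s * s" unfolding s_def ss ..
        show ?thesis unfolding s_def[symmetric] unfolding s abs_mult by (simp add: algebra_simps)
      qed
      also have "\<dots> \<le> M1 * (6 / N n) + M2 * ((2 / N n) * (2 / N n))"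
        using q[of x] N(1)[of n] by (intro add_mono mult_mono M1 M2 pb ppb) auto
      also have "\<dots> \<le> M1 * (6 / N n) + M2 * (2 * (2 / N n))"
        using M2(1) N[of n] by (intro add_left_mono mult_left_mono mult_right_mono) (auto simp: pos_divide_le_eq)
      also have "\<dots> = ?C / N n" by (simp add: add_divide_distrib mult.commute)
      finally show ?thesis unfolding Q_def N_def .
    qed
  qed
qed

lemma Linfty_norm_le:
  fixes f :: "plane \<Rightarrow> 'b::real_normed_vector"
  assumes B: "\<And>x. norm (f x) \<le> B" shows "0 \<le> Linfty_norm f \<and> Linfty_norm f \<le> B"
proof (cases "(\<lambda>x. ereal (norm (f x))) \<in> borel_measurable lborel")
  case True
  let ?e = "esssup lborel (\<lambda>x. ereal (norm (f x)))"
  have "?e \<le> ereal B" by (rule esssup_I[OF True]) (use B in auto)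
  moreover have "esssup lborel (\<lambda>x::plane. 0 :: ereal) \<le> ?e" by (rule esssup_mono) auto
  then have "0 \<le> ?e" by (simp add: esssup_const)
  ultimately show ?thesis
    unfolding Linfty_norm_def using real_of_ereal_positive_mono[of ?e "ereal B"] by (auto simp: real_of_ereal_pos)
next
  case False
  \<comment> \<open>Here the essential supremum is the top element by convention, and
    \<open>real_of_ereal\<close> maps it to 0.\<close>
  have "0 \<le> B" using B[of 0] norm_ge_zero order_trans by blast
  then show ?thesis unfolding Linfty_norm_def esssup_non_measurable[OF False] by (simp add: top_ereal_def)
qed

text \<open>Second derivatives of \<open>P\<close> meet the undifferentiated cutoff and contribute
  nothing to the trace-free part. The term with two derivatives on the cutoff is at most D, each of
  the two cross terms at most 2 D, and subtracting half the trace adds another 5 D; summing four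
  entries gives 40 D.\<close>

lemma tf_hessian_cutoff_bound:
  assumes P: "smooth P" "\<And>x. tf_hessian P x = 0" "\<And>x. \<bar>P x\<bar> \<le> 1 + (norm x)\<^sup>2" "\<And>j x. \<bar>pd j P x\<bar> \<le> 2 * sqrt (1 + (norm x)\<^sup>2)"
    and cf: "smooth cf" "\<And>j x. \<bar>pd j cf x\<bar> * sqrt (1 + (norm x)\<^sup>2) \<le> D" "\<And>i j x. \<bar>pd i (pd j cf) x\<bar> * (1 + (norm x)\<^sup>2) \<le> D"
  shows "norm (tf_hessian (\<lambda>x. P x * cf x) x) \<le> 40 * D"
proof -
  define E where "E j l = P x * pd j (pd l cf) x + pd j P x * pd l cf x + pd l P x * pd j cf x" for j l
  have "pd l (\<lambda>x. P x * cf x) = (\<lambda>x. P x * pd l cf x + pd l P x * cf x)" for l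
    by (auto simp: pd_mult smooth_differentiable P cf)
  then have H: "pd j (pd l (\<lambda>x. P x * cf x)) x = E j l + pd j (pd l P) x * cf x" for j l
    by (simp add: pd_add pd_mult smooth_differentiable smooth_mult smooth_pd P cf E_def)
  have D0: "D \<ge> 0" using order_trans[OF _ cf(2)[of 1 0]] by simp
  have Eb: "\<bar>E j l\<bar> \<le> 5 * D" for j l
  proof -
    have 1: "\<bar>P x * pd j (pd l cf) x\<bar> \<le> D"
      using order_trans[OF mult_right_mono[OF P(3)[of x]] cf(3)[of j l x, unfolded mult.commute[of "\<bar>_\<bar>"]]] by (simp add: abs_mult)
    have 2: "\<bar>pd j P x * pd l cf x\<bar> \<le> 2 * D" for j l
    proof -
      have "\<bar>pd j P x * pd l cf x\<bar> \<le> (2 * sqrt (1 + (norm x)\<^sup>2)) * \<bar>pd l cf x\<bar>"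
        unfolding abs_mult by (intro mult_right_mono P) auto
      also have "\<dots> \<le> 2 * D" using cf(2)[of l x] by (simp add: mult.commute)
      finally show ?thesis .
    qed
    show ?thesis unfolding E_def using 1 2[of j l] 2[of l j] by linarith
  qed
  have T: "tf_hessian (\<lambda>x. P x * cf x) x $ j $ l = E j l - 1 / 2 * (E 1 1 + E 2 2) * (if j = l then 1 else 0)" for j l
  proof -
    have "tf_hessian P x $ j $ l = 0" using P(2)[of x] by simp
    then have "pd j (pd l P) x = 1 / 2 * (pd 1 (pd 1 P) x + pd 2 (pd 2 P) x) * (if j = l then 1 else 0)"
      by (simp add: tf_hessian_def sum_2)
    then show ?thesis by (simp add: tf_hessian_def sum_2 H algebra_simps)
  qed
  have Tb: "\<bar>tf_hessian (\<lambda>x. P x * cf x) x $ j $ l\<bar> \<le> 10 * D" for j l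
  proof (cases "j = l")
    case True
    then have e: "(if j = l then 1 else 0 :: real) = 1" by simp
    have "\<bar>a - 1 / 2 * (b + c) * 1\<bar> \<le> 10 * D" if "\<bar>a\<bar> \<le> 5 * D" "\<bar>b\<bar> \<le> 5 * D" "\<bar>c\<bar> \<le> 5 * D" for a b c :: real
    proof -
      have "\<bar>1 / 2 * (b + c) * 1\<bar> \<le> 5 * D" using that(2,3) by (simp add: abs_mult)
      with that(1) show ?thesis by linarith
    qed
    then show ?thesis unfolding T e using Eb by blast
  next
    case False
    then have e: "(if j = l then 1 else 0 :: real) = 0" by simp
    show ?thesis unfolding T e using Eb[of j l] D0 by linarith
  qed
  have rb: "norm (tf_hessian (\<lambda>x. P x * cf x) x $ j) \<le> 20 * D" for j
    using norm_le_l1_cart[of "tf_hessian (\<lambda>x. P x * cf x) x $ j"] Tb[of j 1] Tb[of j 2] by (simp add: sum_2)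
  have "norm (tf_hessian (\<lambda>x. P x * cf x) x) \<le> (\<Sum>j\<in>UNIV. norm (tf_hessian (\<lambda>x. P x * cf x) x $ j))"
    unfolding norm_vec_def by (rule L2_set_le_sum) simp
  also have "\<dots> \<le> 40 * D" using rb[of 1] rb[of 2] by (simp add: sum_2)
  finally show ?thesis .
qed

section \<open>Testing the bound with cut-off quadratics\<close>

lemma smooth_cis_1: "smooth (\<lambda>\<xi>. cis (x \<bullet> \<xi>))"
  using smooth_cis[of 1 x] by simp

lemma pd_cis_1: "pd j (\<lambda>\<xi>. cis (x \<bullet> \<xi>)) = (\<lambda>\<xi>. (\<i> * (x $ j)) * cis (x \<bullet> \<xi>))"
  using pd_cis[of j 1 x] by simp

lemma pds_cis_times_snoc:
  assumes g: "smooth g"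
  shows "pds (js @ [j]) (\<lambda>\<xi>. cis (x \<bullet> \<xi>) * g \<xi>)
    = (\<lambda>\<xi>. pds js (\<lambda>\<xi>. cis (x \<bullet> \<xi>) * pd j g \<xi>) \<xi> + (\<i> * (x $ j)) * pds js (\<lambda>\<xi>. cis (x \<bullet> \<xi>) * g \<xi>) \<xi>)"
proof -
  have "pd j (\<lambda>\<xi>. cis (x \<bullet> \<xi>) * g \<xi>) = (\<lambda>\<xi>. cis (x \<bullet> \<xi>) * pd j g \<xi> + (\<i> * (x $ j)) * (cis (x \<bullet> \<xi>) * g \<xi>))"
    by (auto simp: pd_mult smooth_differentiable smooth_cis_1 g pd_cis_1)
  then show ?thesis
    by (simp add: pds_append pds_add pds_cmult smooth_mult smooth_cmult smooth_pd g smooth_cis_1)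
qed

text \<open>Together with \<open>cis_times_growth\<close> this verifies the hypotheses of
  \<open>interchange\<close> for the family of exponentials times \<open>g\<close>: each derivative
  either falls on \<open>g\<close> or brings down a coordinate of x.\<close>

lemma cis_times_continuous:
  assumes "on_ann r R g"
  shows "continuous_on UNIV (\<lambda>p. pds js (\<lambda>\<xi>. cis (fst p \<bullet> \<xi>) * g \<xi>) (snd p))"
  using assms
proof (induction js arbitrary: g rule: rev_induct)
  case Nil
  then show ?case unfolding pds_Nil cis_conv_exp
    by (intro continuous_intros smooth_continuous_on_compose on_ann_smooth[OF Nil])
next
  case (snoc j js)
  show ?case
    unfolding pds_cis_times_snoc[OF on_ann_smooth[OF snoc.prems]]
    by (intro continuous_intros snoc.IH snoc.prems on_ann_pd)
qed

lemma cis_times_growth: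
  assumes "on_ann r R g"
  shows "\<exists>C n. \<forall>x \<xi>. norm (pds js (\<lambda>\<xi>. cis (x \<bullet> \<xi>) * g \<xi>) \<xi>) \<le> C * (1 + norm x) ^ n"
  using assms
proof (induction js arbitrary: g rule: rev_induct)
  case Nil
  obtain C where "\<And>\<xi>. norm (g \<xi>) \<le> C" by (rule on_ann_bounded[OF Nil]) blast
  then show ?case by (intro exI[of _ C] exI[of _ 0]) (simp add: norm_mult)
next
  case (snoc j js)
  obtain C n where C: "\<And>x \<xi>. norm (pds js (\<lambda>\<xi>. cis (x \<bullet> \<xi>) * g \<xi>) \<xi>) \<le> C * (1 + norm x) ^ n"
    using snoc.IH[OF snoc.prems] by blast
  obtain D k where D: "\<And>x \<xi>. norm (pds js (\<lambda>\<xi>. cis (x \<bullet> \<xi>) * pd j g \<xi>) \<xi>) \<le> D * (1 + norm x) ^ k"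
    using snoc.IH[OF on_ann_pd[OF snoc.prems]] by blast
  have CD: "C \<ge> 0" "D \<ge> 0" using order_trans[OF norm_ge_zero C[of 0 0]] order_trans[OF norm_ge_zero D[of 0 0]] by simp_all
  have "norm (pds (js @ [j]) (\<lambda>\<xi>. cis (x \<bullet> \<xi>) * g \<xi>) \<xi>) \<le> (D + C) * (1 + norm x) ^ (k + Suc n)" for x \<xi>
  proof -
    have "norm (pds (js @ [j]) (\<lambda>\<xi>. cis (x \<bullet> \<xi>) * g \<xi>) \<xi>)
        \<le> norm (pds js (\<lambda>\<xi>. cis (x \<bullet> \<xi>) * pd j g \<xi>) \<xi>) + \<bar>x $ j\<bar> * norm (pds js (\<lambda>\<xi>. cis (x \<bullet> \<xi>) * g \<xi>) \<xi>)"
      unfolding pds_cis_times_snoc[OF on_ann_smooth[OF snoc.prems]]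
      by (rule order_trans[OF norm_triangle_ineq]) (simp add: norm_mult)
    also have "\<dots> \<le> D * (1 + norm x) ^ k + (1 + norm x) * (C * (1 + norm x) ^ n)"
      using component_le_norm_cart[of x j] by (intro add_mono mult_mono C D) auto
    also have "\<dots> = D * (1 + norm x) ^ k + C * (1 + norm x) ^ Suc n" by simp
    also have "\<dots> \<le> D * (1 + norm x) ^ (k + Suc n) + C * (1 + norm x) ^ (k + Suc n)"
      by (intro add_mono mult_left_mono power_increasing CD) auto
    finally show ?thesis by (simp add: distrib_right)
  qed
  then show ?case by blast
qed

lemma on_ann_cis_times: "on_ann r R g \<Longrightarrow> on_ann r R (\<lambda>\<xi>. cis (x \<bullet> \<xi>) * g \<xi>)"
  by (rule on_ann_mult[OF _ smooth_cis_1])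

lemma interchange_cis:
  assumes u: "cont_functional u" and r: "r > 0" and g: "on_ann r R g"
  shows "\<exists>C n. \<forall>x. norm (u (\<lambda>\<xi>. cis (x \<bullet> \<xi>) * g \<xi>)) \<le> C * (1 + norm x) ^ n"
    and "(\<lambda>x. u (\<lambda>\<xi>. cis (x \<bullet> \<xi>) * g \<xi>)) \<in> borel_measurable borel"
    and "rapid k \<Longrightarrow> u (\<lambda>\<xi>. \<integral>x. k x * (cis (x \<bullet> \<xi>) * g \<xi>) \<partial>lborel) = (\<integral>x. k x * u (\<lambda>\<xi>. cis (x \<bullet> \<xi>) * g \<xi>) \<partial>lborel)"
proof -
  note I = interchange[OF u r on_ann_cis_times[OF g] cis_times_continuous[OF g] cis_times_growth[OF g]]
  \<comment> \<open>This conclusion and the next concern \<open>u (F x)\<close> alone, so the zero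
    kernel serves as instance.\<close>
  show "\<exists>C n. \<forall>x. norm (u (\<lambda>\<xi>. cis (x \<bullet> \<xi>) * g \<xi>)) \<le> C * (1 + norm x) ^ n"
    by (rule I(2)[of "\<lambda>_. 0"]) auto
  show "(\<lambda>x. u (\<lambda>\<xi>. cis (x \<bullet> \<xi>) * g \<xi>)) \<in> borel_measurable borel"
    by (rule I(3)[of "\<lambda>_. 0"]) auto
  show "rapid k \<Longrightarrow> u (\<lambda>\<xi>. \<integral>x. k x * (cis (x \<bullet> \<xi>) * g \<xi>) \<partial>lborel) = (\<integral>x. k x * u (\<lambda>\<xi>. cis (x \<bullet> \<xi>) * g \<xi>) \<partial>lborel)"
    by (rule I(4)) (auto intro: rapid_measurable rapid_integrable)
qed

lemma distr_multiplier_eq: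
  "distr_multiplier u \<theta> x = u (\<lambda>\<xi>. cis (x \<bullet> \<xi>) * fourier \<theta> \<xi>) / complex_of_real ((2 * pi)\<^sup>2)"
  by (simp add: distr_multiplier_def inv_fourier_distr_def mult_distr_def mult.commute)

lemma test_fun_reflect: "g \<in> test_fun \<Longrightarrow> (\<lambda>\<xi>. g (- \<xi>)) \<in> test_fun"
  using smooth_and_pd_compose_linear(1)[OF bounded_linear_minus[OF bounded_linear_ident], of g]
  by (fastforce simp: test_fun_iff on_ann_def)

section \<open>Consequences of the bound for weights with vanishing trace-free Hessian\<close>

text \<open>\<open>P\<close> will run through the weights 1, x_j and |x|^2, and \<open>Op\<close> is
  multiplication by \<open>P\<close> transported to the Fourier side, a differential operator.
  \<open>H\<close> abstracts the squared Sobolev norm as a real number attached to \<theta>.\<close>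

locale test_weight =
  fixes m :: "2 \<Rightarrow> distr" and C :: real and H :: "(plane \<Rightarrow> complex) \<Rightarrow> real"
    and P :: "plane \<Rightarrow> real" and Op :: "(plane \<Rightarrow> complex) \<Rightarrow> plane \<Rightarrow> complex"
  assumes m: "\<And>l. cont_functional (m l)"
    and bound: "\<And>\<psi> \<theta>. \<psi> \<in> Cc_infty \<Longrightarrow> \<theta> \<in> S0 \<Longrightarrow> (\<And>x. \<theta> x \<in> \<real>) \<Longrightarrow>
      norm (B_form m \<psi> \<theta>) \<le> C * Linfty_norm (tf_hessian \<psi>) * H \<theta>"
    and P: "smooth P" "\<And>x. tf_hessian P x = 0" "\<And>x. \<bar>P x\<bar> \<le> 1 + (norm x)\<^sup>2"
      "\<And>j x. \<bar>pd j P x\<bar> \<le> 2 * sqrt (1 + (norm x)\<^sup>2)"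
    and Op: "\<And>r R g. on_ann r R g \<Longrightarrow> on_ann r R (Op g)"
      "\<And>r R g x. on_ann r R g \<Longrightarrow> complex_of_real (P x) * inv_fourier g x = inv_fourier (Op g) x"
      "\<And>g h. smooth g \<Longrightarrow> smooth h \<Longrightarrow> Op (\<lambda>\<xi>. g \<xi> + h \<xi>) = (\<lambda>\<xi>. Op g \<xi> + Op h \<xi>)"
      "\<And>g c. smooth g \<Longrightarrow> Op (\<lambda>\<xi>. c * g \<xi>) = (\<lambda>\<xi>. c * Op g \<xi>)"
begin

text \<open>With \<theta> fixed, cutting \<open>P\<close> off logarithmically makes the right side
  of the bound O(1/n), while dominated convergence carries the left side to the integral with the
  full weight. The integrand is rapidly decreasing because \<open>m l\<close> tested on exponentials
  grows at most polynomially.\<close>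

lemma integral_weight_zero:
  assumes r: "r > 0" and g: "on_ann r R g" and h: "\<And>\<xi>. g (- \<xi>) = cnj (g \<xi>)"
  defines "W \<equiv> \<lambda>x. \<Sum>l\<in>UNIV. (complex_of_real (P x) * m l (\<lambda>\<xi>. cis (x \<bullet> \<xi>) * g \<xi>)) * pd l (inv_fourier g) x"
  shows "(\<integral>x. W x \<partial>lborel) = 0"
proof -
  let ?\<theta> = "inv_fourier g" and ?T = "\<lambda>l x. m l (\<lambda>\<xi>. cis (x \<bullet> \<xi>) * g \<xi>)"
  obtain cf :: "nat \<Rightarrow> plane \<Rightarrow> real" and D where cf:
    "\<And>n. smooth (cf n)" "\<And>n. \<exists>R. \<forall>x. norm x > R \<longrightarrow> cf n x = 0" "\<And>n x. \<bar>cf n x\<bar> \<le> 1"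
    "\<And>x. \<forall>\<^sub>F n in sequentially. cf n x = 1" "D \<ge> 0"
    "\<And>n j x. \<bar>pd j (cf n) x\<bar> * sqrt (1 + (norm x)\<^sup>2) \<le> D / real (Suc n)"
    "\<And>n i j x. \<bar>pd i (pd j (cf n)) x\<bar> * (1 + (norm x)\<^sup>2) \<le> D / real (Suc n)"
    by (rule log_cutoff) blast
  have pdr: "rapid (pd l ?\<theta>)" for l
    unfolding inv_fourier_smooth_pd(2)[OF g]
    using inv_fourier_smooth_pd(3)[OF on_ann_component[OF g, of \<i> l]] by simp
  have "rapid (\<lambda>x. (complex_of_real (P x) * ?T l x) * pd l ?\<theta> x)" for l
  proof -
    obtain E n where E: "\<And>x. norm (?T l x) \<le> E * (1 + norm x) ^ n"
      using interchange_cis(1)[OF m r g, of l] by blast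
    have Pb: "\<bar>P x\<bar> \<le> (1 + norm x)\<^sup>2" for x
      by (rule order_trans[OF P(3)]) (simp add: power2_sum)
    show ?thesis
    proof (rule rapid_mult[OF pdr, where C=E and n="2 + n"])
      show "(\<lambda>x. complex_of_real (P x) * ?T l x) \<in> borel_measurable borel"
        using smooth_measurable[OF P(1)] interchange_cis(2)[OF m r g, of l] by measurable
      fix x
      have "norm (complex_of_real (P x) * ?T l x) \<le> (1 + norm x)\<^sup>2 * (E * (1 + norm x) ^ n)"
        unfolding norm_mult norm_of_real by (intro mult_mono Pb E) auto
      then show "norm (complex_of_real (P x) * ?T l x) \<le> E * (1 + norm x) ^ (2 + n)"
        unfolding power_add by (simp only: mult_ac)
    qed
  qed
  then have W: "rapid W" unfolding W_def sum_2 by (intro rapid_add)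
  have Wm: "W \<in> borel_measurable borel" by (rule rapid_measurable[OF W])
  have cfm: "cf n \<in> borel_measurable borel" for n by (rule smooth_measurable[OF cf(1)])
  have "(\<lambda>n. \<integral>x. complex_of_real (cf n x) * W x \<partial>lborel) \<longlonglongrightarrow> (\<integral>x. W x \<partial>lborel)"
  proof (rule integral_dominated_convergence[where w="\<lambda>x. norm (W x)"])
    show "AE x in lborel. (\<lambda>n. complex_of_real (cf n x) * W x) \<longlonglongrightarrow> W x"
    proof (intro AE_I2)
      fix x
      have "\<forall>\<^sub>F n in sequentially. W x = complex_of_real (cf n x) * W x"
        using cf(4)[of x] by eventually_elim simp
      then show "(\<lambda>n. complex_of_real (cf n x) * W x) \<longlonglongrightarrow> W x"
        by (rule Lim_transform_eventually[OF tendsto_const])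
    qed
    show "AE x in lborel. norm (complex_of_real (cf n x) * W x) \<le> norm (W x)" for n
      using cf(3) by (intro AE_I2) (simp add: norm_mult mult_left_le_one_le)
    show "integrable lborel (\<lambda>x. norm (W x))" using rapid_integrable_0[OF W] by simp
  qed (use Wm cfm in auto)
  moreover have "(\<lambda>n. \<integral>x. complex_of_real (cf n x) * W x \<partial>lborel) \<longlonglongrightarrow> 0"
  proof (rule Lim_null_comparison)
    \<comment> \<open>\<open>(2 * pi)\<^sup>2\<close> undoes the normalisation inside
      \<open>distr_multiplier\<close>, \<open>40 * D\<close> is the bound of
      \<open>tf_hessian_cutoff_bound\<close>; absolute values are taken because \<open>C\<close> and
      \<open>H\<close> carry no sign condition.\<close>
    let ?K = "(2 * pi)\<^sup>2 * (\<bar>C\<bar> * (40 * D) * \<bar>H ?\<theta>\<bar>)"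
    show "(\<lambda>n. ?K * (1 / real (Suc n))) \<longlonglongrightarrow> 0"
      by (rule tendsto_mult_right_zero[OF LIMSEQ_Suc[OF lim_1_over_n]])
    show "\<forall>\<^sub>F n in sequentially. norm (\<integral>x. complex_of_real (cf n x) * W x \<partial>lborel) \<le> ?K * (1 / real (Suc n))"
    proof (intro always_eventually allI)
      fix n
      let ?\<psi> = "\<lambda>x. P x * cf n x"
      obtain R' where R': "\<And>x. norm x > R' \<Longrightarrow> cf n x = 0" using cf(2) by blast
      have "supp ?\<psi> \<subseteq> cball 0 R'"
        unfolding supp_def by (rule closure_minimal) (use R' not_less in force)+
      then have "compact (supp ?\<psi>)" by (metis compact_cball closed_closure compact_Int_closed inf.absorb_iff2 supp_def)
      then have \<psi>: "?\<psi> \<in> Cc_infty" by (simp add: Cc_infty_def smooth_mult P cf)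
      have \<theta>: "?\<theta> \<in> S0" by (rule inv_fourier_S0) (use g r in \<open>auto simp: test_fun_iff\<close>)
      have L: "0 \<le> Linfty_norm (tf_hessian ?\<psi>) \<and> Linfty_norm (tf_hessian ?\<psi>) \<le> 40 * (D / real (Suc n))"
        by (rule Linfty_norm_le) (rule tf_hessian_cutoff_bound[OF P cf(1,6,7)])
      have "B_form m ?\<psi> ?\<theta> = (\<integral>x. complex_of_real (cf n x) * W x / complex_of_real ((2 * pi)\<^sup>2) \<partial>lborel)"
        unfolding B_form_def W_def distr_multiplier_eq fourier_inv_fourier[OF g]
        by (intro Bochner_Integration.integral_cong) (simp_all add: sum_2 field_simps)
      then have B: "(\<integral>x. complex_of_real (cf n x) * W x \<partial>lborel) = complex_of_real ((2 * pi)\<^sup>2) * B_form m ?\<psi> ?\<theta>" by simp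
      have "norm (B_form m ?\<psi> ?\<theta>) \<le> C * Linfty_norm (tf_hessian ?\<psi>) * H ?\<theta>"
        by (rule bound[OF \<psi> \<theta> inv_fourier_real[OF g h]])
      also have "\<dots> \<le> \<bar>C * Linfty_norm (tf_hessian ?\<psi>) * H ?\<theta>\<bar>" by (rule abs_ge_self)
      also have "\<dots> = \<bar>C\<bar> * Linfty_norm (tf_hessian ?\<psi>) * \<bar>H ?\<theta>\<bar>" using L by (simp add: abs_mult)
      also have "\<dots> \<le> \<bar>C\<bar> * (40 * (D / real (Suc n))) * \<bar>H ?\<theta>\<bar>"
        using L by (intro mult_right_mono mult_left_mono) auto
      finally have "(2 * pi)\<^sup>2 * norm (B_form m ?\<psi> ?\<theta>) \<le> (2 * pi)\<^sup>2 * (\<bar>C\<bar> * (40 * (D / real (Suc n))) * \<bar>H ?\<theta>\<bar>)"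
        by (rule mult_left_mono) simp
      then show "norm (\<integral>x. complex_of_real (cf n x) * W x \<partial>lborel) \<le> ?K * (1 / real (Suc n))"
        unfolding B norm_mult norm_of_real by simp
    qed
  qed
  ultimately show ?thesis by (rule LIMSEQ_unique)
qed

text \<open>\<open>(2 * pi)\<^sup>2\<close> times the bilinear version of the nonlinearity with
  weight \<open>P\<close>, written on the Fourier side. The argument \<open>- \<xi>\<close> appears
  because integrating the exponential of the multiplier against \<open>P\<close> times the gradient
  gives a Fourier transform at the opposite frequency.\<close>

definition b :: "(plane \<Rightarrow> complex) \<Rightarrow> (plane \<Rightarrow> complex) \<Rightarrow> complex" where
  "b g h = (\<Sum>l\<in>UNIV. m l (\<lambda>\<xi>. g \<xi> * Op (\<lambda>\<eta>. (\<i> * (\<eta> $ l)) * h \<eta>) (- \<xi>)))"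

text \<open>Hermitian symmetry makes the underlying \<theta> real, so
  \<open>integral_weight_zero\<close> applies. \<open>interchange_cis\<close> moves the x-integral
  inside \<open>m l\<close>, and Fourier inversion evaluates it.\<close>

lemma b_hermitian:
  assumes g: "g \<in> test_fun" and h: "\<And>\<xi>. g (- \<xi>) = cnj (g \<xi>)"
  shows "b g g = 0"
proof -
  obtain r R where r: "r > 0" and g: "on_ann r R g" using g by (auto simp: test_fun_iff)
  let ?k = "\<lambda>l. Op (\<lambda>\<eta>. (\<i> * (\<eta> $ l)) * g \<eta>)"
  have k: "on_ann r R (?k l)" for l by (intro Op(1) on_ann_component g)
  have e: "complex_of_real (P x) * pd l (inv_fourier g) x = inv_fourier (?k l) x" for l x
    unfolding inv_fourier_smooth_pd(2)[OF g] by (rule Op(2)[OF on_ann_component[OF g]])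
  let ?T = "\<lambda>l x. m l (\<lambda>\<xi>. cis (x \<bullet> \<xi>) * g \<xi>)"
  have *: "(\<integral>x. inv_fourier (?k l) x * ?T l x \<partial>lborel) = m l (\<lambda>\<xi>. g \<xi> * ?k l (- \<xi>))" for l
  proof -
    have "(\<integral>x. inv_fourier (?k l) x * (cis (x \<bullet> \<xi>) * g \<xi>) \<partial>lborel) = g \<xi> * ?k l (- \<xi>)" for \<xi>
    proof -
      have "?k l (- \<xi>) = (\<integral>x. cis (- (x \<bullet> (- \<xi>))) * inv_fourier (?k l) x \<partial>lborel)"
        by (metis fourier_inv_fourier[OF k[of l]] fourier_def)
      then have "g \<xi> * ?k l (- \<xi>) = (\<integral>x. g \<xi> * (cis (x \<bullet> \<xi>) * inv_fourier (?k l) x) \<partial>lborel)" by simp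
      then show ?thesis by (simp only: mult_ac)
    qed
    then show ?thesis
      using interchange_cis(3)[OF m r g inv_fourier_smooth_pd(3)[OF k[of l]], of l] by simp
  qed
  have I: "integrable lborel (\<lambda>x. inv_fourier (?k l) x * ?T l x)" for l
  proof -
    obtain E n where E: "\<And>x. norm (?T l x) \<le> E * (1 + norm x) ^ n"
      using interchange_cis(1)[OF m r g, of l] by blast
    have "rapid (\<lambda>x. ?T l x * inv_fourier (?k l) x)"
      by (rule rapid_mult[OF inv_fourier_smooth_pd(3)[OF k] interchange_cis(2)[OF m r g] E])
    then show ?thesis by (subst mult.commute) (rule rapid_integrable_0)
  qed
  have "0 = (\<integral>x. (\<Sum>l\<in>UNIV. (complex_of_real (P x) * ?T l x) * pd l (inv_fourier g) x) \<partial>lborel)"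
    by (rule integral_weight_zero[OF r g h, symmetric])
  also have "\<dots> = (\<integral>x. (\<Sum>l\<in>UNIV. inv_fourier (?k l) x * ?T l x) \<partial>lborel)"
    unfolding e[symmetric] by (simp only: mult_ac)
  also have "\<dots> = b g g" using I by (simp add: b_def *)
  finally show ?thesis by simp
qed

lemma Op_component_test: "h \<in> test_fun \<Longrightarrow> Op (\<lambda>\<eta>. (\<i> * (\<eta> $ l)) * h \<eta>) \<in> test_fun"
  by (auto simp: test_fun_iff intro: Op(1) on_ann_component)

lemma b_test:
  assumes "g \<in> test_fun" "h \<in> test_fun"
  shows "(\<lambda>\<xi>. g \<xi> * Op (\<lambda>\<eta>. (\<i> * (\<eta> $ l)) * h \<eta>) (- \<xi>)) \<in> test_fun"
  using test_fun_mult[OF assms(1) test_fun_smooth[OF test_fun_reflect[OF Op_component_test[OF assms(2), of l]]]]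
  by (simp add: mult.commute)

lemma b_add_left: "g \<in> test_fun \<Longrightarrow> g' \<in> test_fun \<Longrightarrow> h \<in> test_fun \<Longrightarrow> b (\<lambda>\<xi>. g \<xi> + g' \<xi>) h = b g h + b g' h"
  unfolding b_def distrib_right by (simp add: functional_add[OF m] b_test sum.distrib)

lemma b_cmult_left:
  assumes "g \<in> test_fun" "h \<in> test_fun" shows "b (\<lambda>\<xi>. c * g \<xi>) h = c * b g h"
proof -
  have "(\<lambda>\<xi>. (c * g \<xi>) * Op (\<lambda>\<eta>. (\<i> * (\<eta> $ l)) * h \<eta>) (- \<xi>)) = (\<lambda>\<xi>. c * (g \<xi> * Op (\<lambda>\<eta>. (\<i> * (\<eta> $ l)) * h \<eta>) (- \<xi>)))" for l
    by (rule ext) (rule mult.assoc)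
  then show ?thesis unfolding b_def by (simp only: functional_cmult[OF m b_test[OF assms]] sum_distrib_left)
qed

lemma smooth_icomponent: "smooth h \<Longrightarrow> smooth (\<lambda>\<eta>. (\<i> * complex_of_real (\<eta> $ l)) * h \<eta>)"
  by (intro smooth_mult smooth_const smooth_complex_component)

lemma b_add_right:
  assumes "g \<in> test_fun" "h \<in> test_fun" "h' \<in> test_fun"
  shows "b g (\<lambda>\<xi>. h \<xi> + h' \<xi>) = b g h + b g h'"
proof -
  have "Op (\<lambda>\<eta>. (\<i> * (\<eta> $ l)) * (h \<eta> + h' \<eta>)) = (\<lambda>\<xi>. Op (\<lambda>\<eta>. (\<i> * (\<eta> $ l)) * h \<eta>) \<xi> + Op (\<lambda>\<eta>. (\<i> * (\<eta> $ l)) * h' \<eta>) \<xi>)" for l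
    unfolding distrib_left by (intro Op(3) smooth_icomponent test_fun_smooth assms)
  then show ?thesis unfolding b_def by (simp add: distrib_left functional_add[OF m] b_test assms sum.distrib)
qed

lemma b_cmult_right:
  assumes "g \<in> test_fun" "h \<in> test_fun" shows "b g (\<lambda>\<xi>. c * h \<xi>) = c * b g h"
proof -
  have "Op (\<lambda>\<eta>. (\<i> * (\<eta> $ l)) * (c * h \<eta>)) = (\<lambda>\<xi>. c * Op (\<lambda>\<eta>. (\<i> * (\<eta> $ l)) * h \<eta>) \<xi>)" for l
    unfolding mult.left_commute[of _ c] by (intro Op(4) smooth_icomponent test_fun_smooth assms)
  then show ?thesis unfolding b_def
    by (simp add: mult.left_commute[of _ c] functional_cmult[OF m] b_test assms sum_distrib_left)
qed

text \<open>Expanding the form on the diagonal at g + h settles Hermitian pairs. Every test function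
  is a complex combination of two Hermitian ones and \<open>b\<close> is complex bilinear, so the
  identity extends.\<close>

lemma b_antisymmetric:
  assumes g: "g \<in> test_fun" and h: "h \<in> test_fun"
  shows "b g h + b h g = 0"
proof -
  \<comment> \<open>On the Fourier side, \<open>re\<close> and \<open>im\<close> correspond to the
    real and imaginary part of the function in x.\<close>
  define re where "re g \<xi> = 1 / 2 * (g \<xi> + cnj (g (- \<xi>)))" for g :: "plane \<Rightarrow> complex" and \<xi>
  define im where "im g \<xi> = - \<i> / 2 * (g \<xi> - cnj (g (- \<xi>)))" for g :: "plane \<Rightarrow> complex" and \<xi>
  have dec: "g = (\<lambda>\<xi>. re g \<xi> + \<i> * im g \<xi>)" for g
    by (auto simp: re_def im_def field_simps)
  have c: "(\<lambda>\<xi>. cnj (g (- \<xi>))) \<in> test_fun" if "g \<in> test_fun" for g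
    using test_fun_reflect[OF that] smooth_linear[OF bounded_linear_cnj, of "\<lambda>\<xi>. g (- \<xi>)"]
    by (fastforce simp: test_fun_iff on_ann_def)
  have t: "re g \<in> test_fun" "im g \<in> test_fun" if "g \<in> test_fun" for g
    using test_fun_cmult[OF test_fun_add[OF that c[OF that]], of "1 / 2"]
      test_fun_cmult[OF test_fun_diff[OF that c[OF that]], of "- \<i> / 2"]
    by (simp_all only: re_def[abs_def] im_def[abs_def])
  have herm: "re g (- \<xi>) = cnj (re g \<xi>)" "im g (- \<xi>) = cnj (im g \<xi>)" for g \<xi>
    by (simp_all add: re_def im_def field_simps)
  have s: "b g h + b h g = 0" if t: "g \<in> test_fun" "h \<in> test_fun"
    and "\<And>\<xi>. g (- \<xi>) = cnj (g \<xi>)" "\<And>\<xi>. h (- \<xi>) = cnj (h \<xi>)" for g h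
  proof -
    have "b (\<lambda>\<xi>. g \<xi> + h \<xi>) (\<lambda>\<xi>. g \<xi> + h \<xi>) = 0" "b g g = 0" "b h h = 0"
      by (intro b_hermitian test_fun_add that; simp add: that)+
    then show ?thesis by (simp add: b_add_left b_add_right t test_fun_add algebra_simps)
  qed
  have e: "b g h = b (re g) (re h) + \<i> * b (re g) (im h) + \<i> * b (im g) (re h) - b (im g) (im h)"
    if "g \<in> test_fun" "h \<in> test_fun" for g h
  proof -
    have "b g h = b (\<lambda>\<xi>. re g \<xi> + \<i> * im g \<xi>) (\<lambda>\<xi>. re h \<xi> + \<i> * im h \<xi>)"
      using dec[of g] dec[of h] by simp
    also have "\<dots> = b (re g) (re h) + \<i> * b (re g) (im h) + (\<i> * b (im g) (re h) + \<i> * (\<i> * b (im g) (im h)))"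
      by (simp only: b_add_left b_add_right b_cmult_left b_cmult_right t that test_fun_add test_fun_cmult distrib_left)
    also have "\<dots> = b (re g) (re h) + \<i> * b (re g) (im h) + \<i> * b (im g) (re h) - b (im g) (im h)"
      by (simp add: mult.assoc[symmetric])
    finally show ?thesis .
  qed
  have "b g h + b h g = (b (re g) (re h) + b (re h) (re g)) + \<i> * (b (re g) (im h) + b (im h) (re g))
      + \<i> * (b (im g) (re h) + b (re h) (im g)) - (b (im g) (im h) + b (im h) (im g))"
    unfolding e[OF g h] e[OF h g] by (simp add: algebra_simps)
  also have "\<dots> = 0" by (simp add: s t g h herm)
  finally show ?thesis .
qed

end

section \<open>The action of the multiplicative group of complex numbers\<close>

text \<open>Complex multiplication by z on the plane identified with the complex numbers, so that
  dilations and rotations form a single commutative group.\<close>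

definition cm :: "complex \<Rightarrow> plane \<Rightarrow> plane" where
  "cm z \<xi> = (\<chi> i. if i = 1 then Re z * \<xi> $ 1 - Im z * \<xi> $ 2 else Im z * \<xi> $ 1 + Re z * \<xi> $ 2)"

definition cx :: "plane \<Rightarrow> complex" where "cx \<xi> = Complex (\<xi> $ 1) (\<xi> $ 2)"

lemma cm_nth [simp]: "cm z \<xi> $ 1 = Re z * \<xi> $ 1 - Im z * \<xi> $ 2" "cm z \<xi> $ 2 = Im z * \<xi> $ 1 + Re z * \<xi> $ 2"
  by (simp_all add: cm_def)

lemma cm_mult: "cm z (cm w \<xi>) = cm (z * w) \<xi>"
  by (simp add: vec_eq_iff forall_2 algebra_simps)

lemma cm_real: "cm (complex_of_real t) \<xi> = t *\<^sub>R \<xi>"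
  by (simp add: vec_eq_iff forall_2)

lemma cm_1 [simp]: "cm 1 \<xi> = \<xi>" using cm_real[of 1 \<xi>] by simp

lemma cm_0 [simp]: "cm z 0 = 0" by (simp add: vec_eq_iff forall_2)

lemma cm_cx_commute: "cm (cx \<eta>) \<xi> = cm (cx \<xi>) \<eta>"
  by (simp add: vec_eq_iff forall_2 cx_def)

lemma norm_plane: "norm (\<xi>::plane) = sqrt ((\<xi> $ 1)\<^sup>2 + (\<xi> $ 2)\<^sup>2)"
  unfolding norm_eq_sqrt_inner inner_vec_def sum_2 by (simp add: power2_eq_square)

lemma norm_cx [simp]: "norm (cx \<xi>) = norm \<xi>"
  by (simp add: cx_def norm_plane complex_norm)

lemma cx_0 [simp]: "cx \<xi> = 0 \<longleftrightarrow> \<xi> = 0"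
  using norm_cx[of \<xi>] by (metis norm_eq_zero)

lemma norm_cm: "norm (cm z \<xi>) = norm z * norm \<xi>"
proof -
  have "(Re z * \<xi> $ 1 - Im z * \<xi> $ 2)\<^sup>2 + (Im z * \<xi> $ 1 + Re z * \<xi> $ 2)\<^sup>2
      = ((Re z)\<^sup>2 + (Im z)\<^sup>2) * ((\<xi> $ 1)\<^sup>2 + (\<xi> $ 2)\<^sup>2)" by (simp add: power2_eq_square algebra_simps)
  then show ?thesis by (simp add: norm_plane cmod_def real_sqrt_mult)
qed

lemma linear_cm: "linear (cm z)"
  by (rule linearI) (simp_all add: vec_eq_iff forall_2 algebra_simps)

lemma bounded_linear_cm: "bounded_linear (cm z)"
  using linear_cm by (rule linear_conv_bounded_linear[THEN iffD1])

lemma continuous_on_cm [continuous_intros]: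
  assumes "continuous_on S f" "continuous_on S g" shows "continuous_on S (\<lambda>x. cm (f x) (g x))"
proof -
  have "continuous_on S (\<lambda>x. if i = 1 then Re (f x) * g x $ 1 - Im (f x) * g x $ 2 else Im (f x) * g x $ 1 + Re (f x) * g x $ 2)" for i :: 2
    by (cases "i = 1") (auto intro!: continuous_intros assms)
  then show ?thesis unfolding cm_def by (rule continuous_on_vec_lambda)
qed

lemma continuous_on_cx [continuous_intros]:
  assumes "continuous_on S f" shows "continuous_on S (\<lambda>x. cx (f x))"
  unfolding cx_def Complex_eq by (intro continuous_intros assms)

lemma smooth_cm: "smooth \<Phi> \<Longrightarrow> smooth (\<lambda>\<xi>. \<Phi> (cm z \<xi>))" for \<Phi> :: "plane \<Rightarrow> complex"
  by (rule smooth_and_pd_compose_linear(1)[OF bounded_linear_cm])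

lemma pd_cm:
  fixes \<Phi> :: "plane \<Rightarrow> complex"
  shows "smooth \<Phi> \<Longrightarrow> pd j (\<lambda>\<xi>. \<Phi> (cm z \<xi>)) = (\<lambda>\<xi>. \<Sum>k\<in>UNIV. complex_of_real (cm z (axis j 1) $ k) * pd k \<Phi> (cm z \<xi>))"
  by (rule smooth_and_pd_compose_linear(2)[OF bounded_linear_cm])

lemma on_ann_cm:
  assumes "on_ann r R \<Phi>" "0 < \<alpha>" "\<alpha> \<le> norm z" "norm z \<le> \<beta>" "0 < r"
  shows "on_ann (r / \<beta>) (R / \<alpha>) (\<lambda>\<xi>. \<Phi> (cm z \<xi>))"
  unfolding on_ann_def
proof (intro conjI allI impI)
  show "smooth (\<lambda>\<xi>. \<Phi> (cm z \<xi>))" by (rule smooth_cm[OF on_ann_smooth[OF assms(1)]])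
  fix \<xi> assume "\<Phi> (cm z \<xi>) \<noteq> 0"
  then have b: "r \<le> norm z * norm \<xi>" "norm z * norm \<xi> \<le> R"
    using assms(1) by (auto simp: on_ann_def norm_cm[symmetric])
  have "norm z * norm \<xi> \<le> \<beta> * norm \<xi>" "\<alpha> * norm \<xi> \<le> norm z * norm \<xi>"
    using assms by (auto intro: mult_right_mono)
  with b show "r / \<beta> \<le> norm \<xi>" "norm \<xi> \<le> R / \<alpha>"
    using assms by (auto simp: pos_divide_le_eq pos_le_divide_eq mult.commute)
qed

lemma test_fun_cm:
  assumes "\<Phi> \<in> test_fun" "z \<noteq> 0" shows "(\<lambda>\<xi>. \<Phi> (cm z \<xi>)) \<in> test_fun"
proof -
  obtain r R where r: "r > 0" "on_ann r R \<Phi>" using assms(1) by (auto simp: test_fun_iff)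
  have "on_ann (r / norm z) (R / norm z) (\<lambda>\<xi>. \<Phi> (cm z \<xi>))"
    using assms(2) by (intro on_ann_cm r) auto
  moreover have "r / norm z > 0" using r(1) assms(2) by simp
  ultimately show ?thesis unfolding test_fun_iff by blast
qed

lemma pds_cm_snoc:
  fixes \<Phi> :: "plane \<Rightarrow> complex"
  assumes "smooth \<Phi>"
  shows "pds (js @ [j]) (\<lambda>\<xi>. \<Phi> (cm z \<xi>)) = (\<lambda>\<xi>. \<Sum>k\<in>UNIV. complex_of_real (cm z (axis j 1) $ k) * pds js (\<lambda>\<xi>. pd k \<Phi> (cm z \<xi>)) \<xi>)"
  by (simp add: pds_append pd_cm[OF assms] pds_sum pds_cmult smooth_cmult smooth_cm smooth_pd assms)

lemma cm_times_continuous: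
  fixes \<Phi> :: "plane \<Rightarrow> complex"
  assumes "smooth \<Phi>" "continuous_on U z"
  shows "continuous_on (U \<times> UNIV) (\<lambda>p. pds js (\<lambda>\<xi>. \<Phi> (cm (z (fst p)) \<xi>)) (snd p))"
  using assms(1)
proof (induction js arbitrary: \<Phi> rule: rev_induct)
  case Nil
  have "continuous_on (U \<times> UNIV) (\<lambda>p. z (fst p))"
    by (rule continuous_on_compose2[OF assms(2)]) (auto intro!: continuous_intros)
  then show ?case unfolding pds_Nil by (intro smooth_continuous_on_compose[OF Nil] continuous_intros)
next
  case (snoc j js)
  have "continuous_on (U \<times> (UNIV :: plane set)) (\<lambda>p. z (fst p))"
    by (rule continuous_on_compose2[OF assms(2)]) (auto intro!: continuous_intros)
  then show ?case
    unfolding pds_cm_snoc[OF snoc.prems] by (intro continuous_intros snoc.IH smooth_pd snoc.prems)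
qed

text \<open>Every derivative produces matrix entries of \<open>cm z\<close>, of size at most |z|;
  the constant is uniform in z.\<close>

lemma cm_times_growth:
  assumes "on_ann r R \<Phi>"
  shows "\<exists>C\<ge>0. \<forall>z \<xi>. norm (pds js (\<lambda>\<xi>. \<Phi> (cm z \<xi>)) \<xi>) \<le> C * norm z ^ length js"
  using assms
proof (induction js arbitrary: \<Phi> rule: rev_induct)
  case Nil
  obtain C where "C \<ge> 0" "\<And>\<xi>. norm (\<Phi> \<xi>) \<le> C" by (rule on_ann_bounded[OF Nil]) blast
  then show ?case by auto
next
  case (snoc j js)
  obtain C where C: "\<And>k. C k \<ge> 0" "\<And>k z \<xi>. norm (pds js (\<lambda>\<xi>. pd k \<Phi> (cm z \<xi>)) \<xi>) \<le> C k * norm z ^ length js"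
    using snoc.IH[OF on_ann_pd[OF snoc.prems]] by metis
  have "norm (pds (js @ [j]) (\<lambda>\<xi>. \<Phi> (cm z \<xi>)) \<xi>) \<le> (\<Sum>k\<in>UNIV. C k) * norm z ^ length (js @ [j])" for z \<xi>
  proof -
    have e: "\<bar>cm z (axis j 1) $ k\<bar> \<le> norm z" for k
      using component_le_norm_cart[of "cm z (axis j 1)" k] by (simp add: norm_cm)
    have "norm (pds (js @ [j]) (\<lambda>\<xi>. \<Phi> (cm z \<xi>)) \<xi>) \<le> (\<Sum>k\<in>UNIV. norm (complex_of_real (cm z (axis j 1) $ k) * pds js (\<lambda>\<xi>. pd k \<Phi> (cm z \<xi>)) \<xi>))"
      unfolding pds_cm_snoc[OF on_ann_smooth[OF snoc.prems]] by (rule norm_sum)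
    also have "\<dots> \<le> (\<Sum>k\<in>UNIV. norm z * (C k * norm z ^ length js))"
      unfolding norm_mult norm_of_real by (intro sum_mono mult_mono e C) auto
    also have "\<dots> = (\<Sum>k\<in>UNIV. C k) * norm z ^ length (js @ [j])"
      by (simp add: sum_2 algebra_simps)
    finally show ?thesis .
  qed
  moreover have "0 \<le> (\<Sum>k\<in>UNIV. C k)" using C(1) by (rule sum_nonneg)
  ultimately show ?case by blast
qed

text \<open>\<open>interchange\<close> for the orbit of \<Phi> under a moving group element. The
  amplitude \<open>A\<close> confines \<open>z\<close> to a range bounded away from 0 and infinity;
  continuity of \<open>z\<close> is asked on \<open>U\<close> only, which admits z = 1/t with its
  singularity where \<open>A\<close> vanishes.\<close>

lemma interchange_cm:
  fixes z A k :: "'a::euclidean_space \<Rightarrow> complex"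
  assumes u: "cont_functional u" and r: "r > 0" and \<Phi>: "on_ann r R \<Phi>"
    and A: "continuous_on UNIV A" "\<And>x. norm (A x) \<le> a"
    and UV: "open U" "open V" "U \<union> V = UNIV" "continuous_on U z" "\<And>x. x \<in> V \<Longrightarrow> A x = 0"
    and z: "0 < \<alpha>" "\<And>x. A x \<noteq> 0 \<Longrightarrow> \<alpha> \<le> norm (z x)" "\<And>x. A x \<noteq> 0 \<Longrightarrow> norm (z x) \<le> \<beta>" "0 < \<beta>"
    and k: "k \<in> borel_measurable borel" "\<And>n. integrable lborel (\<lambda>x. (1 + norm x) ^ n * norm (k x))"
  shows "u (\<lambda>\<xi>. \<integral>x. k x * (A x * \<Phi> (cm (z x) \<xi>)) \<partial>lborel) = (\<integral>x. k x * (A x * u (\<lambda>\<xi>. \<Phi> (cm (z x) \<xi>))) \<partial>lborel)"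
proof -
  have s: "smooth \<Phi>" using \<Phi> by (rule on_ann_smooth)
  let ?F = "\<lambda>x \<xi>. A x * \<Phi> (cm (z x) \<xi>)"
  have p: "pds js (?F x) = (\<lambda>\<xi>. A x * pds js (\<lambda>\<xi>. \<Phi> (cm (z x) \<xi>)) \<xi>)" for js x
    by (rule pds_cmult[OF smooth_cm[OF s]])
  have F: "on_ann (r / \<beta>) (R / \<alpha>) (?F x)" for x
  proof (cases "A x = 0")
    case False
    then show ?thesis by (intro on_ann_mult[OF on_ann_cm[OF \<Phi>]] smooth_const z r)
  qed (simp add: on_ann_def)
  have cont: "continuous_on UNIV (\<lambda>p. pds js (?F (fst p)) (snd p))" for js
  proof -
    have AU: "continuous_on (S \<times> (UNIV :: plane set)) (\<lambda>p. A (fst p))" for S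
      by (rule continuous_on_compose2[OF A(1)]) (auto intro!: continuous_intros)
    have 1: "continuous_on (U \<times> UNIV) (\<lambda>p. pds js (?F (fst p)) (snd p))"
      unfolding p by (intro continuous_on_mult AU cm_times_continuous s UV)
    have 2: "continuous_on (V \<times> UNIV) (\<lambda>p. pds js (?F (fst p)) (snd p))"
    proof (rule continuous_on_eq[where f="\<lambda>_. 0"])
      fix q :: "'a \<times> plane" assume "q \<in> V \<times> UNIV"
      then have "A (fst q) = 0" using UV(5) by auto
      then show "0 = pds js (?F (fst q)) (snd q)" unfolding p by simp
    qed simp
    have "continuous_on (\<Union>{U \<times> UNIV, V \<times> UNIV}) (\<lambda>p. pds js (?F (fst p)) (snd p))"
      by (rule continuous_on_open_Union) (use 1 2 UV in \<open>auto intro: open_Times\<close>)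
    moreover have "\<Union>{U \<times> UNIV, V \<times> UNIV} = (UNIV :: ('a \<times> plane) set)" using UV(3) by auto
    ultimately show ?thesis by simp
  qed
  have growth: "\<exists>C n. \<forall>x \<xi>. norm (pds js (?F x) \<xi>) \<le> C * (1 + norm x) ^ n" for js
  proof -
    obtain C where C: "C \<ge> 0" "\<And>z \<xi>. norm (pds js (\<lambda>\<xi>. \<Phi> (cm z \<xi>)) \<xi>) \<le> C * norm z ^ length js"
      using cm_times_growth[OF \<Phi>] by blast
    have a0: "0 \<le> a" by (rule order_trans[OF norm_ge_zero A(2)])
    have "norm (pds js (?F x) \<xi>) \<le> a * (C * \<beta> ^ length js)" for x \<xi>
    proof (cases "A x = 0")
      case False
      have "norm (pds js (\<lambda>\<xi>. \<Phi> (cm (z x) \<xi>)) \<xi>) \<le> C * norm (z x) ^ length js" by (rule C)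
      also have "\<dots> \<le> C * \<beta> ^ length js" using z(3)[OF False] C(1) by (intro mult_left_mono power_mono) auto
      finally show ?thesis unfolding p norm_mult using a0 by (intro mult_mono A) auto
    next
      case True
      then show ?thesis unfolding p using a0 C(1) z(4) by simp
    qed
    then show ?thesis by (intro exI[of _ "a * (C * \<beta> ^ length js)"] exI[of _ 0]) simp
  qed
  have "u (?F x) = A x * u (\<lambda>\<xi>. \<Phi> (cm (z x) \<xi>))" for x
  proof (cases "A x = 0")
    case False
    then have "z x \<noteq> 0" using z(1,2) by force
    then have "(\<lambda>\<xi>. \<Phi> (cm (z x) \<xi>)) \<in> test_fun" using \<Phi> r by (intro test_fun_cm) (auto simp: test_fun_iff)
    then show ?thesis by (rule functional_cmult[OF u])
  qed (simp add: functional_zero[OF u])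
  then show ?thesis
    using interchange(4)[OF u _ F cont growth k] r z(4) by simp
qed

lemma cm_scaleR: "cm (h *\<^sub>R z) \<xi> = h *\<^sub>R cm z \<xi>"
  by (simp add: vec_eq_iff forall_2 algebra_simps)

text \<open>The generator of the flow \<open>cm (exp (t * a))\<close>: the radial derivative for \<open>a = 1\<close> and the
  angular one for \<open>a = \<i>\<close>.\<close>

definition Dir :: "complex \<Rightarrow> (plane \<Rightarrow> complex) \<Rightarrow> plane \<Rightarrow> complex" where
  "Dir a \<Phi> \<xi> = (\<Sum>k\<in>UNIV. complex_of_real (cm a \<xi> $ k) * pd k \<Phi> \<xi>)"

lemma smooth_cm_nth: "smooth (\<lambda>\<xi>. complex_of_real (cm a \<xi> $ k))"
proof -
  consider "k = 1" | "k = 2" using exhaust_2 by blast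
  then show ?thesis by cases (simp_all, intro smooth_intros, intro smooth_intros)
qed

lemma on_ann_Dir: "on_ann r R \<Phi> \<Longrightarrow> on_ann r R (Dir a \<Phi>)"
  unfolding Dir_def[abs_def] sum_2 by (intro on_ann_add on_ann_mult on_ann_pd smooth_cm_nth)

lemma test_fun_Dir: "\<Phi> \<in> test_fun \<Longrightarrow> Dir a \<Phi> \<in> test_fun"
  by (auto simp: test_fun_iff intro: on_ann_Dir)

lemma Dir_cm:
  assumes "smooth \<Phi>" shows "Dir a (\<lambda>\<xi>. \<Phi> (cm w \<xi>)) = (\<lambda>\<xi>. Dir a \<Phi> (cm w \<xi>))"
  unfolding Dir_def[abs_def] pd_cm[OF assms]
  by (auto simp: sum_2 fun_eq_iff axis_def algebra_simps)

lemma exp_flow_derivative: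
  assumes "smooth \<Phi>"
  shows "((\<lambda>t. \<Phi> (cm (exp (complex_of_real t * a)) \<xi>)) has_vector_derivative Dir a \<Phi> (cm (exp (complex_of_real t * a)) \<xi>)) (at t within S)"
proof -
  let ?e = "\<lambda>t. exp (complex_of_real t * a)"
  have "(?e has_vector_derivative a * ?e t) (at t within S)"
    by (rule has_vector_derivative_real_field) (auto intro!: derivative_eq_intros)
  moreover have "bounded_linear (\<lambda>z. cm z \<xi>)"
    by (intro linear_conv_bounded_linear[THEN iffD1] linearI) (simp_all add: vec_eq_iff forall_2 algebra_simps)
  ultimately have "((\<lambda>t. cm (?e t) \<xi>) has_derivative (\<lambda>h. h *\<^sub>R cm (a * ?e t) \<xi>)) (at t within S)"
    unfolding has_vector_derivative_def using bounded_linear.has_derivative[of "\<lambda>z. cm z \<xi>" ?e]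
    by (fastforce simp: cm_scaleR)
  from has_derivative_compose[OF this smooth_has_derivative[OF assms]]
  have "((\<lambda>t. \<Phi> (cm (?e t) \<xi>)) has_derivative (\<lambda>h. \<Sum>j\<in>UNIV. (h *\<^sub>R cm (a * ?e t) \<xi>) $ j *\<^sub>R pd j \<Phi> (cm (?e t) \<xi>))) (at t within S)" .
  moreover have "(\<Sum>j\<in>UNIV. (h *\<^sub>R cm (a * ?e t) \<xi>) $ j *\<^sub>R pd j \<Phi> (cm (?e t) \<xi>)) = h *\<^sub>R Dir a \<Phi> (cm (?e t) \<xi>)" for h
    unfolding Dir_def cm_mult scaleR_sum_right vector_scaleR_component
    by (simp only: scaleR_conv_of_real[where 'a=complex] of_real_mult mult.assoc scaleR_conv_of_real[where 'a=real] of_real_eq_id id_apply)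
  ultimately show ?thesis by (simp add: has_vector_derivative_def)
qed

text \<open>The fundamental theorem of calculus along the orbit, pulled through \<open>u\<close> by
  \<open>interchange_cm\<close>. The integrated form avoids differentiating \<open>u\<close> along
  the flow.\<close>

lemma functional_flow:
  assumes u: "cont_functional u" and \<Phi>: "\<Phi> \<in> test_fun"
  shows "u (\<lambda>\<xi>. \<Phi> (cm (exp a) \<xi>)) - u \<Phi>
    = (\<integral>t. indicator {0..1} t *\<^sub>R u (\<lambda>\<xi>. Dir a \<Phi> (cm (exp (complex_of_real t * a)) \<xi>)) \<partial>lborel)"
proof -
  obtain r R where r: "r > 0" and ann: "on_ann r R \<Phi>" using \<Phi> by (auto simp: test_fun_iff)
  have s: "smooth \<Phi>" using \<Phi> by (rule test_fun_smooth)
  have sD: "smooth (Dir a \<Phi>)" by (rule on_ann_smooth[OF on_ann_Dir[OF ann]])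
  \<comment> \<open>Time is clamped to the unit interval because \<open>interchange_cm\<close>
    integrates over the whole line and wants uniform bounds on the group element.\<close>
  let ?c = "\<lambda>t::real. max 0 (min 1 t)"
  let ?z = "\<lambda>t. exp (complex_of_real (?c t) * a)" and ?k = "\<lambda>t::real. indicator {0..1} t :: complex"
  have zc: "continuous_on UNIV ?z" by (intro continuous_intros)
  have zb: "exp (- norm a) \<le> norm (?z t)" "norm (?z t) \<le> exp (norm a)" for t
  proof -
    have "\<bar>?c t * Re a\<bar> \<le> 1 * norm a" unfolding abs_mult by (intro mult_mono abs_Re_le_cmod) auto
    then show "exp (- norm a) \<le> norm (?z t)" "norm (?z t) \<le> exp (norm a)" by (auto simp: abs_le_iff)
  qed
  have km: "?k \<in> borel_measurable borel" by measurable
  have ki: "integrable lborel (\<lambda>x::real. (1 + norm x) ^ n * norm (?k x))" for n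
  proof -
    have "integrable lborel (\<lambda>x::real. indicator {0..1} x *\<^sub>R (1 + norm x) ^ n)"
      by (rule borel_integrable_compact) (auto intro!: continuous_intros)
    then show ?thesis by (rule Bochner_Integration.integrable_bound) (auto simp: indicator_def)
  qed
  have I: "u (\<lambda>\<xi>. \<integral>x. ?k x * (1 * Dir a \<Phi> (cm (?z x) \<xi>)) \<partial>lborel) = (\<integral>x. ?k x * (1 * u (\<lambda>\<xi>. Dir a \<Phi> (cm (?z x) \<xi>))) \<partial>lborel)"
    by (rule interchange_cm[OF u r on_ann_Dir[OF ann], where U=UNIV and V="{}" and a=1 and \<alpha>="exp (- norm a)" and \<beta>="exp (norm a)"])
      (use zc zb km ki in auto)
  have "(\<integral>x. ?k x * (1 * Dir a \<Phi> (cm (?z x) \<xi>)) \<partial>lborel) = \<Phi> (cm (exp a) \<xi>) - \<Phi> \<xi>" for \<xi>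
  proof -
    let ?f = "\<lambda>t. Dir a \<Phi> (cm (exp (complex_of_real t * a)) \<xi>)"
    have "(\<integral>t. indicator {0..1} t *\<^sub>R ?f t \<partial>lborel) = \<Phi> (cm (exp (complex_of_real 1 * a)) \<xi>) - \<Phi> (cm (exp (complex_of_real 0 * a)) \<xi>)"
    proof (rule integral_FTC_Icc)
      show "continuous_on {0..1} ?f" by (intro smooth_continuous_on_compose[OF sD] continuous_intros)
    qed (use exp_flow_derivative[OF s] in auto)
    moreover have "(\<integral>x. ?k x * (1 * Dir a \<Phi> (cm (?z x) \<xi>)) \<partial>lborel) = (\<integral>t. indicator {0..1} t *\<^sub>R ?f t \<partial>lborel)"
      by (rule Bochner_Integration.integral_cong) (auto simp: indicator_def)
    ultimately show ?thesis by simp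
  qed
  moreover have "(\<integral>x. ?k x * (1 * u (\<lambda>\<xi>. Dir a \<Phi> (cm (?z x) \<xi>))) \<partial>lborel)
      = (\<integral>t. indicator {0..1} t *\<^sub>R u (\<lambda>\<xi>. Dir a \<Phi> (cm (exp (complex_of_real t * a)) \<xi>)) \<partial>lborel)"
    by (rule Bochner_Integration.integral_cong) (auto simp: indicator_def)
  moreover have "u (\<lambda>\<xi>. \<Phi> (cm (exp a) \<xi>) - \<Phi> \<xi>) = u (\<lambda>\<xi>. \<Phi> (cm (exp a) \<xi>)) - u \<Phi>"
    by (rule functional_diff[OF u test_fun_cm[OF \<Phi>] \<Phi>]) simp
  ultimately show ?thesis using I by simp
qed

text \<open>The generator commutes with the group action and is real linear in its parameter, so the
  integrand of \<open>functional_flow\<close> vanishes for purely imaginary parameters.\<close>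

lemma rotation_invariant:
  assumes u: "cont_functional u" and 0: "\<And>\<phi>. \<phi> \<in> test_fun \<Longrightarrow> u (Dir \<i> \<phi>) = 0" and \<Phi>: "\<Phi> \<in> test_fun"
  shows "u (\<lambda>\<xi>. \<Phi> (cm (cis t) \<xi>)) = u \<Phi>"
proof -
  have "Dir (\<i> * t) \<phi> = (\<lambda>\<xi>. t * Dir \<i> \<phi> \<xi>)" for \<phi>
    by (auto simp: Dir_def[abs_def] sum_2 fun_eq_iff algebra_simps)
  then have "u (\<lambda>\<xi>. Dir (\<i> * t) \<Phi> (cm z \<xi>)) = 0" if "z \<noteq> 0" for z
    using 0[OF test_fun_cm[OF \<Phi> that]] functional_cmult[OF u test_fun_cm[OF test_fun_Dir[OF \<Phi>] that]]
    unfolding Dir_cm[OF test_fun_smooth[OF \<Phi>]] by simp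
  then show ?thesis using functional_flow[OF u \<Phi>, of "\<i> * t"] by (simp add: cis_conv_exp)
qed

text \<open>\<open>functional_flow\<close> with parameter -1, where homogeneity turns the integrand
  into exp (e t) times a constant. After integration both sides carry the factor exp e - 1, nonzero
  for e \<noteq> 0. Here \<open>e\<close> is the degree of homogeneity plus the dimension 2.\<close>

lemma euler_identity:
  assumes u: "cont_functional u" and e: "e \<noteq> 0"
    and hom: "\<And>\<phi> t. \<phi> \<in> test_fun \<Longrightarrow> t > 0 \<Longrightarrow> u (\<lambda>\<xi>. \<phi> ((1 / t) *\<^sub>R \<xi>)) = complex_of_real (t powr e) * u \<phi>"
    and \<Phi>: "\<Phi> \<in> test_fun"
  shows "u (\<lambda>\<xi>. \<Sum>k\<in>UNIV. complex_of_real (\<xi> $ k) * pd k \<Phi> \<xi>) = - complex_of_real e * u \<Phi>"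
proof -
  have x: "cm (exp (- complex_of_real t)) \<xi> = (1 / exp t) *\<^sub>R \<xi>" for t \<xi>
  proof -
    have "exp (- complex_of_real t) = complex_of_real (1 / exp t)"
      using exp_of_real[of "- t", where 'a=complex] by (simp add: exp_minus divide_inverse)
    then show ?thesis using cm_real[of "1 / exp t" \<xi>] by simp
  qed
  have h: "u (\<lambda>\<xi>. \<phi> (cm (exp (- complex_of_real t)) \<xi>)) = complex_of_real (exp (e * t)) * u \<phi>" if "\<phi> \<in> test_fun" for \<phi> t
    unfolding x using hom[OF that, of "exp t"] by (simp add: powr_def)
  have D: "Dir (- 1) \<Phi> \<in> test_fun" by (rule test_fun_Dir[OF \<Phi>])
  have "complex_of_real (exp e) * u \<Phi> - u \<Phi> = (\<integral>t. indicator {0..1} t *\<^sub>R (complex_of_real (exp (e * t)) * u (Dir (- 1) \<Phi>)) \<partial>lborel)"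
    using functional_flow[OF u \<Phi>, of "- 1"] h[OF \<Phi>, of 1] h[OF D] by simp
  also have "\<dots> = complex_of_real (exp (e * 1) / e) * u (Dir (- 1) \<Phi>) - complex_of_real (exp (e * 0) / e) * u (Dir (- 1) \<Phi>)"
  proof (rule integral_FTC_Icc)
    fix t :: real
    have "((\<lambda>t. exp (e * t) / e) has_real_derivative exp (e * t)) (at t within {0..1})"
      using e by (auto intro!: derivative_eq_intros)
    then have "((\<lambda>t. complex_of_real (exp (e * t) / e)) has_vector_derivative complex_of_real (exp (e * t))) (at t within {0..1})"
      by (rule has_vector_derivative_of_real)
    then show "((\<lambda>t. complex_of_real (exp (e * t) / e) * u (Dir (- 1) \<Phi>)) has_vector_derivative complex_of_real (exp (e * t)) * u (Dir (- 1) \<Phi>)) (at t within {0..1})"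
      by (rule has_vector_derivative_mult_left)
  qed (auto intro!: continuous_intros)
  finally have "complex_of_real (exp e - 1) * u \<Phi> = complex_of_real (exp e - 1) * (u (Dir (- 1) \<Phi>) / complex_of_real e)"
    by (simp add: algebra_simps diff_divide_distrib)
  moreover have "exp e - 1 \<noteq> 0" using e by simp
  ultimately have "u \<Phi> = u (Dir (- 1) \<Phi>) / complex_of_real e" by (metis mult_left_cancel of_real_eq_0_iff)
  moreover have "Dir (- 1) \<Phi> = (\<lambda>\<xi>. - (\<Sum>k\<in>UNIV. complex_of_real (\<xi> $ k) * pd k \<Phi> \<xi>))"
    by (auto simp: Dir_def[abs_def] sum_2 fun_eq_iff)
  moreover have "(\<lambda>\<xi>. \<Sum>k\<in>UNIV. complex_of_real (\<xi> $ k) * pd k \<Phi> \<xi>) \<in> test_fun"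
    by (intro test_fun_sum test_fun_mult test_fun_pd \<Phi> smooth_complex_component)
  ultimately show ?thesis using e by (simp add: functional_minus[OF u] field_simps)
qed

section \<open>Averaging over the multiplicative group\<close>

text \<open>The determinant of multiplication by z is |z|^2; Lebesgue measure is recognised by its
  values on boxes.\<close>

lemma lborel_integral_cm:
  fixes h :: "plane \<Rightarrow> complex"
  assumes w: "w \<noteq> 0" and h: "h \<in> borel_measurable borel"
  shows "(\<integral>x. h x \<partial>lborel) = complex_of_real ((norm w)\<^sup>2) * (\<integral>x. h (cm w x) \<partial>lborel)"
proof -
  let ?M = "density (distr lborel borel (cm w)) (\<lambda>_. ennreal ((norm w)\<^sup>2))"
  have cmm: "cm w \<in> borel_measurable borel" by (intro borel_measurable_continuous_onI continuous_intros)
  have M: "lborel = ?M"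
  proof (rule lborel_eqI)
    fix l u :: plane assume le: "\<And>b. b \<in> Basis \<Longrightarrow> l \<bullet> b \<le> u \<bullet> b"
    have pre: "cm w -` box l u = cm (inverse w) ` box l u"
    proof (intro equalityI subsetI)
      fix x assume "x \<in> cm w -` box l u"
      then show "x \<in> cm (inverse w) ` box l u"
        using w by (intro image_eqI[of _ _ "cm w x"]) (auto simp: cm_mult)
    qed (use w in \<open>auto simp: cm_mult\<close>)
    have det: "det (matrix (cm (inverse w))) = 1 / (norm w)\<^sup>2"
    proof -
      have "det (matrix (cm z)) = (norm z)\<^sup>2" for z
        unfolding cmod_power2 by (simp add: det_2 matrix_def axis_def power2_eq_square)
      then show ?thesis by (simp add: norm_inverse power_inverse divide_inverse)
    qed
    have pm: "cm w -` box l u \<in> sets borel" using measurable_sets[OF cmm, of "box l u"] by simp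
    have "emeasure ?M (box l u) = ennreal ((norm w)\<^sup>2) * emeasure lborel (cm w -` box l u)"
      using cmm by (simp add: emeasure_density nn_integral_cmult_indicator emeasure_distr)
    also have "emeasure lborel (cm w -` box l u) = emeasure lebesgue (cm (inverse w) ` box l u)"
      using pm pre by (simp add: emeasure_lborel_Icc)
    also have "\<dots> = ennreal (measure lebesgue (cm (inverse w) ` box l u))"
      by (intro emeasure_eq_measure2 measurable_linear_image linear_cm) simp
    also have "measure lebesgue (cm (inverse w) ` box l u) = 1 / (norm w)\<^sup>2 * measure lebesgue (box l u)"
      by (subst measure_linear_image[OF linear_cm]) (simp_all add: det)
    also have "measure lebesgue (box l u) = (\<Prod>b\<in>Basis. (u - l) \<bullet> b)"
      using le by (simp add: measure_lborel_box_eq)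
    finally have "emeasure ?M (box l u) = ennreal ((norm w)\<^sup>2) * ennreal (1 / (norm w)\<^sup>2 * (\<Prod>b\<in>Basis. (u - l) \<bullet> b))" .
    also have "\<dots> = ennreal (\<Prod>b\<in>Basis. (u - l) \<bullet> b)"
      using w by (subst ennreal_mult'[symmetric]) auto
    finally show "emeasure ?M (box l u) = (\<Prod>b\<in>Basis. (u - l) \<bullet> b)" .
  qed simp
  have "(\<integral>x. h x \<partial>lborel) = (\<integral>x. h x \<partial>?M)" using M by (rule arg_cong)
  also have "\<dots> = (\<integral>x. (norm w)\<^sup>2 *\<^sub>R h x \<partial>distr lborel borel (cm w))"
    using h by (subst integral_density) auto
  also have "\<dots> = (\<integral>x. (norm w)\<^sup>2 *\<^sub>R h (cm w x) \<partial>lborel)"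
    using h cmm by (subst integral_distr) auto
  finally show ?thesis by (simp add: scaleR_conv_of_real)
qed

lemma continuous_on_zero_near_0:
  fixes F :: "plane \<Rightarrow> complex"
  assumes "continuous_on (- {0}) F" "\<rho> > 0" "\<And>x. norm x < \<rho> \<Longrightarrow> F x = 0"
  shows "continuous_on UNIV F"
proof -
  have "continuous_on (ball 0 \<rho>) F"
    by (rule continuous_on_eq[where f="\<lambda>_. 0"]) (use assms(3) in auto)
  then have "continuous_on (\<Union>{- {0}, ball 0 \<rho>}) F"
    by (intro continuous_on_open_Union) (use assms(1) in auto)
  moreover have "\<Union>{- {0}, ball 0 \<rho>} = (UNIV :: plane set)" using assms(2) by auto
  ultimately show ?thesis by simp
qed

lemma integrable_cball_moment:
  "integrable lborel (\<lambda>x::plane. (1 + norm x) ^ n * norm (indicator (cball 0 B) x :: complex))"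
proof -
  have "integrable lborel (\<lambda>x::plane. indicator (cball 0 B) x *\<^sub>R (1 + norm x) ^ n)"
    by (rule borel_integrable_compact) (auto intro!: continuous_intros)
  then show ?thesis by (rule Bochner_Integration.integrable_bound) (auto simp: indicator_def)
qed

lemma test_fun_annE:
  assumes "\<phi> \<in> test_fun" obtains r R where "0 < r" "r \<le> R" "on_ann r R \<phi>"
proof -
  obtain r R where "0 < r" "on_ann r R \<phi>" using assms by (auto simp: test_fun_iff)
  then show ?thesis by (intro that[of r "max r R"]) (auto elim: on_ann_mono)
qed

text \<open>Here \<open>cm (inverse (cx s)) (axis 1 1)\<close> is \<open>1 / s\<close> as a complex number, and \<open>|s|\<^sup>-\<^sup>2\<close> is the
  density of the Haar measure of the punctured plane.\<close>

definition inversion :: "(plane \<Rightarrow> complex) \<Rightarrow> plane \<Rightarrow> complex" where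
  "inversion \<Phi> s = \<Phi> (cm (inverse (cx s)) (axis 1 1)) / complex_of_real ((norm s)\<^sup>2)"

lemma inversion_props:
  assumes r: "0 < r" "r \<le> R" and \<Phi>: "on_ann r R \<Phi>"
  shows "inversion \<Phi> s \<noteq> 0 \<Longrightarrow> 1 / R \<le> norm s" "inversion \<Phi> s \<noteq> 0 \<Longrightarrow> norm s \<le> 1 / r"
    and "continuous_on UNIV (inversion \<Phi>)" and "\<exists>a. \<forall>s. norm (inversion \<Phi> s) \<le> a"
proof -
  have R: "0 < R" using r by simp
  have n: "norm (cm (inverse (cx s)) (axis 1 1)) = 1 / norm s" for s
    by (simp add: norm_cm norm_inverse divide_inverse)
  have b: "1 / R \<le> norm s \<and> norm s \<le> 1 / r" if "inversion \<Phi> s \<noteq> 0" for s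
  proof -
    have s0: "norm s > 0" using that by (cases "s = 0") (auto simp: inversion_def)
    have "r \<le> 1 / norm s" "1 / norm s \<le> R"
      using that \<Phi> unfolding on_ann_def n[symmetric] by (auto simp: inversion_def)
    then have "r * norm s \<le> 1" "1 \<le> norm s * R" using s0 by (simp_all add: pos_le_divide_eq pos_divide_le_eq mult.commute)
    then show ?thesis using r(1) R by (simp add: pos_le_divide_eq pos_divide_le_eq mult.commute)
  qed
  then show "inversion \<Phi> s \<noteq> 0 \<Longrightarrow> 1 / R \<le> norm s" "inversion \<Phi> s \<noteq> 0 \<Longrightarrow> norm s \<le> 1 / r" by blast+
  show "continuous_on UNIV (inversion \<Phi>)"
  proof (rule continuous_on_zero_near_0)
    show "continuous_on (- {0}) (inversion \<Phi>)"
      unfolding inversion_def[abs_def]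
      by (intro continuous_intros smooth_continuous_on_compose[OF on_ann_smooth[OF \<Phi>]]) auto
    show "1 / R > 0" using R by simp
    show "inversion \<Phi> x = 0" if "norm x < 1 / R" for x using b[of x] that by force
  qed
  obtain C where C: "C \<ge> 0" "\<And>x. norm (\<Phi> x) \<le> C" by (rule on_ann_bounded[OF \<Phi>]) blast
  have "norm (inversion \<Phi> s) \<le> C * R\<^sup>2" for s
  proof (cases "inversion \<Phi> s = 0")
    case False
    with b[OF False] have s: "1 / R \<le> norm s" "norm s > 0" using R by (auto intro: less_le_trans[of 0 "1 / R"])
    have "inverse (norm s) \<le> R" using s R by (simp add: field_simps)
    then have "(inverse (norm s))\<^sup>2 \<le> R\<^sup>2" by (intro power_mono) auto
    then have "norm (\<Phi> (cm (inverse (cx s)) (axis 1 1))) * (inverse (norm s))\<^sup>2 \<le> C * R\<^sup>2"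
      using C by (intro mult_mono) auto
    then show ?thesis by (simp add: inversion_def norm_divide norm_power divide_inverse power_inverse norm_mult norm_inverse)
  qed (use C R in simp)
  then show "\<exists>a. \<forall>s. norm (inversion \<Phi> s) \<le> a" by blast
qed

lemma cm_cx_axis: "cm (cx \<xi>) (axis 1 1) = \<xi>"
  by (simp add: vec_eq_iff forall_2 cx_def axis_def)

lemma cx_cm: "cx (cm z \<xi>) = z * cx \<xi>"
  by (simp add: cx_def complex_eq_iff)

text \<open>Both sides of the average are the multiplicative convolution of \<open>\<phi>\<close> and \<open>\<Phi>\<close> on the
  punctured plane, evaluated by \<open>f\<close> in the two possible orders.\<close>

lemma group_average:
  assumes f: "cont_functional f"
    and hom: "\<And>\<phi> z. \<phi> \<in> test_fun \<Longrightarrow> z \<noteq> 0 \<Longrightarrow> f (\<lambda>\<xi>. \<phi> (cm z \<xi>)) = complex_of_real (norm z powr (- e)) * f \<phi>"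
    and \<Phi>: "\<Phi> \<in> test_fun" and \<phi>: "\<phi> \<in> test_fun"
  shows "f \<phi> * (\<integral>s. inversion \<Phi> s * complex_of_real (norm s powr (- e)) \<partial>lborel)
    = f \<Phi> * (\<integral>t. \<phi> t * complex_of_real (norm t powr (e - 2)) \<partial>lborel)"
proof -
  obtain r R where r: "0 < r" "r \<le> R" and a\<Phi>: "on_ann r R \<Phi>" by (rule test_fun_annE[OF \<Phi>])
  obtain q Q where q: "0 < q" "q \<le> Q" and a\<phi>: "on_ann q Q \<phi>" by (rule test_fun_annE[OF \<phi>])
  note IP = inversion_props[OF r a\<Phi>]
  obtain a where a: "\<And>s. norm (inversion \<Phi> s) \<le> a" using IP(4) by blast
  \<comment> \<open>The integrable kernel required by \<open>interchange_cm\<close>; it equals 1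
    wherever \<open>inversion \<Phi>\<close> is nonzero, so inserting it changes nothing.\<close>
  let ?k1 = "indicator (cball 0 (1 / r)) :: plane \<Rightarrow> complex"
  have 1: "f (\<lambda>\<xi>. \<integral>s. ?k1 s * (inversion \<Phi> s * \<phi> (cm (cx s) \<xi>)) \<partial>lborel) = (\<integral>s. ?k1 s * (inversion \<Phi> s * f (\<lambda>\<xi>. \<phi> (cm (cx s) \<xi>))) \<partial>lborel)"
  proof (rule interchange_cm[OF f q(1) a\<phi> IP(3) a, where U=UNIV and V="{}" and \<alpha>="1 / R" and \<beta>="1 / r"])
    show "integrable lborel (\<lambda>x. (1 + norm x) ^ n * norm (?k1 x))" for n by (rule integrable_cball_moment)
    show "continuous_on UNIV cx" by (intro continuous_intros)
    show "?k1 \<in> borel_measurable borel" by (rule borel_measurable_indicator) simp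
  qed (use IP(1,2) r in auto)
  have k1: "?k1 s * (inversion \<Phi> s * c) = inversion \<Phi> s * c" for s c
    using IP(2)[of s] by (auto simp: indicator_def)
  have "inversion \<Phi> s * f (\<lambda>\<xi>. \<phi> (cm (cx s) \<xi>)) = f \<phi> * (inversion \<Phi> s * complex_of_real (norm s powr (- e)))" for s
    by (cases "s = 0") (simp_all add: inversion_def hom[OF \<phi>])
  with 1 have F4: "f (\<lambda>\<xi>. \<integral>s. inversion \<Phi> s * \<phi> (cm (cx s) \<xi>) \<partial>lborel) = f \<phi> * (\<integral>s. inversion \<Phi> s * complex_of_real (norm s powr (- e)) \<partial>lborel)"
    unfolding k1 by simp
  let ?A = "\<lambda>t. \<phi> t / complex_of_real ((norm t)\<^sup>2)" and ?k2 = "indicator (cball 0 Q) :: plane \<Rightarrow> complex"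
  obtain C where C: "C \<ge> 0" "\<And>x. norm (\<phi> x) \<le> C" by (rule on_ann_bounded[OF a\<phi>]) blast
  have \<phi>b: "q \<le> norm t \<and> norm t \<le> Q" if "\<phi> t \<noteq> 0" for t using a\<phi> that by (auto simp: on_ann_def)
  have Ac: "continuous_on UNIV ?A"
  proof (rule continuous_on_zero_near_0)
    show "continuous_on (- {0}) ?A"
      by (intro continuous_intros smooth_continuous_on[OF on_ann_smooth[OF a\<phi>]]) auto
    show "?A x = 0" if "norm x < q" for x using \<phi>b[of x] that by auto
  qed (rule q)
  have Ab: "norm (?A t) \<le> C / q\<^sup>2" for t
  proof (cases "\<phi> t = 0")
    case False
    then have "q\<^sup>2 \<le> (norm t)\<^sup>2" using \<phi>b q by (intro power_mono) auto
    then show ?thesis using C(1) C(2)[of t] q by (simp add: norm_divide norm_power frac_le)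
  qed (use C q in simp)
  have 2: "f (\<lambda>\<xi>. \<integral>t. ?k2 t * (?A t * \<Phi> (cm (inverse (cx t)) \<xi>)) \<partial>lborel) = (\<integral>t. ?k2 t * (?A t * f (\<lambda>\<xi>. \<Phi> (cm (inverse (cx t)) \<xi>))) \<partial>lborel)"
  proof (rule interchange_cm[OF f r(1) a\<Phi> Ac Ab, where U="- {0}" and V="ball 0 q" and \<alpha>="1 / Q" and \<beta>="1 / q"])
    show "integrable lborel (\<lambda>x. (1 + norm x) ^ n * norm (?k2 x))" for n by (rule integrable_cball_moment)
    show "?k2 \<in> borel_measurable borel" by (rule borel_measurable_indicator) simp
    show "continuous_on (- {0}) (\<lambda>t. inverse (cx t))" by (intro continuous_intros) auto
    show "?A x = 0" if "x \<in> ball 0 q" for x using \<phi>b[of x] that by auto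
    fix x assume "?A x \<noteq> 0"
    then have x: "q \<le> norm x" "norm x \<le> Q" "norm x > 0" using \<phi>b[of x] q by auto
    then show "1 / Q \<le> norm (inverse (cx x))" "norm (inverse (cx x)) \<le> 1 / q"
      using q unfolding norm_inverse norm_cx unfolding inverse_eq_divide by (auto intro!: frac_le)
  qed (use q in auto)
  have k2: "?k2 t * (?A t * c) = ?A t * c" for t c
    using \<phi>b[of t] by (auto simp: indicator_def)
  \<comment> \<open>The action of 1/t contributes |t|^e and the Haar density |t|^(-2), hence the
    exponent \<open>e - 2\<close>.\<close>
  have "?A t * f (\<lambda>\<xi>. \<Phi> (cm (inverse (cx t)) \<xi>)) = f \<Phi> * (\<phi> t * complex_of_real (norm t powr (e - 2)))" for t
  proof (cases "t = 0")
    case True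
    then show ?thesis using \<phi>b[of 0] q by auto
  next
    case False
    then have "norm (inverse (cx t)) powr (- e) / (norm t)\<^sup>2 = norm t powr (e - 2)"
      by (simp add: norm_inverse powr_minus inverse_powr powr_diff flip: powr_numeral)
    then have "complex_of_real (norm (inverse (cx t)) powr (- e)) / complex_of_real ((norm t)\<^sup>2) = complex_of_real (norm t powr (e - 2))"
      by (metis of_real_divide)
    moreover have "?A t * f (\<lambda>\<xi>. \<Phi> (cm (inverse (cx t)) \<xi>)) = f \<Phi> * (\<phi> t * (complex_of_real (norm (inverse (cx t)) powr (- e)) / complex_of_real ((norm t)\<^sup>2)))"
      using False by (simp add: hom[OF \<Phi>])
    ultimately show ?thesis by simp
  qed
  with 2 have F5: "f (\<lambda>\<xi>. \<integral>t. ?A t * \<Phi> (cm (inverse (cx t)) \<xi>) \<partial>lborel) = f \<Phi> * (\<integral>t. \<phi> t * complex_of_real (norm t powr (e - 2)) \<partial>lborel)"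
    unfolding k2 by simp
  \<comment> \<open>Substitute t = \<xi> s in the sense of complex multiplication: the Jacobian
    |\<xi>|^2 cancels against the density and \<xi> / t becomes 1/s.\<close>
  have "(\<integral>s. inversion \<Phi> s * \<phi> (cm (cx s) \<xi>) \<partial>lborel) = (\<integral>t. ?A t * \<Phi> (cm (inverse (cx t)) \<xi>) \<partial>lborel)" for \<xi>
  proof (cases "\<xi> = 0")
    case True
    have "\<phi> 0 = 0" "\<Phi> 0 = 0" using a\<phi> a\<Phi> q r by (auto simp: on_ann_def)
    with True show ?thesis by simp
  next
    case False
    let ?h = "\<lambda>t. ?A t * \<Phi> (cm (inverse (cx t)) \<xi>)"
    have "continuous_on UNIV ?h"
    proof (rule continuous_on_zero_near_0)
      show "continuous_on (- {0}) ?h"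
        by (intro continuous_intros smooth_continuous_on_compose[OF on_ann_smooth[OF a\<Phi>]] smooth_continuous_on[OF on_ann_smooth[OF a\<phi>]]) auto
      show "?h x = 0" if "norm x < q" for x using \<phi>b[of x] that by auto
    qed (rule q)
    then have "?h \<in> borel_measurable borel" by (rule borel_measurable_continuous_onI)
    then have "(\<integral>t. ?h t \<partial>lborel) = complex_of_real ((norm (cx \<xi>))\<^sup>2) * (\<integral>s. ?h (cm (cx \<xi>) s) \<partial>lborel)"
      using False by (intro lborel_integral_cm) auto
    also have "\<dots> = (\<integral>s. complex_of_real ((norm (cx \<xi>))\<^sup>2) * ?h (cm (cx \<xi>) s) \<partial>lborel)"
      by (simp only: integral_mult_right_zero)
    also have "\<dots> = (\<integral>s. inversion \<Phi> s * \<phi> (cm (cx s) \<xi>) \<partial>lborel)"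
    proof (rule Bochner_Integration.integral_cong[OF refl])
      fix s :: plane
      have "cm (inverse (cx (cm (cx \<xi>) s))) \<xi> = cm (inverse (cx s)) (axis 1 1)"
      proof -
        have "cm (inverse (cx (cm (cx \<xi>) s))) (cm (cx \<xi>) (axis 1 1)) = cm (inverse (cx s)) (axis 1 1)"
        proof -
          have "inverse (cx \<xi> * cx s) * cx \<xi> = inverse (cx s)" using False by simp
          then show ?thesis by (simp only: cm_mult cx_cm)
        qed
        then show ?thesis by (simp only: cm_cx_axis)
      qed
      then have "?h (cm (cx \<xi>) s) = \<phi> (cm (cx s) \<xi>) / complex_of_real ((norm \<xi> * norm s)\<^sup>2) * \<Phi> (cm (inverse (cx s)) (axis 1 1))"
        by (simp add: norm_cm cm_cx_commute[of \<xi> s] mult.commute)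
      then show "complex_of_real ((norm (cx \<xi>))\<^sup>2) * ?h (cm (cx \<xi>) s) = inversion \<Phi> s * \<phi> (cm (cx s) \<xi>)"
        using False by (simp add: inversion_def power_mult_distrib)
    qed
    finally show ?thesis by simp
  qed
  with F4 F5 show ?thesis by simp
qed

text \<open>The normalising constant of the average must be nonzero. Near s = 3/4 on the first axis,
  1/s lies where \<open>b\<close> is 1, and the other factors are at least 1 because |s| \<le> 1 and
  e \<ge> 0; elsewhere the integrand is nonnegative.\<close>

lemma inversion_bump_integral:
  assumes e: "e \<ge> 0" and b: "on_ann (1 / 2) 4 b" "\<And>\<xi>. 1 \<le> norm \<xi> \<Longrightarrow> norm \<xi> \<le> 2 \<Longrightarrow> b \<xi> = 1" "\<And>\<xi>. \<exists>t\<ge>0. b \<xi> = complex_of_real t"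
  shows "\<exists>c>0. (\<integral>s. inversion b s * complex_of_real (norm s powr (- e)) \<partial>lborel) = complex_of_real c"
proof -
  obtain t where t: "\<And>\<xi>. t \<xi> \<ge> 0" "\<And>\<xi>. b \<xi> = complex_of_real (t \<xi>)" using b(3) by metis
  define g where "g s = t (cm (inverse (cx s)) (axis 1 1)) / (norm s)\<^sup>2 * norm s powr (- e)" for s
  have ig: "inversion b s * complex_of_real (norm s powr (- e)) = complex_of_real (g s)" for s
    by (simp add: inversion_def g_def t)
  note IP = inversion_props[OF _ _ b(1)]
  have g0: "g s \<ge> 0" for s by (simp add: g_def t)
  let ?B = "ball ((3 / 4) *\<^sub>R axis 1 1 :: plane) (1 / 8)"
  have gB: "g s \<ge> 1" if "s \<in> ?B" for s
  proof -
    have "norm s \<le> 7 / 8" "norm s \<ge> 5 / 8"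
      using that norm_triangle_ineq2[of "(3 / 4) *\<^sub>R axis 1 1 :: plane" s] norm_triangle_ineq2[of s "(3 / 4) *\<^sub>R axis 1 1 :: plane"]
      by (auto simp: dist_norm norm_minus_commute)
    then have s: "norm s > 0" "norm s \<le> 1" "norm s \<ge> 1 / 2" by auto
    have n: "norm (cm (inverse (cx s)) (axis 1 1)) = 1 / norm s" by (simp add: norm_cm norm_inverse divide_inverse)
    have "b (cm (inverse (cx s)) (axis 1 1)) = 1" by (rule b(2)) (unfold n, use s in \<open>auto simp: field_simps\<close>)
    then have "t (cm (inverse (cx s)) (axis 1 1)) = 1" using t(2) by simp
    then have "g s = inverse ((norm s)\<^sup>2) * norm s powr (- e)" by (simp add: g_def divide_inverse)
    moreover have "1 \<le> inverse ((norm s)\<^sup>2)" using s by (intro one_le_inverse) (auto simp: power_le_one)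
    moreover have "1 \<le> norm s powr (- e)"
      using s e powr_le1[of e "norm s"] by (simp add: powr_minus one_le_inverse)
    ultimately show ?thesis using mult_mono[of 1 "inverse ((norm s)\<^sup>2)" 1 "norm s powr (- e)"] by simp
  qed
  have "integrable lborel (\<lambda>s. inversion b s * complex_of_real (norm s powr (- e)))"
  proof -
    let ?h = "\<lambda>s. inversion b s * complex_of_real (norm s powr (- e))"
    have "continuous_on UNIV ?h"
    proof (rule continuous_on_zero_near_0)
      show "continuous_on (- {0}) ?h"
        by (intro continuous_intros continuous_on_subset[OF IP(3)]) auto
      show "?h x = 0" if "norm x < 1 / 4" for x using IP(1)[of x] that by force
    qed simp
    then have "integrable lborel (\<lambda>x. indicator (cball 0 2) x *\<^sub>R ?h x)"
      by (intro borel_integrable_compact) (auto intro: continuous_on_subset)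
    moreover have "indicator (cball 0 2) x *\<^sub>R ?h x = ?h x" for x
      using IP(2)[of x] by (auto simp: indicator_def)
    ultimately show ?thesis by simp
  qed
  then have gi: "integrable lborel g" unfolding ig by (simp add: complex_of_real_integrable_eq)
  have "0 < measure lborel ?B" using content_ball_pos[of "1 / 8" "(3 / 4) *\<^sub>R axis 1 1 :: plane"] by simp
  also have "\<dots> = (\<integral>s. indicator ?B s \<partial>lborel)" by simp
  also have "\<dots> \<le> (\<integral>s. g s \<partial>lborel)"
  proof (rule integral_mono[OF _ gi])
    show "integrable lborel (indicator ?B :: plane \<Rightarrow> real)"
      by (intro integrable_real_indicator emeasure_bounded_finite) auto
    show "indicator ?B s \<le> g s" for s using g0[of s] gB[of s] by (auto simp: indicator_def)
  qed
  finally show ?thesis unfolding ig by (intro exI[of _ "\<integral>s. g s \<partial>lborel"]) simp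
qed

section \<open>Divergence-free and orthogonality constraints\<close>

lemma pd_cong_open:
  assumes "open U" "\<xi> \<in> U" "\<And>x. x \<in> U \<Longrightarrow> f x = g x" "g differentiable (at \<xi>)"
  shows "pd j f \<xi> = pd j g \<xi>"
proof -
  obtain g' where g': "(g has_derivative g') (at \<xi>)" using assms(4) by (auto simp: differentiable_def)
  then have "(f has_derivative g') (at \<xi>)"
    by (rule has_derivative_transform_within_open[OF _ assms(1,2)]) (simp add: assms(3))
  with g' show ?thesis by (simp add: pd_eqI)
qed

text \<open>The bilinear forms evaluate their second argument at -\<xi>. An even cutoff equal to 1
  on a wider annulus is locally constant there, so all terms with a derivative on it drop
  out.\<close>

lemma cutoff_near_test_fun:
  assumes \<phi>: "\<phi> \<in> test_fun"
  obtains h where "h \<in> test_fun" "\<And>\<xi>. h (- \<xi>) = h \<xi>" "\<And>\<xi>. \<phi> \<xi> \<noteq> 0 \<Longrightarrow> h \<xi> = 1"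
    "\<And>\<xi> j. \<phi> \<xi> \<noteq> 0 \<Longrightarrow> pd j h (- \<xi>) = 0" "\<And>\<xi> i j. \<phi> \<xi> \<noteq> 0 \<Longrightarrow> pd i (pd j h) (- \<xi>) = 0"
proof -
  obtain r R where r: "0 < r" "r \<le> R" and a: "on_ann r R \<phi>" by (rule test_fun_annE[OF \<phi>])
  obtain h where h: "on_ann (r / 2 / 2) (2 * (2 * R)) h" "\<And>\<xi>. r / 2 \<le> norm \<xi> \<Longrightarrow> norm \<xi> \<le> 2 * R \<Longrightarrow> h \<xi> = 1" "\<And>\<xi>. h (- \<xi>) = h \<xi>"
  proof (rule ann_bump[of "r / 2" "2 * R"])
    show "0 < r / 2" "r / 2 \<le> 2 * R" using r by auto
  qed blast
  let ?U = "ball 0 (2 * R) - cball (0::plane) (r / 2)"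
  have U: "- \<xi> \<in> ?U" "\<xi> \<in> ?U" if "\<phi> \<xi> \<noteq> 0" for \<xi>
    using a r that by (force simp: on_ann_def)+
  have oU: "open ?U" by (intro open_Diff) auto
  have p1: "pd j h \<xi> = 0" if "\<xi> \<in> ?U" for \<xi> j
    using pd_cong_open[OF oU that, of h "\<lambda>_. 1" j] h(2) by simp
  have p2: "pd i (pd j h) \<xi> = 0" if "\<xi> \<in> ?U" for \<xi> i j
    using pd_cong_open[OF oU that, of "pd j h" "\<lambda>_. 0" i] p1 by simp
  have ht: "h \<in> test_fun" unfolding test_fun_iff using r(1) h(1) by (intro exI[of _ "r / 2 / 2"]) auto
  have h1: "h \<xi> = 1" if "\<phi> \<xi> \<noteq> 0" for \<xi>
  proof -
    have "r \<le> norm \<xi>" "norm \<xi> \<le> R" using a that by (auto simp: on_ann_def)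
    then show ?thesis using r by (intro h(2)) auto
  qed
  show ?thesis by (rule that[OF ht h(3) h1]) (use p1 p2 U(1) in auto)
qed

abbreviation xi :: "2 \<Rightarrow> plane \<Rightarrow> complex" where "xi l \<xi> \<equiv> complex_of_real (\<xi> $ l)"

lemma pd_xi: "pd j (xi l) = (\<lambda>\<xi>. if l = j then 1 else 0)"
proof
  fix \<xi>
  have "pd j (\<lambda>x. complex_of_real (x $ l)) \<xi> = complex_of_real (pd j (\<lambda>x. x $ l) \<xi>)"
    by (rule pd_linear[OF bounded_linear_of_real smooth_differentiable[OF smooth_component]])
  then show "pd j (xi l) \<xi> = (if l = j then 1 else 0)" by (simp add: pd_component)
qed

lemma pd_xi_mult: "smooth f \<Longrightarrow> pd j (\<lambda>\<xi>. xi l \<xi> * f \<xi>) = (\<lambda>\<xi>. xi l \<xi> * pd j f \<xi> + (if l = j then f \<xi> else 0))"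
  by (rule ext) (simp add: pd_mult smooth_differentiable smooth_complex_component pd_xi)

lemma test_fun_xi: "\<phi> \<in> test_fun \<Longrightarrow> (\<lambda>\<xi>. xi l \<xi> * \<phi> \<xi>) \<in> test_fun"
  by (intro test_fun_mult smooth_complex_component)

section \<open>From the polarised identities to the shape of the multiplier\<close>

text \<open>The three \<open>form\<close> assumptions are the polarised identities for the weights
  1, x_j and |x|^2, freed from the constants \<i>, -1 and -\<i>. The exponent in \<open>hom\<close>
  is the degree -1 + 2 \<delta> plus 2 from the Jacobian.\<close>

locale vanishing_forms =
  fixes m :: "2 \<Rightarrow> distr" and \<delta> :: real
  assumes m: "\<And>l. cont_functional (m l)"
    and \<delta>: "\<delta> \<ge> 0" "\<delta> \<noteq> 1"
    and hom: "\<And>l \<phi> t. \<phi> \<in> test_fun \<Longrightarrow> t > 0 \<Longrightarrow> m l (\<lambda>\<xi>. \<phi> ((1 / t) *\<^sub>R \<xi>)) = complex_of_real (t powr (2 * \<delta> + 1)) * m l \<phi>"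
    and form_1: "\<And>g h. g \<in> test_fun \<Longrightarrow> h \<in> test_fun \<Longrightarrow>
      (\<Sum>l\<in>UNIV. m l (\<lambda>\<xi>. g \<xi> * (xi l (- \<xi>) * h (- \<xi>)))) + (\<Sum>l\<in>UNIV. m l (\<lambda>\<xi>. h \<xi> * (xi l (- \<xi>) * g (- \<xi>)))) = 0"
    and form_x: "\<And>g h j. g \<in> test_fun \<Longrightarrow> h \<in> test_fun \<Longrightarrow>
      (\<Sum>l\<in>UNIV. m l (\<lambda>\<xi>. g \<xi> * pd j (\<lambda>\<eta>. xi l \<eta> * h \<eta>) (- \<xi>))) + (\<Sum>l\<in>UNIV. m l (\<lambda>\<xi>. h \<xi> * pd j (\<lambda>\<eta>. xi l \<eta> * g \<eta>) (- \<xi>))) = 0"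
    and form_sq: "\<And>g h. g \<in> test_fun \<Longrightarrow> h \<in> test_fun \<Longrightarrow>
      (\<Sum>l\<in>UNIV. m l (\<lambda>\<xi>. g \<xi> * (\<Sum>a\<in>UNIV. pd a (pd a (\<lambda>\<eta>. xi l \<eta> * h \<eta>)) (- \<xi>))))
      + (\<Sum>l\<in>UNIV. m l (\<lambda>\<xi>. h \<xi> * (\<Sum>a\<in>UNIV. pd a (pd a (\<lambda>\<eta>. xi l \<eta> * g \<eta>)) (- \<xi>)))) = 0"
begin

definition u :: distr where "u \<phi> = m 1 (\<lambda>\<xi>. xi 1 \<xi> * \<phi> \<xi>) + m 2 (\<lambda>\<xi>. xi 2 \<xi> * \<phi> \<xi>)"

lemma u: "cont_functional u"
  using cont_functional_lincomb[OF cont_functional_mult[OF m[of 1] smooth_complex_component[of 1]]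
      cont_functional_mult[OF m[of 2] smooth_complex_component[of 2]], of 1 1]
  by (simp add: u_def[abs_def])

lemmas add = functional_add[OF m] and minus = functional_minus[OF m] and zero = functional_zero[OF m]
  and cmult = functional_cmult[OF m]

lemma hom_xi:
  assumes \<phi>: "\<phi> \<in> test_fun" and t: "t > 0"
  shows "m l (\<lambda>\<xi>. xi k \<xi> * \<phi> ((1 / t) *\<^sub>R \<xi>)) = complex_of_real (t powr (2 * \<delta> + 2)) * m l (\<lambda>\<xi>. xi k \<xi> * \<phi> \<xi>)"
proof -
  let ?g = "\<lambda>\<xi>. xi k ((1 / t) *\<^sub>R \<xi>) * \<phi> ((1 / t) *\<^sub>R \<xi>)"
  have 1: "(\<lambda>\<xi>. xi k \<xi> * \<phi> ((1 / t) *\<^sub>R \<xi>)) = (\<lambda>\<xi>. complex_of_real t * ?g \<xi>)"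
    using t by (auto simp: fun_eq_iff)
  have "?g \<in> test_fun"
    using test_fun_cm[OF test_fun_xi[OF \<phi>, of k], of "complex_of_real (1 / t)"] t unfolding cm_real by simp
  then have "m l (\<lambda>\<xi>. xi k \<xi> * \<phi> ((1 / t) *\<^sub>R \<xi>)) = complex_of_real t * (complex_of_real (t powr (2 * \<delta> + 1)) * m l (\<lambda>\<xi>. xi k \<xi> * \<phi> \<xi>))"
    unfolding 1 cmult[OF \<open>?g \<in> test_fun\<close>] by (simp only: hom[OF test_fun_xi[OF \<phi>, of k] t, of l])
  moreover have "t * t powr (2 * \<delta> + 1) = t powr (2 * \<delta> + 2)"
  proof -
    have "2 * \<delta> + 2 = 1 + (2 * \<delta> + 1)" by simp
    then show ?thesis using t by (simp only: powr_add powr_one)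
  qed
  ultimately show ?thesis by (simp add: mult.assoc[symmetric] flip: of_real_mult)
qed

text \<open>In \<open>form_1\<close> with the even cutoff \<open>h\<close> as second argument, both
  sums reduce to -u, evaluated on \<phi> and on its reflection.\<close>

lemma u_odd: assumes \<phi>: "\<phi> \<in> test_fun" shows "u (\<lambda>\<xi>. \<phi> (- \<xi>)) = - u \<phi>"
proof -
  obtain h where h: "h \<in> test_fun" "\<And>\<xi>. h (- \<xi>) = h \<xi>" "\<And>\<xi>. \<phi> \<xi> \<noteq> 0 \<Longrightarrow> h \<xi> = 1"
    by (rule cutoff_near_test_fun[OF \<phi>]) blast
  have 1: "(\<lambda>\<xi>. \<phi> \<xi> * (xi l (- \<xi>) * h (- \<xi>))) = (\<lambda>\<xi>. - (xi l \<xi> * \<phi> \<xi>))" for l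
  proof
    fix \<xi> show "\<phi> \<xi> * (xi l (- \<xi>) * h (- \<xi>)) = - (xi l \<xi> * \<phi> \<xi>)"
      using h(2,3)[of \<xi>] by (cases "\<phi> \<xi> = 0") auto
  qed
  have 2: "(\<lambda>\<xi>. h \<xi> * (xi l (- \<xi>) * \<phi> (- \<xi>))) = (\<lambda>\<xi>. - (xi l \<xi> * \<phi> (- \<xi>)))" for l
  proof
    fix \<xi> show "h \<xi> * (xi l (- \<xi>) * \<phi> (- \<xi>)) = - (xi l \<xi> * \<phi> (- \<xi>))"
      using h(2)[of \<xi>] h(3)[of "- \<xi>"] by (cases "\<phi> (- \<xi>) = 0") auto
  qed
  show ?thesis
  proof -
    have n: "m l (\<lambda>\<xi>. - (xi l \<xi> * \<psi> \<xi>)) = - m l (\<lambda>\<xi>. xi l \<xi> * \<psi> \<xi>)" if "\<psi> \<in> test_fun" for \<psi> l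
      by (rule minus[OF test_fun_xi[OF that]])
    have "- u \<phi> + - u (\<lambda>\<xi>. \<phi> (- \<xi>)) = 0"
      using form_1[OF \<phi> h(1)] unfolding 1 2 sum_2 u_def n[OF \<phi>] n[OF test_fun_reflect[OF \<phi>]] by simp
    then show ?thesis by (metis add.inverse_inverse add_eq_0_iff)
  qed
qed

lemma sum_xi_m: "(\<Sum>l\<in>UNIV. m l (\<lambda>\<xi>. xi l \<xi> * \<phi> \<xi>)) = u \<phi>"
  by (simp add: sum_2 u_def)

text \<open>In \<open>form_x\<close> the Kronecker deltas from differentiating \<open>xi l\<close>
  produce the two values of \<open>m j\<close>, and the derivative falling on \<phi> produces
  \<open>u\<close>, with a sign change absorbed by \<open>u_odd\<close>.\<close>

lemma m_even_part:
  assumes \<phi>: "\<phi> \<in> test_fun"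
  shows "m j \<phi> + m j (\<lambda>\<xi>. \<phi> (- \<xi>)) + u (pd j \<phi>) = 0"
proof -
  obtain h where h: "h \<in> test_fun" "\<And>\<xi>. h (- \<xi>) = h \<xi>" "\<And>\<xi>. \<phi> \<xi> \<noteq> 0 \<Longrightarrow> h \<xi> = 1"
    "\<And>\<xi> j. \<phi> \<xi> \<noteq> 0 \<Longrightarrow> pd j h (- \<xi>) = 0" by (rule cutoff_near_test_fun[OF \<phi>]) blast
  have s: "smooth \<phi>" "smooth h" using \<phi> h(1) by (auto intro: test_fun_smooth)
  \<comment> \<open>Where h differs from 1, an open set, \<phi> vanishes identically; this lets the
    factor \<open>h\<close> be dropped in front of derivatives of \<phi>.\<close>
  have pdz: "pd j \<phi> \<xi> = 0" if "h \<xi> \<noteq> 1" for \<xi>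
  proof -
    have "open (- {1::complex})" by auto
    then have "open (h -` (- {1}))" using continuous_open_vimage[of "- {1}" h] smooth_isCont[OF s(2)] by blast
    then have "pd j \<phi> \<xi> = pd j (\<lambda>_. 0) \<xi>"
      by (rule pd_cong_open) (use that h(3) in auto)
    then show ?thesis by simp
  qed
  have 1: "(\<lambda>\<xi>. \<phi> \<xi> * pd j (\<lambda>\<eta>. xi l \<eta> * h \<eta>) (- \<xi>)) = (\<lambda>\<xi>. (if l = j then 1 else 0) * \<phi> \<xi>)" for l
  proof
    fix \<xi> show "\<phi> \<xi> * pd j (\<lambda>\<eta>. xi l \<eta> * h \<eta>) (- \<xi>) = (if l = j then 1 else 0) * \<phi> \<xi>"
      using h(2,3,4)[of \<xi>] by (cases "\<phi> \<xi> = 0") (auto simp: pd_xi_mult s)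
  qed
  have 2: "(\<lambda>\<xi>. h \<xi> * pd j (\<lambda>\<eta>. xi l \<eta> * \<phi> \<eta>) (- \<xi>)) = (\<lambda>\<xi>. - (xi l \<xi> * pd j \<phi> (- \<xi>)) + (if l = j then 1 else 0) * \<phi> (- \<xi>))" for l
  proof
    fix \<xi> show "h \<xi> * pd j (\<lambda>\<eta>. xi l \<eta> * \<phi> \<eta>) (- \<xi>) = - (xi l \<xi> * pd j \<phi> (- \<xi>)) + (if l = j then 1 else 0) * \<phi> (- \<xi>)"
      using h(2)[of \<xi>] h(3)[of "- \<xi>"] pdz[of "- \<xi>"]
      by (cases "h \<xi> = 1") (auto simp: pd_xi_mult s)
  qed
  have e1: "(\<Sum>l\<in>UNIV. m l (\<lambda>\<xi>. (if l = j then 1 else 0) * \<psi> \<xi>)) = m j \<psi>" if "\<psi> \<in> test_fun" for \<psi>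
  proof -
    have "(\<Sum>l\<in>UNIV. m l (\<lambda>\<xi>. (if l = j then 1 else 0) * \<psi> \<xi>)) = (\<Sum>l\<in>UNIV. if l = j then m l \<psi> else 0)"
      by (rule sum.cong) (auto simp: zero)
    then show ?thesis by simp
  qed
  have "(\<Sum>l\<in>UNIV. m l (\<lambda>\<xi>. - (xi l \<xi> * pd j \<phi> (- \<xi>)) + (if l = j then 1 else 0) * \<phi> (- \<xi>)))
      = (\<Sum>l\<in>UNIV. - m l (\<lambda>\<xi>. xi l \<xi> * pd j \<phi> (- \<xi>)) + m l (\<lambda>\<xi>. (if l = j then 1 else 0) * \<phi> (- \<xi>)))"
  proof (rule sum.cong[OF refl])
    fix l
    have "(\<lambda>\<xi>. - (xi l \<xi> * pd j \<phi> (- \<xi>))) \<in> test_fun" "(\<lambda>\<xi>. xi l \<xi> * pd j \<phi> (- \<xi>)) \<in> test_fun"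
      using test_fun_reflect[OF test_fun_pd[OF \<phi>, of j]] by (auto intro: test_fun_minus test_fun_xi)
    moreover have "(\<lambda>\<xi>. (if l = j then 1 else 0) * \<phi> (- \<xi>)) \<in> test_fun"
      by (rule test_fun_cmult[OF test_fun_reflect[OF \<phi>]])
    ultimately show "m l (\<lambda>\<xi>. - (xi l \<xi> * pd j \<phi> (- \<xi>)) + (if l = j then 1 else 0) * \<phi> (- \<xi>))
      = - m l (\<lambda>\<xi>. xi l \<xi> * pd j \<phi> (- \<xi>)) + m l (\<lambda>\<xi>. (if l = j then 1 else 0) * \<phi> (- \<xi>))"
      by (simp only: add minus)
  qed
  also have "\<dots> = - u (\<lambda>\<xi>. pd j \<phi> (- \<xi>)) + m j (\<lambda>\<xi>. \<phi> (- \<xi>))"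
    unfolding sum.distrib sum_negf e1[OF test_fun_reflect[OF \<phi>]] sum_xi_m ..
  also have "\<dots> = u (pd j \<phi>) + m j (\<lambda>\<xi>. \<phi> (- \<xi>))" by (simp add: u_odd test_fun_pd \<phi>)
  finally show ?thesis
    using form_x[OF \<phi> h(1), of j] unfolding 1 2 e1[OF \<phi>] by (simp add: algebra_simps)
qed

text \<open>\<open>m_even_part\<close> on \<open>xi j\<close> times \<psi>, summed over j: the
  values of \<open>m\<close> give 2 u by oddness, the product rule gives another 2 u because the
  dimension is 2, and Euler's identity replaces the radial derivative by -(2 \<delta> + 2)
  u.\<close>

lemma u_zero: assumes \<psi>: "\<psi> \<in> test_fun" shows "u \<psi> = 0"
proof -
  have s: "smooth \<psi>" using \<psi> by (rule test_fun_smooth)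
  have r: "m j (\<lambda>\<xi>. xi j (- \<xi>) * \<psi> (- \<xi>)) = - m j (\<lambda>\<xi>. xi j \<xi> * \<psi> (- \<xi>))" for j
    using minus[OF test_fun_xi[OF test_fun_reflect[OF \<psi>]], of j j] by simp
  have p: "u (pd j (\<lambda>\<xi>. xi j \<xi> * \<psi> \<xi>)) = u (\<lambda>\<xi>. xi j \<xi> * pd j \<psi> \<xi>) + u \<psi>" for j
    using functional_add[OF u test_fun_xi[OF test_fun_pd[OF \<psi>, of j], of j] \<psi>] by (simp add: pd_xi_mult s)
  have "m j (\<lambda>\<xi>. xi j \<xi> * \<psi> \<xi>) - m j (\<lambda>\<xi>. xi j \<xi> * \<psi> (- \<xi>)) + (u (\<lambda>\<xi>. xi j \<xi> * pd j \<psi> \<xi>) + u \<psi>) = 0" for j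
    using m_even_part[OF test_fun_xi[OF \<psi>], of j j] unfolding r p by simp
  note E = this
  have alg: "(a1 + a2) - (b1 + b2) + (x1 + x2) + 2 * c = 0" if "a1 - b1 + (x1 + c) = 0" "a2 - b2 + (x2 + c) = 0"
    for a1 a2 b1 b2 x1 x2 c :: complex using that by algebra
  have E1: "u \<psi> - u (\<lambda>\<xi>. \<psi> (- \<xi>)) + (u (\<lambda>\<xi>. xi 1 \<xi> * pd 1 \<psi> \<xi>) + u (\<lambda>\<xi>. xi 2 \<xi> * pd 2 \<psi> \<xi>)) + 2 * u \<psi> = 0"
    using alg[OF E[of 1] E[of 2]] unfolding u_def[of \<psi>] u_def[of "\<lambda>\<xi>. \<psi> (- \<xi>)"] .
  have E2: "u (\<lambda>\<xi>. xi 1 \<xi> * pd 1 \<psi> \<xi>) + u (\<lambda>\<xi>. xi 2 \<xi> * pd 2 \<psi> \<xi>) = u (\<lambda>\<xi>. \<Sum>k\<in>UNIV. xi k \<xi> * pd k \<psi> \<xi>)"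
    unfolding sum_2 by (rule functional_add[OF u, symmetric]) (intro test_fun_xi test_fun_pd \<psi>)+
  have E3: "u (\<lambda>\<xi>. \<Sum>k\<in>UNIV. xi k \<xi> * pd k \<psi> \<xi>) = - complex_of_real (2 * \<delta> + 2) * u \<psi>"
  proof (rule euler_identity[OF u _ _ \<psi>])
    show "2 * \<delta> + 2 \<noteq> 0" using \<delta> by simp
    show "u (\<lambda>\<xi>. \<phi> ((1 / t) *\<^sub>R \<xi>)) = complex_of_real (t powr (2 * \<delta> + 2)) * u \<phi>" if "\<phi> \<in> test_fun" "t > 0" for \<phi> t
      unfolding u_def hom_xi[OF that] by (simp add: distrib_left)
  qed
  have "complex_of_real (2 - 2 * \<delta>) * u \<psi> = 0"
    using E1 unfolding E2 E3 u_odd[OF \<psi>] by (simp add: algebra_simps)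
  then show ?thesis using \<delta> by (simp add: complex_eq_iff)
qed

lemma m_odd: assumes "\<phi> \<in> test_fun" shows "m j (\<lambda>\<xi>. \<phi> (- \<xi>)) = - m j \<phi>"
  using m_even_part[OF assms, of j] u_zero[OF test_fun_pd[OF assms]] by (simp add: add_eq_0_iff)

text \<open>The Laplacian of \<open>xi l\<close> times \<phi> is \<open>xi l\<close> times the
  Laplacian plus twice a first derivative. The former sums to \<open>u\<close>, which vanishes, and
  the terms with the Laplacian on the cutoff side are 0, so the divergence remains; oddness of
  \<open>m\<close> removes the reflection.\<close>

lemma m_divergence_free:
  assumes \<phi>: "\<phi> \<in> test_fun" shows "m 1 (pd 1 \<phi>) + m 2 (pd 2 \<phi>) = 0"
proof -
  obtain h where h: "h \<in> test_fun" "\<And>\<xi>. h (- \<xi>) = h \<xi>" "\<And>\<xi>. \<phi> \<xi> \<noteq> 0 \<Longrightarrow> h \<xi> = 1"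
    "\<And>\<xi> j. \<phi> \<xi> \<noteq> 0 \<Longrightarrow> pd j h (- \<xi>) = 0" "\<And>\<xi> i j. \<phi> \<xi> \<noteq> 0 \<Longrightarrow> pd i (pd j h) (- \<xi>) = 0"
    by (rule cutoff_near_test_fun[OF \<phi>]) blast
  have s: "smooth \<phi>" "smooth h" using \<phi> h(1) by (auto intro: test_fun_smooth)
  define Lap where "Lap \<phi> \<xi> = (\<Sum>a\<in>UNIV. pd a (pd a \<phi>) \<xi>)" for \<phi> :: "plane \<Rightarrow> complex" and \<xi>
  have L: "Lap (\<lambda>\<eta>. xi l \<eta> * f \<eta>) \<xi> = xi l \<xi> * Lap f \<xi> + 2 * pd l f \<xi>" if f: "smooth f" for l f \<xi>
  proof -
    have "pd a (pd a (\<lambda>\<eta>. xi l \<eta> * f \<eta>)) \<xi> = xi l \<xi> * pd a (pd a f) \<xi> + 2 * (if l = a then pd a f \<xi> else 0)" for a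
    proof -
      define k :: complex where "k = (if l = a then 1 else 0)"
      have px: "pd a (\<lambda>\<xi>. xi l \<xi> * g \<xi>) = (\<lambda>\<xi>. xi l \<xi> * pd a g \<xi> + k * g \<xi>)" if "smooth g" for g
        unfolding pd_xi_mult[OF that] k_def by auto
      have "pd a (pd a (\<lambda>\<eta>. xi l \<eta> * f \<eta>)) \<xi> = pd a (\<lambda>\<xi>. xi l \<xi> * pd a f \<xi>) \<xi> + pd a (\<lambda>\<xi>. k * f \<xi>) \<xi>"
        unfolding px[OF f]
        by (intro pd_add smooth_differentiable smooth_mult smooth_complex_component smooth_pd f smooth_const)
      also have "\<dots> = (xi l \<xi> * pd a (pd a f) \<xi> + k * pd a f \<xi>) + k * pd a f \<xi>"
        by (simp only: px[OF smooth_pd[OF f]] pd_linear[OF bounded_linear_mult_right smooth_differentiable[OF f]])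
      finally show ?thesis by (simp add: k_def)
    qed
    then have "Lap (\<lambda>\<eta>. xi l \<eta> * f \<eta>) \<xi> = (\<Sum>a\<in>UNIV. xi l \<xi> * pd a (pd a f) \<xi>) + (\<Sum>a\<in>UNIV. 2 * (if l = a then pd a f \<xi> else 0))"
      by (simp add: Lap_def sum.distrib)
    also have "(\<Sum>a\<in>UNIV. 2 * (if l = a then pd a f \<xi> else 0)) = 2 * pd l f \<xi>"
      by (simp add: sum_distrib_left[symmetric])
    finally show ?thesis by (simp add: Lap_def sum_distrib_left)
  qed
  have Lz: "h \<xi> * Lap (\<lambda>\<eta>. xi l \<eta> * \<phi> \<eta>) (- \<xi>) = Lap (\<lambda>\<eta>. xi l \<eta> * \<phi> \<eta>) (- \<xi>)" for l \<xi>
  proof (cases "h \<xi> = 1")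
    case False
    let ?U = "h -` (- {1})"
    have oU: "open ?U" using continuous_open_vimage[of "- {1}" h] smooth_isCont[OF s(2)] by auto
    have a: "pd a (\<lambda>\<eta>. xi l \<eta> * \<phi> \<eta>) x = 0" if "x \<in> ?U" for x a
      using pd_cong_open[OF oU that, of "\<lambda>\<eta>. xi l \<eta> * \<phi> \<eta>" "\<lambda>_. 0" a] h(3) by fastforce
    have "- \<xi> \<in> ?U" using False h(2) by simp
    then have "pd a (pd a (\<lambda>\<eta>. xi l \<eta> * \<phi> \<eta>)) (- \<xi>) = 0" for a
      using pd_cong_open[OF oU, of "- \<xi>" "pd a (\<lambda>\<eta>. xi l \<eta> * \<phi> \<eta>)" "\<lambda>_. 0" a] a by simp
    then show ?thesis by (simp add: Lap_def)
  qed simp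
  have 1: "(\<lambda>\<xi>. \<phi> \<xi> * Lap (\<lambda>\<eta>. xi l \<eta> * h \<eta>) (- \<xi>)) = (\<lambda>\<xi>. 0)" for l
  proof
    fix \<xi> show "\<phi> \<xi> * Lap (\<lambda>\<eta>. xi l \<eta> * h \<eta>) (- \<xi>) = 0"
      using h(4,5)[of \<xi>] by (cases "\<phi> \<xi> = 0") (auto simp: L s Lap_def[of h])
  qed
  have tL: "(\<lambda>\<xi>. Lap \<phi> (- \<xi>)) \<in> test_fun"
    unfolding Lap_def by (rule test_fun_sum) (intro test_fun_reflect test_fun_pd \<phi>)
  have 2: "m l (\<lambda>\<xi>. h \<xi> * Lap (\<lambda>\<eta>. xi l \<eta> * \<phi> \<eta>) (- \<xi>)) = - m l (\<lambda>\<xi>. xi l \<xi> * Lap \<phi> (- \<xi>)) - 2 * m l (pd l \<phi>)" for l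
  proof -
    have e: "(\<lambda>\<xi>. h \<xi> * Lap (\<lambda>\<eta>. xi l \<eta> * \<phi> \<eta>) (- \<xi>)) = (\<lambda>\<xi>. - (xi l \<xi> * Lap \<phi> (- \<xi>)) + 2 * pd l \<phi> (- \<xi>))"
      unfolding Lz unfolding L[OF s(1)] by simp
    have "m l (\<lambda>\<xi>. - (xi l \<xi> * Lap \<phi> (- \<xi>)) + 2 * pd l \<phi> (- \<xi>)) = - m l (\<lambda>\<xi>. xi l \<xi> * Lap \<phi> (- \<xi>)) + 2 * m l (\<lambda>\<xi>. pd l \<phi> (- \<xi>))"
      using test_fun_xi[OF tL, of l] test_fun_reflect[OF test_fun_pd[OF \<phi>, of l]]
      by (simp only: add minus cmult test_fun_minus test_fun_cmult)
    then show ?thesis unfolding e by (simp add: m_odd test_fun_pd \<phi>)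
  qed
  have "(\<Sum>l\<in>UNIV. - m l (\<lambda>\<xi>. xi l \<xi> * Lap \<phi> (- \<xi>)) - 2 * m l (pd l \<phi>)) = 0"
    using form_sq[OF \<phi> h(1)] unfolding Lap_def[symmetric] 1 2 zero by simp
  then have "- u (\<lambda>\<xi>. Lap \<phi> (- \<xi>)) - 2 * (m 1 (pd 1 \<phi>) + m 2 (pd 2 \<phi>)) = 0"
    by (simp add: sum_2 u_def algebra_simps)
  moreover have "S = 0" if "- X - 2 * S = 0" "X = 0" for X S :: complex using that by simp
  ultimately show ?thesis using u_zero[OF tL] by blast
qed

text \<open>The component of m orthogonal to \<xi>. Multiplying out, |xi|^2 m1 = xi1 u + xi2 f and
  |xi|^2 m2 = xi2 u - xi1 f, so once u = 0 it determines m away from the origin.\<close>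

definition f :: distr where "f \<phi> = m 1 (\<lambda>\<xi>. xi 2 \<xi> * \<phi> \<xi>) - m 2 (\<lambda>\<xi>. xi 1 \<xi> * \<phi> \<xi>)"

lemma f: "cont_functional f"
  using cont_functional_lincomb[OF cont_functional_mult[OF m[of 1] smooth_complex_component[of 2]]
      cont_functional_mult[OF m[of 2] smooth_complex_component[of 1]], of 1 "-1"]
  by (simp add: f_def[abs_def])

lemma norm2_xi: "complex_of_real ((norm \<xi>)\<^sup>2) = xi 1 \<xi> * xi 1 \<xi> + xi 2 \<xi> * xi 2 \<xi>"
proof -
  have "(norm \<xi>)\<^sup>2 = \<xi> $ 1 * \<xi> $ 1 + \<xi> $ 2 * \<xi> $ 2"
    unfolding power2_norm_eq_inner inner_vec_def sum_2 by simp
  then show ?thesis by simp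
qed

lemma m_norm2:
  assumes \<psi>: "\<psi> \<in> test_fun"
  shows "m 1 (\<lambda>\<xi>. complex_of_real ((norm \<xi>)\<^sup>2) * \<psi> \<xi>) = f (\<lambda>\<xi>. xi 2 \<xi> * \<psi> \<xi>)"
    and "m 2 (\<lambda>\<xi>. complex_of_real ((norm \<xi>)\<^sup>2) * \<psi> \<xi>) = - f (\<lambda>\<xi>. xi 1 \<xi> * \<psi> \<xi>)"
proof -
  have e: "m l (\<lambda>\<xi>. complex_of_real ((norm \<xi>)\<^sup>2) * \<psi> \<xi>) = m l (\<lambda>\<xi>. xi 1 \<xi> * (xi 1 \<xi> * \<psi> \<xi>)) + m l (\<lambda>\<xi>. xi 2 \<xi> * (xi 2 \<xi> * \<psi> \<xi>))" for l
    unfolding norm2_xi distrib_right mult.assoc by (intro add test_fun_xi \<psi>)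
  have c: "(\<lambda>\<xi>. xi 2 \<xi> * (xi 1 \<xi> * \<psi> \<xi>)) = (\<lambda>\<xi>. xi 1 \<xi> * (xi 2 \<xi> * \<psi> \<xi>))" by (simp add: mult_ac)
  have "u (\<lambda>\<xi>. xi k \<xi> * \<psi> \<xi>) = 0" for k by (intro u_zero test_fun_xi \<psi>)
  from this[of 1] this[of 2]
  show "m 1 (\<lambda>\<xi>. complex_of_real ((norm \<xi>)\<^sup>2) * \<psi> \<xi>) = f (\<lambda>\<xi>. xi 2 \<xi> * \<psi> \<xi>)"
    and "m 2 (\<lambda>\<xi>. complex_of_real ((norm \<xi>)\<^sup>2) * \<psi> \<xi>) = - f (\<lambda>\<xi>. xi 1 \<xi> * \<psi> \<xi>)"
    unfolding e f_def u_def c by (simp_all add: add_eq_0_iff)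
qed

lemma pd_norm2: "pd l (\<lambda>\<xi>. complex_of_real ((norm \<xi>)\<^sup>2)) = (\<lambda>\<xi>. 2 * xi l \<xi>)"
proof -
  consider "l = 1" | "l = 2" using exhaust_2 by blast
  then show ?thesis unfolding norm2_xi
    by cases (auto simp: fun_eq_iff pd_add pd_mult pd_xi smooth_differentiable smooth_mult smooth_complex_component)
qed

text \<open>Testing the divergence identity with |\<xi>|^2 \<phi> turns \<open>m\<close> into
  \<open>f\<close> by \<open>m_norm2\<close>; the derivative of |\<xi>|^2 contributes only 2 u,
  which is 0.\<close>

lemma f_angular: assumes \<phi>: "\<phi> \<in> test_fun" shows "f (Dir \<i> \<phi>) = 0"
proof -
  have s: "smooth \<phi>" "smooth (\<lambda>\<xi>::plane. complex_of_real ((norm \<xi>)\<^sup>2))"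
    by (rule test_fun_smooth[OF \<phi>], rule smooth_of_real[OF smooth_norm2])
  let ?N = "\<lambda>\<xi>::plane. complex_of_real ((norm \<xi>)\<^sup>2)"
  have N: "(\<lambda>\<xi>. ?N \<xi> * \<phi> \<xi>) \<in> test_fun" by (rule test_fun_mult[OF \<phi> s(2)])
  have p: "pd l (\<lambda>\<xi>. ?N \<xi> * \<phi> \<xi>) = (\<lambda>\<xi>. ?N \<xi> * pd l \<phi> \<xi> + 2 * (xi l \<xi> * \<phi> \<xi>))" for l
    by (rule ext) (simp add: pd_mult smooth_differentiable s pd_norm2 del: of_real_power)
  have q: "m l (\<lambda>\<xi>. ?N \<xi> * pd l \<phi> \<xi> + 2 * (xi l \<xi> * \<phi> \<xi>)) = m l (\<lambda>\<xi>. ?N \<xi> * pd l \<phi> \<xi>) + 2 * m l (\<lambda>\<xi>. xi l \<xi> * \<phi> \<xi>)" for l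
    by (simp only: add cmult test_fun_mult[OF test_fun_pd[OF \<phi>] s(2)] test_fun_cmult test_fun_xi \<phi>)
  have "m 1 (\<lambda>\<xi>. ?N \<xi> * pd 1 \<phi> \<xi>) + m 2 (\<lambda>\<xi>. ?N \<xi> * pd 2 \<phi> \<xi>) + 2 * u \<phi> = 0"
    using m_divergence_free[OF N] unfolding p q u_def by (simp add: algebra_simps del: of_real_power)
  then have "f (\<lambda>\<xi>. xi 2 \<xi> * pd 1 \<phi> \<xi>) = f (\<lambda>\<xi>. xi 1 \<xi> * pd 2 \<phi> \<xi>)"
    unfolding m_norm2[OF test_fun_pd[OF \<phi>]] by (simp add: u_zero[OF \<phi>])
  moreover have "Dir \<i> \<phi> = (\<lambda>\<xi>. xi 1 \<xi> * pd 2 \<phi> \<xi> - xi 2 \<xi> * pd 1 \<phi> \<xi>)"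
    by (auto simp: Dir_def sum_2 fun_eq_iff)
  ultimately show ?thesis by (simp add: functional_diff[OF f] test_fun_xi test_fun_pd \<phi>)
qed

text \<open>Polar decomposition of z: the rotation is absorbed by \<open>rotation_invariant\<close>,
  and the dilation by |z| is homogeneity at 1 / |z|, with exponent the degree 2 \<delta> plus
  2.\<close>

lemma f_hom:
  assumes \<phi>: "\<phi> \<in> test_fun" and z: "z \<noteq> 0"
  shows "f (\<lambda>\<xi>. \<phi> (cm z \<xi>)) = complex_of_real (norm z powr (- (2 * \<delta> + 2))) * f \<phi>"
proof -
  obtain t where t: "z = complex_of_real (norm z) * cis t" using rcis_cmod_Arg[of z] by (metis rcis_def)
  have \<phi>t: "(\<lambda>\<xi>. \<phi> (cm (cis t) \<xi>)) \<in> test_fun" by (rule test_fun_cm[OF \<phi>]) simp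
  have "cm z \<xi> = cm (cis t) ((1 / (1 / norm z)) *\<^sub>R \<xi>)" for \<xi>
    by (subst t) (simp add: cm_real[symmetric] cm_mult mult.commute)
  then have "f (\<lambda>\<xi>. \<phi> (cm z \<xi>)) = f (\<lambda>\<xi>. (\<lambda>\<xi>. \<phi> (cm (cis t) \<xi>)) ((1 / (1 / norm z)) *\<^sub>R \<xi>))" by simp
  also have "\<dots> = complex_of_real ((1 / norm z) powr (2 * \<delta> + 2)) * f (\<lambda>\<xi>. \<phi> (cm (cis t) \<xi>))"
    unfolding f_def using z by (subst (1 2) hom_xi[OF \<phi>t]) (auto simp: algebra_simps)
  also have "f (\<lambda>\<xi>. \<phi> (cm (cis t) \<xi>)) = f \<phi>" by (rule rotation_invariant[OF f f_angular \<phi>])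
  also have "(1 / norm z) powr (2 * \<delta> + 2) = norm z powr (- (2 * \<delta> + 2))"
    unfolding powr_minus using z by (simp add: powr_divide inverse_eq_divide)
  finally show ?thesis .
qed

lemma test_fun_divide_norm2:
  assumes \<phi>: "\<phi> \<in> test_fun" shows "(\<lambda>\<xi>. \<phi> \<xi> / complex_of_real ((norm \<xi>)\<^sup>2)) \<in> test_fun"
proof -
  obtain r R where r: "0 < r" "r \<le> R" and a: "on_ann r R \<phi>" by (rule test_fun_annE[OF \<phi>])
  \<comment> \<open>The added term vanishes for |\<xi>| \<ge> r, where \<phi> lives, and keeps the
    denominator positive inside, including the origin.\<close>
  let ?d = "\<lambda>\<xi>::plane. (norm \<xi>)\<^sup>2 + eb 0 (r\<^sup>2 - (norm \<xi>)\<^sup>2)"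
  have d: "?d \<xi> \<noteq> 0" for \<xi>
  proof (cases "norm \<xi> < r")
    case True
    then have "(norm \<xi>)\<^sup>2 < r\<^sup>2" by (intro power_strict_mono) auto
    then show ?thesis using eb_pos[of "r\<^sup>2 - (norm \<xi>)\<^sup>2"] by (smt (verit) zero_le_power2)
  next
    case False
    then have "0 < (norm \<xi>)\<^sup>2" using r(1) by auto
    then show ?thesis using eb_nonneg[of "r\<^sup>2 - (norm \<xi>)\<^sup>2"] by linarith
  qed
  have sm: "smooth (\<lambda>\<xi>. complex_of_real (inverse (?d \<xi>)))"
    by (intro smooth_of_real smooth_inverse smooth_add smooth_norm2 smooth_eb smooth_diff smooth_const d)
  have "\<phi> \<xi> / complex_of_real ((norm \<xi>)\<^sup>2) = complex_of_real (inverse (?d \<xi>)) * \<phi> \<xi>" for \<xi>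
  proof (cases "\<phi> \<xi> = 0")
    case False
    then have "r \<le> norm \<xi>" using a by (auto simp: on_ann_def)
    then have "r\<^sup>2 - (norm \<xi>)\<^sup>2 \<le> 0" using r(1) by (simp add: power_mono)
    then show ?thesis by (simp add: eb_zero divide_inverse)
  qed simp
  then show ?thesis using test_fun_mult[OF \<phi> sm] by simp
qed

text \<open>\<open>group_average\<close> against one fixed even bump expresses \<open>f\<close> as a
  multiple of integration against |\<xi>|^(2 \<delta>); dividing test functions by |\<xi>|^2
  recovers \<open>m\<close>. Reality applied to \<open>xi k\<close> times the real even bump shows
  that the value of \<open>f\<close> on the bump is imaginary.\<close>

lemma classification:
  assumes real: "\<And>l \<phi>. \<phi> \<in> test_fun \<Longrightarrow> m l (\<lambda>\<xi>. \<phi> (- \<xi>)) = cnj (m l (\<lambda>\<xi>. cnj (\<phi> \<xi>)))"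
  obtains k :: real where
    "\<And>\<phi>. \<phi> \<in> test_fun \<Longrightarrow> m 1 \<phi> = \<i> * complex_of_real k * (\<integral>\<xi>. xi 2 \<xi> * complex_of_real (norm \<xi> powr (2 * \<delta> - 2)) * \<phi> \<xi> \<partial>lborel)"
    "\<And>\<phi>. \<phi> \<in> test_fun \<Longrightarrow> m 2 \<phi> = - \<i> * complex_of_real k * (\<integral>\<xi>. xi 1 \<xi> * complex_of_real (norm \<xi> powr (2 * \<delta> - 2)) * \<phi> \<xi> \<partial>lborel)"
proof -
  obtain b where b: "on_ann (1 / 2) (2 * 2) b" "\<And>\<xi>. 1 \<le> norm \<xi> \<Longrightarrow> norm \<xi> \<le> 2 \<Longrightarrow> b \<xi> = 1"
      "\<And>\<xi>. b (- \<xi>) = b \<xi>" "\<And>\<xi>. \<exists>t\<ge>0. b \<xi> = complex_of_real t"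
    by (rule ann_bump[of 1 2]) auto
  have bt: "b \<in> test_fun" unfolding test_fun_iff using b(1) by (intro exI[of _ "1 / 2"]) auto
  obtain c where c: "c > 0" "(\<integral>s. inversion b s * complex_of_real (norm s powr (- (2 * \<delta> + 2))) \<partial>lborel) = complex_of_real c"
    using inversion_bump_integral[of "2 * \<delta> + 2" b] b \<delta>(1) by auto
  have cb: "cnj (b \<xi>) = b \<xi>" for \<xi> using b(4)[of \<xi>] by auto
  have nb: "cnj (m l (\<lambda>\<xi>. xi k \<xi> * b \<xi>)) = - m l (\<lambda>\<xi>. xi k \<xi> * b \<xi>)" for l k
    using real[OF test_fun_xi[OF bt, of k], of l] minus[OF test_fun_xi[OF bt, of k], of l] by (simp add: b(3) cb)
  have "cnj (f b) = - f b" unfolding f_def complex_cnj_diff nb by simp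
  then have "Re (f b) = 0" by (simp add: complex_eq_iff)
  then have fb: "f b = \<i> * complex_of_real (Im (f b))" by (simp add: complex_eq_iff)
  define k where "k = Im (f b) / c"
  have f_eq: "f \<phi> = \<i> * complex_of_real k * (\<integral>t. \<phi> t * complex_of_real (norm t powr (2 * \<delta>)) \<partial>lborel)" if "\<phi> \<in> test_fun" for \<phi>
  proof -
    have "f \<phi> * complex_of_real c = f b * (\<integral>t. \<phi> t * complex_of_real (norm t powr (2 * \<delta>)) \<partial>lborel)"
      using group_average[OF f f_hom bt that] unfolding c(2) by simp
    then show ?thesis using c(1) fb by (simp add: k_def field_simps)
  qed
  have p: "xi j t * (\<phi> t / complex_of_real ((norm t)\<^sup>2)) * complex_of_real (norm t powr (2 * \<delta>)) = xi j t * complex_of_real (norm t powr (2 * \<delta> - 2)) * \<phi> t" for j t and \<phi> :: "plane \<Rightarrow> complex"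
  proof (cases "t = 0")
    case False
    then have "norm t powr (2 * \<delta> - 2) = norm t powr (2 * \<delta>) / (norm t)\<^sup>2" by (simp add: powr_diff)
    then show ?thesis by simp
  qed simp
  have n: "(\<lambda>\<xi>. complex_of_real ((norm \<xi>)\<^sup>2) * (\<phi> \<xi> / complex_of_real ((norm \<xi>)\<^sup>2))) = \<phi>" if "\<phi> \<in> test_fun" for \<phi>
  proof
    fix \<xi>
    have "\<phi> 0 = 0" using that by (auto simp: test_fun_iff on_ann_def)
    then show "complex_of_real ((norm \<xi>)\<^sup>2) * (\<phi> \<xi> / complex_of_real ((norm \<xi>)\<^sup>2)) = \<phi> \<xi>" by (cases "\<xi> = 0") auto
  qed
  show ?thesis
  proof (rule that[of k])
    fix \<phi> assume \<phi>: "\<phi> \<in> test_fun"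
    note d = test_fun_divide_norm2[OF \<phi>]
    show "m 1 \<phi> = \<i> * complex_of_real k * (\<integral>\<xi>. xi 2 \<xi> * complex_of_real (norm \<xi> powr (2 * \<delta> - 2)) * \<phi> \<xi> \<partial>lborel)"
      using m_norm2(1)[OF d] unfolding n[OF \<phi>] f_eq[OF test_fun_xi[OF d]] p .
    show "m 2 \<phi> = - \<i> * complex_of_real k * (\<integral>\<xi>. xi 1 \<xi> * complex_of_real (norm \<xi> powr (2 * \<delta> - 2)) * \<phi> \<xi> \<partial>lborel)"
      using m_norm2(2)[OF d] unfolding n[OF \<phi>] f_eq[OF test_fun_xi[OF d]] p by simp
  qed
qed

end

section \<open>The three weights and the Biot--Savart law\<close>

context test_weight
begin

text \<open>Strips the constant \<open>c\<close> from the antisymmetry of \<open>b\<close>, leaving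
  the operator \<open>K\<close> in the shape expected by \<open>vanishing_forms\<close>.\<close>

lemma form_zero:
  assumes K: "\<And>l h. h \<in> test_fun \<Longrightarrow> Op (\<lambda>\<eta>. (\<i> * (\<eta> $ l)) * h \<eta>) = (\<lambda>\<xi>. c * K l h \<xi>)"
    "\<And>l h. h \<in> test_fun \<Longrightarrow> K l h \<in> test_fun"
    and "c \<noteq> 0" and g: "g \<in> test_fun" and h: "h \<in> test_fun"
  shows "(\<Sum>l\<in>UNIV. m l (\<lambda>\<xi>. g \<xi> * K l h (- \<xi>))) + (\<Sum>l\<in>UNIV. m l (\<lambda>\<xi>. h \<xi> * K l g (- \<xi>))) = 0"
proof -
  have *: "b g h = c * (\<Sum>l\<in>UNIV. m l (\<lambda>\<xi>. g \<xi> * K l h (- \<xi>)))" if g: "g \<in> test_fun" and h: "h \<in> test_fun" for g h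
  proof -
    have "(\<lambda>\<xi>. g \<xi> * K l h (- \<xi>)) \<in> test_fun" for l
      using test_fun_mult[OF g test_fun_smooth[OF test_fun_reflect[OF K(2)[OF h, of l]]]] by (simp add: mult.commute)
    then have "m l (\<lambda>\<xi>. c * (g \<xi> * K l h (- \<xi>))) = c * m l (\<lambda>\<xi>. g \<xi> * K l h (- \<xi>))" for l
      by (rule functional_cmult[OF m])
    then show ?thesis unfolding b_def K(1)[OF h] by (simp add: sum_distrib_left mult.left_commute[of _ c])
  qed
  show ?thesis
    using b_antisymmetric[OF g h] \<open>c \<noteq> 0\<close> unfolding *[OF g h] *[OF h g] by (simp flip: distrib_left)
qed

end

lemma inv_fourier_add:
  assumes "on_ann r R g" "on_ann r R h"
  shows "inv_fourier (\<lambda>\<xi>. g \<xi> + h \<xi>) x = inv_fourier g x + inv_fourier h x"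
proof -
  have "integrable lborel (\<lambda>\<xi>. cis (x \<bullet> \<xi>) * g \<xi>)" "integrable lborel (\<lambda>\<xi>. cis (x \<bullet> \<xi>) * h \<xi>)"
    by (rule rapid_integrable_0[OF on_ann_rapid[OF on_ann_cis_times]], rule assms)+
  then show ?thesis by (simp add: inv_fourier_def distrib_left add_divide_distrib)
qed

lemma pd_norm2_real: "pd l (\<lambda>x. (norm x)\<^sup>2) = (\<lambda>x. 2 * x $ l)"
proof
  fix x :: plane
  have "((\<lambda>x::plane. (norm x)\<^sup>2) has_derivative (\<lambda>h. 2 * (x \<bullet> h))) (at x)"
    unfolding power2_norm_eq_inner by (auto intro!: derivative_eq_intros simp: inner_commute)
  from pd_eqI[OF this, of l] show "pd l (\<lambda>x. (norm x)\<^sup>2) x = 2 * x $ l" by (simp add: inner_axis)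
qed

lemma norm_le_sqrt_1: "norm x \<le> sqrt (1 + (norm x)\<^sup>2)" for x :: plane
  by (rule real_le_rsqrt) simp

lemma test_weight_1:
  assumes "\<And>l. cont_functional (m l)"
    and "\<And>\<psi> \<theta>. \<psi> \<in> Cc_infty \<Longrightarrow> \<theta> \<in> S0 \<Longrightarrow> (\<And>x. \<theta> x \<in> \<real>) \<Longrightarrow>
      norm (B_form m \<psi> \<theta>) \<le> C * Linfty_norm (tf_hessian \<psi>) * H \<theta>"
  shows "test_weight m C H (\<lambda>_. 1) (\<lambda>g. g)"
  by unfold_locales (auto intro: assms simp: tf_hessian_def vec_eq_iff)

lemma test_weight_component:
  assumes "\<And>l. cont_functional (m l)"
    and "\<And>\<psi> \<theta>. \<psi> \<in> Cc_infty \<Longrightarrow> \<theta> \<in> S0 \<Longrightarrow> (\<And>x. \<theta> x \<in> \<real>) \<Longrightarrow>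
      norm (B_form m \<psi> \<theta>) \<le> C * Linfty_norm (tf_hessian \<psi>) * H \<theta>"
  shows "test_weight m C H (\<lambda>x. x $ j) (\<lambda>g \<xi>. \<i> * pd j g \<xi>)"
proof
  show "\<bar>x $ j\<bar> \<le> 1 + (norm x)\<^sup>2" for x :: plane
  proof -
    \<comment> \<open>From (t - 1)^2 + t^2 \<ge> 0 with t = |x|.\<close>
    have "norm x \<le> 1 + (norm x)\<^sup>2"
      using sum_squares_ge_zero[of "norm x - 1" "norm x"] by (simp add: power2_eq_square algebra_simps)
    then show ?thesis using component_le_norm_cart[of x j] by linarith
  qed
  show "\<bar>pd i (\<lambda>x. x $ j) x\<bar> \<le> 2 * sqrt (1 + (norm x)\<^sup>2)" for i and x :: plane
  proof -
    have "1 \<le> sqrt (1 + (norm x)\<^sup>2)" by simp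
    then have "1 \<le> 2 * sqrt (1 + (norm x)\<^sup>2)" by linarith
    then show ?thesis unfolding pd_component by auto
  qed
  show "on_ann r R (\<lambda>\<xi>. \<i> * pd j g \<xi>)" if "on_ann r R g" for r R g
    by (intro on_ann_mult on_ann_pd that smooth_const)
  show "complex_of_real (x $ j) * inv_fourier g x = inv_fourier (\<lambda>\<xi>. \<i> * pd j g \<xi>) x" if "on_ann r R g" for r R g x
    by (rule inv_fourier_smooth_pd(4)[OF that])
  show "(\<lambda>\<xi>. \<i> * pd j (\<lambda>\<xi>. g \<xi> + h \<xi>) \<xi>) = (\<lambda>\<xi>. \<i> * pd j g \<xi> + \<i> * pd j h \<xi>)" if "smooth g" "smooth h" for g h :: "plane \<Rightarrow> complex"
    using that by (simp add: pd_add smooth_differentiable distrib_left)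
  show "(\<lambda>\<xi>. \<i> * pd j (\<lambda>\<xi>. c * g \<xi>) \<xi>) = (\<lambda>\<xi>. c * (\<i> * pd j g \<xi>))" if "smooth g" for g :: "plane \<Rightarrow> complex" and c
    by (rule ext) (simp only: pd_linear[OF bounded_linear_mult_right smooth_differentiable[OF that]] mult.left_commute)
qed (auto intro: assms smooth_component simp: tf_hessian_def vec_eq_iff pd_component)

lemma test_weight_norm2:
  assumes "\<And>l. cont_functional (m l)"
    and "\<And>\<psi> \<theta>. \<psi> \<in> Cc_infty \<Longrightarrow> \<theta> \<in> S0 \<Longrightarrow> (\<And>x. \<theta> x \<in> \<real>) \<Longrightarrow>
      norm (B_form m \<psi> \<theta>) \<le> C * Linfty_norm (tf_hessian \<psi>) * H \<theta>"
  shows "test_weight m C H (\<lambda>x. (norm x)\<^sup>2) (\<lambda>g \<xi>. - (\<Sum>a\<in>UNIV. pd a (pd a g) \<xi>))"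
proof
  have p2: "pd j (\<lambda>x. 2 * x $ l) x = 2 * (if l = j then 1 else 0)" for j l and x :: plane
    by (simp add: pd_linear[OF bounded_linear_mult_right smooth_differentiable[OF smooth_component]] pd_component)
  show "tf_hessian (\<lambda>x. (norm x)\<^sup>2) x = 0" for x
    by (simp add: tf_hessian_def vec_eq_iff pd_norm2_real p2 sum_2)
  show "\<bar>pd i (\<lambda>x. (norm x)\<^sup>2) x\<bar> \<le> 2 * sqrt (1 + (norm x)\<^sup>2)" for i and x :: plane
    unfolding pd_norm2_real using component_le_norm_cart[of x i] norm_le_sqrt_1[of x] by (simp add: abs_mult)
  show "on_ann r R (\<lambda>\<xi>. - (\<Sum>a\<in>UNIV. pd a (pd a g) \<xi>))" if "on_ann r R g" for r R g
    unfolding sum_2 by (intro on_ann_minus on_ann_add on_ann_pd that)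
  show "complex_of_real ((norm x)\<^sup>2) * inv_fourier g x = inv_fourier (\<lambda>\<xi>. - (\<Sum>a\<in>UNIV. pd a (pd a g) \<xi>)) x"
    if g: "on_ann r R g" for r R g x
  proof -
    have c: "complex_of_real (x $ j) * (complex_of_real (x $ j) * inv_fourier g x) = inv_fourier (\<lambda>\<xi>. - pd j (pd j g) \<xi>) x" for j
    proof -
      have i: "on_ann r R (\<lambda>\<xi>. \<i> * pd j g \<xi>)" by (intro on_ann_mult on_ann_pd g smooth_const)
      have "pd j (\<lambda>\<xi>. \<i> * pd j g \<xi>) = (\<lambda>\<xi>. \<i> * pd j (pd j g) \<xi>)"
        by (rule ext) (intro pd_linear[OF bounded_linear_mult_right] smooth_differentiable smooth_pd on_ann_smooth[OF g])
      then show ?thesis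
        unfolding inv_fourier_smooth_pd(4)[OF g] inv_fourier_smooth_pd(4)[OF i] by (simp add: mult.assoc[symmetric])
    qed
    have "inv_fourier (\<lambda>\<xi>. - (\<Sum>a\<in>UNIV. pd a (pd a g) \<xi>)) x = inv_fourier (\<lambda>\<xi>. - pd 1 (pd 1 g) \<xi> + - pd 2 (pd 2 g) \<xi>) x"
      by (simp add: sum_2)
    also have "\<dots> = inv_fourier (\<lambda>\<xi>. - pd 1 (pd 1 g) \<xi>) x + inv_fourier (\<lambda>\<xi>. - pd 2 (pd 2 g) \<xi>) x"
      by (intro inv_fourier_add[of r R] on_ann_minus on_ann_pd g)
    also have "\<dots> = (complex_of_real (x $ 1) * complex_of_real (x $ 1) + complex_of_real (x $ 2) * complex_of_real (x $ 2)) * inv_fourier g x"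
      unfolding c[symmetric] by (simp add: algebra_simps)
    also have "complex_of_real (x $ 1) * complex_of_real (x $ 1) + complex_of_real (x $ 2) * complex_of_real (x $ 2) = complex_of_real ((norm x)\<^sup>2)"
      unfolding power2_norm_eq_inner inner_vec_def sum_2 by simp
    finally show ?thesis by simp
  qed
  show "(\<lambda>\<xi>. - (\<Sum>a\<in>UNIV. pd a (pd a (\<lambda>\<xi>. g \<xi> + h \<xi>)) \<xi>)) = (\<lambda>\<xi>. - (\<Sum>a\<in>UNIV. pd a (pd a g) \<xi>) + - (\<Sum>a\<in>UNIV. pd a (pd a h) \<xi>))"
    if "smooth g" "smooth h" for g h :: "plane \<Rightarrow> complex"
  proof -
    have "pd a (\<lambda>\<xi>. g \<xi> + h \<xi>) = (\<lambda>\<xi>. pd a g \<xi> + pd a h \<xi>)" for a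
      by (rule ext) (intro pd_add smooth_differentiable that)
    then show ?thesis using that by (simp add: pd_add smooth_differentiable smooth_pd sum.distrib)
  qed
  show "(\<lambda>\<xi>. - (\<Sum>a\<in>UNIV. pd a (pd a (\<lambda>\<xi>. c * g \<xi>)) \<xi>)) = (\<lambda>\<xi>. c * - (\<Sum>a\<in>UNIV. pd a (pd a g) \<xi>))"
    if "smooth g" for g :: "plane \<Rightarrow> complex" and c
  proof -
    have "pd a (\<lambda>\<xi>. c * g \<xi>) = (\<lambda>\<xi>. c * pd a g \<xi>)" for a
      by (rule ext) (intro pd_linear[OF bounded_linear_mult_right] smooth_differentiable that)
    then show ?thesis
      using that by (simp add: pd_linear[OF bounded_linear_mult_right] smooth_differentiable smooth_pd sum_distrib_left)
  qed
qed (auto intro: assms smooth_norm2)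

lemma vanishing_forms_of_bound:
  assumes \<delta>: "\<delta> \<ge> 0" "\<delta> \<noteq> 1" and m: "\<And>l. cont_functional (m l)"
    and hom: "\<And>l. homogeneous_distr (- 1 + 2 * \<delta>) (m l)"
    and bound: "\<And>\<psi> \<theta>. \<psi> \<in> Cc_infty \<Longrightarrow> \<theta> \<in> S0 \<Longrightarrow> (\<And>x. \<theta> x \<in> \<real>) \<Longrightarrow>
      norm (B_form m \<psi> \<theta>) \<le> C * Linfty_norm (tf_hessian \<psi>) * H \<theta>"
  shows "vanishing_forms m \<delta>"
proof
  fix g h assume g: "g \<in> test_fun" and h: "h \<in> test_fun"
  have ass: "(\<lambda>\<eta>. (\<i> * xi l \<eta>) * f \<eta>) = (\<lambda>\<eta>. \<i> * (xi l \<eta> * f \<eta>))" for f :: "plane \<Rightarrow> complex" and l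
    by (simp add: mult.assoc)
  have pc: "pd j (\<lambda>\<eta>. \<i> * f \<eta>) = (\<lambda>\<eta>. \<i> * pd j f \<eta>)" if "smooth f" for f :: "plane \<Rightarrow> complex" and j
    by (rule ext) (intro pd_linear[OF bounded_linear_mult_right] smooth_differentiable that)
  have sx: "smooth (\<lambda>\<eta>. xi l \<eta> * f \<eta>)" if "f \<in> test_fun" for f l
    by (intro smooth_mult smooth_complex_component test_fun_smooth that)
  interpret W1: test_weight m C H "\<lambda>_. 1" "\<lambda>g. g" by (rule test_weight_1[OF m bound])
  show "(\<Sum>l\<in>UNIV. m l (\<lambda>\<xi>. g \<xi> * (xi l (- \<xi>) * h (- \<xi>)))) + (\<Sum>l\<in>UNIV. m l (\<lambda>\<xi>. h \<xi> * (xi l (- \<xi>) * g (- \<xi>)))) = 0"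
    by (rule W1.form_zero[where K="\<lambda>l h \<xi>. xi l \<xi> * h \<xi>" and c=\<i>, OF _ _ _ g h]) (auto simp: ass intro: test_fun_xi)
  show "(\<Sum>l\<in>UNIV. m l (\<lambda>\<xi>. g \<xi> * pd j (\<lambda>\<eta>. xi l \<eta> * h \<eta>) (- \<xi>))) + (\<Sum>l\<in>UNIV. m l (\<lambda>\<xi>. h \<xi> * pd j (\<lambda>\<eta>. xi l \<eta> * g \<eta>) (- \<xi>))) = 0" for j
  proof -
    interpret Wx: test_weight m C H "\<lambda>x. x $ j" "\<lambda>g \<xi>. \<i> * pd j g \<xi>" by (rule test_weight_component[OF m bound])
    show ?thesis
      by (rule Wx.form_zero[where K="\<lambda>l h. pd j (\<lambda>\<eta>. xi l \<eta> * h \<eta>)" and c="- 1", OF _ _ _ g h])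
        (auto simp: ass pc sx intro: test_fun_pd test_fun_xi)
  qed
  interpret Wq: test_weight m C H "\<lambda>x. (norm x)\<^sup>2" "\<lambda>g \<xi>. - (\<Sum>a\<in>UNIV. pd a (pd a g) \<xi>)"
    by (rule test_weight_norm2[OF m bound])
  show "(\<Sum>l\<in>UNIV. m l (\<lambda>\<xi>. g \<xi> * (\<Sum>a\<in>UNIV. pd a (pd a (\<lambda>\<eta>. xi l \<eta> * h \<eta>)) (- \<xi>))))
      + (\<Sum>l\<in>UNIV. m l (\<lambda>\<xi>. h \<xi> * (\<Sum>a\<in>UNIV. pd a (pd a (\<lambda>\<eta>. xi l \<eta> * g \<eta>)) (- \<xi>)))) = 0"
    by (rule Wq.form_zero[where K="\<lambda>l h \<xi>. \<Sum>a\<in>UNIV. pd a (pd a (\<lambda>\<eta>. xi l \<eta> * h \<eta>)) \<xi>" and c="- \<i>", OF _ _ _ g h])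
      (auto simp: ass pc sx smooth_pd sum_distrib_left sum_negf intro!: test_fun_sum test_fun_pd test_fun_xi)
next
  fix l \<phi> and t :: real assume "\<phi> \<in> test_fun" "t > 0"
  then show "m l (\<lambda>\<xi>. \<phi> ((1 / t) *\<^sub>R \<xi>)) = complex_of_real (t powr (2 * \<delta> + 1)) * m l \<phi>"
    using hom[of l] unfolding homogeneous_distr_def by (simp add: add.commute)
qed (use \<delta> m in auto)

text \<open>The symbol |\<xi>|^(2 \<delta> - 2) may be singular at the origin, but the Fourier
  transform of \<theta> lives on an annulus, so the product is rapidly decreasing and can be
  differentiated under the integral, where a derivative brings down \<i> times a frequency
  coordinate.\<close>

lemma biot_savart_eq:
  fixes \<delta> :: real
  assumes \<theta>: "\<theta> \<in> S0"
  defines "I \<equiv> \<lambda>a x. \<integral>\<xi>. xi a \<xi> * complex_of_real (norm \<xi> powr (2 * \<delta> - 2)) * (cis (x \<bullet> \<xi>) * fourier \<theta> \<xi>) \<partial>lborel"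
  shows "biot_savart \<delta> 1 \<theta> x = - \<i> * I 2 x / complex_of_real ((2 * pi)\<^sup>2)"
    and "biot_savart \<delta> 2 \<theta> x = \<i> * I 1 x / complex_of_real ((2 * pi)\<^sup>2)"
proof -
  let ?c = "1 / complex_of_real ((2 * pi)\<^sup>2)"
  define G where "G \<xi> = complex_of_real (norm \<xi> powr (2 * (- 1 + \<delta>))) * fourier \<theta> \<xi>" for \<xi>
  obtain r R where r: "0 < r" "r \<le> R" and g: "on_ann r R (fourier \<theta>)" by (rule test_fun_annE[OF fourier_S0[OF \<theta>]])
  obtain B where B: "B \<ge> 0" "\<And>\<xi>. norm (fourier \<theta> \<xi>) \<le> B" by (rule on_ann_bounded[OF g]) blast
  have G: "rapid G"
  proof (rule rapid_bounded_support)
    show "G \<in> borel_measurable borel"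
      unfolding G_def using smooth_measurable[OF on_ann_smooth[OF g]] by measurable
    let ?a = "2 * (- 1 + \<delta>)"
    show "norm (G \<xi>) \<le> (r powr ?a + R powr ?a) * B" for \<xi>
    proof (cases "fourier \<theta> \<xi> = 0")
      case False
      then have n: "r \<le> norm \<xi>" "norm \<xi> \<le> R" using g by (auto simp: on_ann_def)
      \<comment> \<open>The power is monotone in one direction or the other, so its maximum on the
        annulus is taken at an end point; the sum covers both signs of the exponent.\<close>
      have "norm \<xi> powr ?a \<le> r powr ?a + R powr ?a"
      proof (cases "?a \<ge> 0")
        case True
        then have "norm \<xi> powr ?a \<le> R powr ?a" using n by (intro powr_mono2) auto
        then show ?thesis using powr_ge_zero[of r ?a] by linarith
      next
        case False
        then have "norm \<xi> powr ?a \<le> r powr ?a" using n r by (intro powr_mono2') auto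
        then show ?thesis using powr_ge_zero[of R ?a] by linarith
      qed
      then show ?thesis unfolding G_def norm_mult using B by (intro mult_mono) auto
    qed (use B in \<open>simp add: G_def\<close>)
    show "G \<xi> = 0" if "norm \<xi> > R" for \<xi> using g that by (auto simp: on_ann_def G_def)
  qed
  have "frac_laplacian (- 1 + \<delta>) \<theta> = (\<lambda>x. ?c * ft 1 G x)"
    by (simp add: frac_laplacian_def multiplier_def inv_fourier_ft G_def[abs_def])
  then have "pd a (frac_laplacian (- 1 + \<delta>) \<theta>) x = ?c * ft 1 (\<lambda>\<xi>. (\<i> * 1 * (\<xi> $ a)) * G \<xi>) x" for a
    using pd_linear[OF bounded_linear_mult_right smooth_differentiable[OF ft_smooth_and_pd(1)[OF G]], of a ?c 1 x]
    by (simp only: ft_smooth_and_pd(2)[OF G] of_real_1)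
  moreover have "ft 1 (\<lambda>\<xi>. (\<i> * 1 * (\<xi> $ a)) * G \<xi>) x = \<i> * I a x" for a
  proof -
    have "ft 1 (\<lambda>\<xi>. (\<i> * 1 * (\<xi> $ a)) * G \<xi>) x = (\<integral>\<xi>. \<i> * (xi a \<xi> * complex_of_real (norm \<xi> powr (2 * \<delta> - 2)) * (cis (x \<bullet> \<xi>) * fourier \<theta> \<xi>)) \<partial>lborel)"
      unfolding ft_def G_def
      by (intro Bochner_Integration.integral_cong) (simp_all add: inner_commute algebra_simps)
    then show ?thesis unfolding I_def by simp
  qed
  ultimately have p: "pd a (frac_laplacian (- 1 + \<delta>) \<theta>) x = \<i> * I a x / complex_of_real ((2 * pi)\<^sup>2)" for a by simp
  show "biot_savart \<delta> 1 \<theta> x = - \<i> * I 2 x / complex_of_real ((2 * pi)\<^sup>2)"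
    "biot_savart \<delta> 2 \<theta> x = \<i> * I 1 x / complex_of_real ((2 * pi)\<^sup>2)"
    unfolding biot_savart_def p sum_2 by (simp_all add: eps_def)
qed

theorem theorem12:
  fixes \<delta> :: real and m :: "2 \<Rightarrow> distr" and c :: "plane \<Rightarrow> complex"
  assumes "\<delta> \<ge> 0" and "\<delta> \<noteq> 1"
    and "LP_cutoff c"
    and "\<And>l. distribution (m l)"
    and "\<And>l. homogeneous_distr (- 1 + 2 * \<delta>) (m l)"
    and "\<And>l. reality_cond (m l)"
    and "\<exists>C::real. \<forall>\<psi>\<in>Cc_infty. \<forall>\<theta>\<in>S0. (\<forall>x. \<theta> x \<in> \<real>) \<longrightarrow>
           norm (B_form m \<psi> \<theta>)
             \<le> C * Linfty_norm (tf_hessian \<psi>) * (Hdot_norm c (- 1 + \<delta>) \<theta>)\<^sup>2"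
  shows "\<exists>\<kappa>::real. \<forall>l. \<forall>\<theta>\<in>S0. \<forall>x.
           distr_multiplier (m l) \<theta> x = complex_of_real \<kappa> * biot_savart \<delta> l \<theta> x"
proof -
  obtain C where C: "\<And>\<psi> \<theta>. \<psi> \<in> Cc_infty \<Longrightarrow> \<theta> \<in> S0 \<Longrightarrow> (\<And>x. \<theta> x \<in> \<real>) \<Longrightarrow>
      norm (B_form m \<psi> \<theta>) \<le> C * Linfty_norm (tf_hessian \<psi>) * (Hdot_norm c (- 1 + \<delta>) \<theta>)\<^sup>2"
    using assms(7) by blast
  interpret vanishing_forms m \<delta>
    by (rule vanishing_forms_of_bound[OF assms(1,2) distribution_cont_functional[OF assms(4)] assms(5) C])
  obtain k :: real where k:
    "\<And>\<phi>. \<phi> \<in> test_fun \<Longrightarrow> m 1 \<phi> = \<i> * complex_of_real k * (\<integral>\<xi>. xi 2 \<xi> * complex_of_real (norm \<xi> powr (2 * \<delta> - 2)) * \<phi> \<xi> \<partial>lborel)"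
    "\<And>\<phi>. \<phi> \<in> test_fun \<Longrightarrow> m 2 \<phi> = - \<i> * complex_of_real k * (\<integral>\<xi>. xi 1 \<xi> * complex_of_real (norm \<xi> powr (2 * \<delta> - 2)) * \<phi> \<xi> \<partial>lborel)"
    by (rule classification) (use assms(6) in \<open>auto simp: reality_cond_def\<close>)
  \<comment> \<open>The first component of the Biot--Savart law carries -\<i> where
    \<open>m 1\<close> carries \<i> k, and the second the opposite signs, hence the constant
    -k.\<close>
  have "distr_multiplier (m l) \<theta> x = complex_of_real (- k) * biot_savart \<delta> l \<theta> x" if \<theta>: "\<theta> \<in> S0" for l \<theta> x
  proof -
    have t: "(\<lambda>\<xi>. cis (x \<bullet> \<xi>) * fourier \<theta> \<xi>) \<in> test_fun"
      by (rule test_fun_mult[OF fourier_S0[OF \<theta>] smooth_cis_1])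
    consider "l = 1" | "l = 2" using exhaust_2 by blast
    then show ?thesis
      by cases (simp_all add: distr_multiplier_eq k[OF t] biot_savart_eq[OF \<theta>])
  qed
  then show ?thesis by blast
qed

end
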